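(* Let $(X,J,\overline{\omega},f)$ be a gradient steady Kähler–Ricci soliton with associated holomorphic volume form $\Omega_f$, and let $F:L\to X$ be an $f$-special Lagrangian submanifold with phase $\theta_0$. Then a normal vector field $\xi\in\Gamma(NL)$ is an $f$-special Lagrangian deformation vector field if and only if it satisfies the $f$-harmonic $1$-form equation $$d\,\widetilde{\omega}(\xi)=d^{*}_{f}\,\widetilde{\omega}(\xi)=0.$$
   Context: $(X,J,\overline{\omega})$ is a connected Kähler manifold of real dimension $2m$ with Kähler metric $\overline{g}$; a gradient steady Kähler–Ricci soliton structure is a smooth $f:X\to\mathbb{R}$ with $\overline{\mathrm{Ric}}+\overline{\mathrm{Hess}}f=0$. $\Omega_f$ is a nonvanishing holomorphic $(m,0)$-form on $X$ with $e^{-f}\frac{\overline{\omega}^{m}}{m!}=(-1)^{\frac{m(m-1)}{2}}\left(\frac{i}{2}\right)^{m}\Omega_{f}\wedge\overline{\Omega_{f}}$ (such a form is associated to the soliton by a result of Bryant). Submanifolds are immersed, oriented, connected. An $m$-dimensional submanifold $F:L\to X$ with induced metric $g$ is $f$-special Lagrangian with phase $\theta_0\in\mathbb{R}/2\pi\mathbb{Z}$ if $F^{*}\mathrm{Re}(e^{-i\theta_0}\Omega_f)=e^{-\frac12F^{*}f}dV_g$; equivalently, $F$ is Lagrangian ($F^*\overline{\omega}=0$) and $F^{*}\Omega_f=e^{i\theta_0}e^{-\frac12F^*f}dV_g$. A normal field $\xi$ is an $f$-special Lagrangian deformation vector field if, for a smooth family of immersions $\{F_t\}$ with $F_0=F$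 and $\frac{d}{dt}|_{t=0}F_t=\xi$, one has $\frac{d}{dt}\big|_{t=0}F_t^{*}\overline{\omega}=\frac{d}{dt}\big|_{t=0}F_t^{*}\mathrm{Im}(e^{-i\theta_0}\Omega_f)=0$. $\widetilde{\omega}(\xi):=F^{*}(\iota_{\xi}\overline{\omega})$, and $d^{*}_{f}=d^{*}_{g}+\frac12\iota_{\nabla (F^{*}f)}$ is the formal adjoint of $d$ with respect to the weighted measure $e^{-\frac12F^{*}f}dV_g$ on $L$. *)

theory Defs
  imports "HOL-Analysis.Analysis"
begin

section \<open>Smooth maps between open subsets of normed spaces\<close>

text \<open>For open \<open>S\<close>, being \<open>k\<close> times continuously differentiable is expressed through iterated
  directional derivatives (adequate since all domains below are finite-dimensional).\<close>

primrec Ck_on :: "nat \<Rightarrow> 'a::euclidean_space set \<Rightarrow> ('a \<Rightarrow> 'b::real_normed_vector) \<Rightarrow> bool" where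
  "Ck_on 0 S u \<longleftrightarrow> continuous_on S u"
| "Ck_on (Suc k) S u \<longleftrightarrow>
     (\<forall>x\<in>S. u differentiable (at x)) \<and> (\<forall>v. Ck_on k S (\<lambda>x. frechet_derivative u (at x) v))"

definition smooth_on :: "'a::euclidean_space set \<Rightarrow> ('a \<Rightarrow> 'b::real_normed_vector) \<Rightarrow> bool" where
  "smooth_on S u \<longleftrightarrow> open S \<and> (\<forall>k. Ck_on k S u)"


section \<open>Manifolds\<close>

text \<open>A manifold is a second countable Hausdorff type \<open>'p\<close> with an atlas, not necessarily maximal.
  A chart is a pair of an open domain and a coordinate map, the latter relevant only on that
  domain.\<close>

type_synonym ('p, 'e) chart = "'p set \<times> ('p \<Rightarrow> 'e)"

definition chart_dom :: "('p, 'e) chart \<Rightarrow> 'p set" where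
  "chart_dom c = fst c"

definition coord :: "('p, 'e) chart \<Rightarrow> 'p \<Rightarrow> 'e" where
  "coord c = snd c"

definition chart_img :: "('p, 'e) chart \<Rightarrow> 'e set" where
  "chart_img c = coord c ` chart_dom c"

definition param :: "('p, 'e) chart \<Rightarrow> 'e \<Rightarrow> 'p" where
  "param c = inv_into (chart_dom c) (coord c)"

definition transition :: "('p, 'e) chart \<Rightarrow> ('p, 'e) chart \<Rightarrow> 'e \<Rightarrow> 'e" where
  "transition c d = coord d \<circ> param c"

text \<open>The derivative of the coordinate change from \<open>c\<close> to \<open>d\<close> at the point \<open>p\<close>.\<close>

definition dtrans :: "('p, 'e::euclidean_space) chart \<Rightarrow> ('p, 'e) chart \<Rightarrow> 'p \<Rightarrow> 'e \<Rightarrow> 'e" where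
  "dtrans c d p = frechet_derivative (transition c d) (at (coord c p))"

definition is_chart :: "('p::topological_space, 'e::euclidean_space) chart \<Rightarrow> bool" where
  "is_chart c \<longleftrightarrow> open (chart_dom c) \<and> open (chart_img c) \<and>
     homeomorphism (chart_dom c) (chart_img c) (coord c) (param c)"

definition smooth_atlas ::
    "('p::{t2_space,second_countable_topology}, 'e::euclidean_space) chart set \<Rightarrow> bool" where
  "smooth_atlas A \<longleftrightarrow> (\<forall>c\<in>A. is_chart c) \<and> (\<Union>c\<in>A. chart_dom c) = UNIV \<and>
     (\<forall>c\<in>A. \<forall>d\<in>A. smooth_on (coord c ` (chart_dom c \<inter> chart_dom d)) (transition c d))"

definition oriented_atlas ::
    "('p::{t2_space,second_countable_topology}, real^'m) chart set \<Rightarrow> bool" where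
  "oriented_atlas A \<longleftrightarrow> smooth_atlas A \<and>
     (\<forall>c\<in>A. \<forall>d\<in>A. \<forall>p\<in>chart_dom c \<inter> chart_dom d. det (matrix (dtrans c d p)) > 0)"

text \<open>In a holomorphic chart the complex structure is multiplication by the imaginary unit.\<close>

definition cplx_J :: "complex^'m \<Rightarrow> complex^'m" where
  "cplx_J v = \<i> *s v"

definition holomorphic_atlas ::
    "('p::{t2_space,second_countable_topology}, complex^'m) chart set \<Rightarrow> bool" where
  "holomorphic_atlas A \<longleftrightarrow> smooth_atlas A \<and>
     (\<forall>c\<in>A. \<forall>d\<in>A. \<forall>p\<in>chart_dom c \<inter> chart_dom d. \<forall>v.
        dtrans c d p (cplx_J v) = cplx_J (dtrans c d p v))"

definition smooth_function ::
    "('p, 'e::euclidean_space) chart set \<Rightarrow> ('p \<Rightarrow> real) \<Rightarrow> bool" where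
  "smooth_function A u \<longleftrightarrow> (\<forall>c\<in>A. smooth_on (chart_img c) (u \<circ> param c))"


section \<open>Tensor fields\<close>

text \<open>A tensor field is the family of its expressions in the charts of an atlas: its first argument
  is a chart \<open>c\<close>, its second a point of \<open>chart_img c\<close>, and tangent vectors are given by their
  components in \<open>c\<close>. A \<open>k\<close>-form is evaluated on a sequence of vectors of which only the
  entries \<open>0, \<dots>, k - 1\<close> matter.\<close>

type_synonym ('e, 'b) local_form = "'e \<Rightarrow> (nat \<Rightarrow> 'e) \<Rightarrow> 'b"
type_synonym 'e local_metric = "'e \<Rightarrow> 'e \<Rightarrow> 'e \<Rightarrow> real"
type_synonym ('p, 'e, 'b) form = "('p, 'e) chart \<Rightarrow> ('e, 'b) local_form"
type_synonym ('p, 'e) tensor2 = "('p, 'e) chart \<Rightarrow> 'e local_metric"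

text \<open>Wedge product of a \<open>k\<close>-form and an \<open>l\<close>-form at a point, normalised so that
  \<open>dx \<and> dy\<close> is \<open>1\<close> on the coordinate frame.\<close>

definition wedge :: "nat \<Rightarrow> nat \<Rightarrow> ((nat \<Rightarrow> 'v) \<Rightarrow> 'b::real_normed_field) \<Rightarrow>
    ((nat \<Rightarrow> 'v) \<Rightarrow> 'b) \<Rightarrow> (nat \<Rightarrow> 'v) \<Rightarrow> 'b" where
  "wedge k l \<alpha> \<beta> v = (\<Sum>\<sigma> | \<sigma> permutes {..<k + l}.
     of_int (sign \<sigma>) * \<alpha> (\<lambda>i. v (\<sigma> i)) * \<beta> (\<lambda>i. v (\<sigma> (k + i)))) / (fact k * fact l)"

text \<open>The \<open>n\<close>-th exterior power of a \<open>2\<close>-form.\<close>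

primrec wedge_power :: "nat \<Rightarrow> ((nat \<Rightarrow> 'v) \<Rightarrow> 'b::real_normed_field) \<Rightarrow> (nat \<Rightarrow> 'v) \<Rightarrow> 'b" where
  "wedge_power 0 \<alpha> = (\<lambda>v. 1)"
| "wedge_power (Suc n) \<alpha> = wedge 2 (2 * n) \<alpha> (wedge_power n \<alpha>)"

text \<open>Exterior derivative of a \<open>k\<close>-form in coordinates, evaluated on constant vector fields.\<close>

definition ext_deriv :: "nat \<Rightarrow> ('e::euclidean_space, 'b::real_normed_field) local_form \<Rightarrow>
    ('e, 'b) local_form" where
  "ext_deriv k \<alpha> y v = (\<Sum>i\<le>k. (-1) ^ i *
     frechet_derivative (\<lambda>z. \<alpha> z (\<lambda>j. v (if j < i then j else Suc j))) (at y) (v i))"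

definition interior_product :: "'v \<Rightarrow> ((nat \<Rightarrow> 'v) \<Rightarrow> 'b) \<Rightarrow> (nat \<Rightarrow> 'v) \<Rightarrow> 'b" where
  "interior_product x \<alpha> v = \<alpha> (case_nat x v)"


section \<open>Riemannian geometry in a chart\<close>

text \<open>Here \<open>g\<close> is the expression of a metric in one chart. The vector representing the
  functional \<open>u\<close> with respect to \<open>g\<close> at \<open>y\<close>:\<close>

definition sharp :: "'e::euclidean_space local_metric \<Rightarrow> 'e \<Rightarrow> ('e \<Rightarrow> real) \<Rightarrow> 'e" where
  "sharp g y u = (THE z. \<forall>w. g y z w = u w)"

definition gradient :: "'e::euclidean_space local_metric \<Rightarrow> ('e \<Rightarrow> real) \<Rightarrow> 'e \<Rightarrow> 'e" where
  "gradient g u y = sharp g y (frechet_derivative u (at y))"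

text \<open>The Levi-Civita derivative of the constant field \<open>w\<close> in direction \<open>v\<close>, by the
  Koszul formula.\<close>

definition christoffel :: "'e::euclidean_space local_metric \<Rightarrow> 'e \<Rightarrow> 'e \<Rightarrow> 'e \<Rightarrow> 'e" where
  "christoffel g y v w = sharp g y (\<lambda>u.
     (frechet_derivative (\<lambda>z. g z w u) (at y) v
      + frechet_derivative (\<lambda>z. g z v u) (at y) w
      - frechet_derivative (\<lambda>z. g z v w) (at y) u) / 2)"

text \<open>\<open>R(u, v) w = \<nabla>\<^sub>u \<nabla>\<^sub>v w - \<nabla>\<^sub>v \<nabla>\<^sub>u w\<close> for constant fields \<open>u, v, w\<close>.\<close>

definition riemann ::
    "'e::euclidean_space local_metric \<Rightarrow> 'e \<Rightarrow> 'e \<Rightarrow> 'e \<Rightarrow> 'e \<Rightarrow> 'e" where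
  "riemann g y u v w =
     frechet_derivative (\<lambda>z. christoffel g z v w) (at y) u
     - frechet_derivative (\<lambda>z. christoffel g z u w) (at y) v
     + christoffel g y u (christoffel g y v w) - christoffel g y v (christoffel g y u w)"

definition ricci :: "'e::euclidean_space local_metric \<Rightarrow> 'e \<Rightarrow> 'e \<Rightarrow> 'e \<Rightarrow> real" where
  "ricci g y v w = (\<Sum>b\<in>Basis. riemann g y b v w \<bullet> b)"

definition hessian ::
    "'e::euclidean_space local_metric \<Rightarrow> ('e \<Rightarrow> real) \<Rightarrow> 'e \<Rightarrow> 'e \<Rightarrow> 'e \<Rightarrow> real" where
  "hessian g u y v w =
     frechet_derivative (\<lambda>z. frechet_derivative u (at z) w) (at y) v
     - frechet_derivative u (at y) (christoffel g y v w)"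

text \<open>The Riemannian volume form in an oriented chart. The linear order on \<open>'m\<close> serves to
  enumerate the coordinates of \<open>real^'m\<close>.\<close>

definition index_rank :: "'m::{finite,linorder} \<Rightarrow> nat" where
  "index_rank j = card {i. i < j}"

definition volume_form :: "(real^'m::{finite,linorder}) local_metric \<Rightarrow>
    (real^'m::{finite,linorder}, real) local_form" where
  "volume_form g y v = sqrt (det (\<chi> i j. g y (axis i 1) (axis j 1))) *
     det (\<chi> j. v (index_rank j))"

definition orthonormal_frame :: "(real^'m) local_metric \<Rightarrow>
    real^'m \<Rightarrow> (nat \<Rightarrow> real^'m) \<Rightarrow> bool" where
  "orthonormal_frame g y e \<longleftrightarrow>
     (\<forall>i<CARD('m). \<forall>j<CARD('m). g y (e i) (e j) = (if i = j then 1 else 0))"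

text \<open>The Hodge star of a \<open>k\<close>-form: contraction of the form with the first \<open>k\<close> slots of the
  volume form. The value does not depend on the orthonormal frame \<open>e\<close> that is chosen.\<close>

definition hodge_star :: "(real^'m::{finite,linorder}) local_metric \<Rightarrow> nat \<Rightarrow>
    (real^'m::{finite,linorder}, real) local_form \<Rightarrow>
    (real^'m::{finite,linorder}, real) local_form" where
  "hodge_star g k \<alpha> y w = (let e = (SOME e. orthonormal_frame g y e) in
     (\<Sum>I \<in> {..<k} \<rightarrow>\<^sub>E {..<CARD('m)}.
        \<alpha> y (\<lambda>i. e (I i)) * volume_form g y (\<lambda>j. if j < k then e (I j) else w (j - k))) / fact k)"

definition codiff :: "(real^'m::{finite,linorder}) local_metric \<Rightarrow> nat \<Rightarrow>
    (real^'m::{finite,linorder}, real) local_form \<Rightarrow>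
    (real^'m::{finite,linorder}, real) local_form" where
  "codiff g k \<alpha> y w = (-1) ^ (CARD('m) * (k + 1) + 1) *
     hodge_star g (CARD('m) - k + 1) (ext_deriv (CARD('m) - k) (hodge_star g k \<alpha>)) y w"

text \<open>The weighted codifferential \<open>d\<^sup>* + \<iota>\<^bsub>\<nabla>u\<^esub> / 2\<close>.\<close>

definition codiff_weighted :: "(real^'m::{finite,linorder}) local_metric \<Rightarrow>
    (real^'m::{finite,linorder} \<Rightarrow> real) \<Rightarrow> nat \<Rightarrow>
    (real^'m::{finite,linorder}, real) local_form \<Rightarrow>
    (real^'m::{finite,linorder}, real) local_form" where
  "codiff_weighted g u k \<alpha> y w =
     codiff g k \<alpha> y w + 1/2 * interior_product (gradient g u y) (\<alpha> y) w"


section \<open>Steady gradient Kaehler-Ricci solitons\<close>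

definition hermitian_metric ::
    "('p::{t2_space,second_countable_topology}, complex^'m) chart set \<Rightarrow>
     ('p, complex^'m) tensor2 \<Rightarrow> bool" where
  "hermitian_metric A g \<longleftrightarrow>
     (\<forall>c\<in>A. (\<forall>v w. smooth_on (chart_img c) (\<lambda>y. g c y v w)) \<and>
        (\<forall>y\<in>chart_img c. bilinear (g c y) \<and> (\<forall>v w. g c y v w = g c y w v) \<and>
           (\<forall>v. v \<noteq> 0 \<longrightarrow> g c y v v > 0) \<and>
           (\<forall>v w. g c y (cplx_J v) (cplx_J w) = g c y v w))) \<and>
     (\<forall>c\<in>A. \<forall>d\<in>A. \<forall>p\<in>chart_dom c \<inter> chart_dom d. \<forall>v w.
        g c (coord c p) v w = g d (coord d p) (dtrans c d p v) (dtrans c d p w))"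

text \<open>\<open>\<omega>(v, w) = g(J v, w)\<close>.\<close>

definition kaehler_form :: "('p, complex^'m) tensor2 \<Rightarrow> ('p, complex^'m, real) form" where
  "kaehler_form g c y v = g c y (cplx_J (v 0)) (v 1)"

definition kaehler_manifold ::
    "('p::{t2_space,second_countable_topology}, complex^'m) chart set \<Rightarrow>
     ('p, complex^'m) tensor2 \<Rightarrow> bool" where
  "kaehler_manifold A g \<longleftrightarrow> connected (UNIV :: 'p set) \<and> holomorphic_atlas A \<and>
     hermitian_metric A g \<and>
     (\<forall>c\<in>A. \<forall>y\<in>chart_img c. \<forall>v. ext_deriv 2 (kaehler_form g c) y v = 0)"

definition gradient_steady_soliton ::
    "('p::{t2_space,second_countable_topology}, complex^'m) chart set \<Rightarrow>
     ('p, complex^'m) tensor2 \<Rightarrow> ('p \<Rightarrow> real) \<Rightarrow> bool" where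
  "gradient_steady_soliton A g f \<longleftrightarrow> kaehler_manifold A g \<and> smooth_function A f \<and>
     (\<forall>c\<in>A. \<forall>y\<in>chart_img c. \<forall>v w.
        ricci (g c) y v w + hessian (g c) (f \<circ> param c) y v w = 0)"

text \<open>Complex-multilinear alternating \<open>k\<close>-forms on \<open>complex^'m\<close>, i.e. forms of type \<open>(k, 0)\<close>
  at a point.\<close>

definition form_type_k0 :: "nat \<Rightarrow> ((nat \<Rightarrow> complex^'m) \<Rightarrow> complex) \<Rightarrow> bool" where
  "form_type_k0 k \<alpha> \<longleftrightarrow>
     (\<forall>v w. (\<forall>i<k. v i = w i) \<longrightarrow> \<alpha> v = \<alpha> w) \<and>
     (\<forall>v x y a. \<forall>i<k. \<alpha> (v(i := x + a *s y)) = \<alpha> (v(i := x)) + a * \<alpha> (v(i := y))) \<and>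
     (\<forall>v i j. i < j \<and> j < k \<and> v i = v j \<longrightarrow> \<alpha> v = 0)"

definition holomorphic_top_form ::
    "('p::{t2_space,second_countable_topology}, complex^'m) chart set \<Rightarrow>
     ('p, complex^'m, complex) form \<Rightarrow> bool" where
  "holomorphic_top_form A \<Omega> \<longleftrightarrow>
     (\<forall>c\<in>A. (\<forall>y\<in>chart_img c. form_type_k0 CARD('m) (\<Omega> c y)) \<and>
        (\<forall>v. smooth_on (chart_img c) (\<lambda>y. \<Omega> c y v) \<and>
           (\<forall>y\<in>chart_img c. \<forall>x. frechet_derivative (\<lambda>z. \<Omega> c z v) (at y) (cplx_J x) =
              \<i> * frechet_derivative (\<lambda>z. \<Omega> c z v) (at y) x))) \<and>
     (\<forall>c\<in>A. \<forall>d\<in>A. \<forall>p\<in>chart_dom c \<inter> chart_dom d. \<forall>v.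
        \<Omega> c (coord c p) v = \<Omega> d (coord d p) (\<lambda>i. dtrans c d p (v i)))"

text \<open>A nonvanishing holomorphic \<open>(m, 0)\<close>-form with
  \<open>e\<^sup>-\<^sup>f \<omega>\<^sup>m / m! = (-1)\<^bsup>m(m-1)/2\<^esup> (\<i>/2)\<^sup>m \<Omega> \<and> cnj \<Omega>\<close>.\<close>

definition soliton_volume_form ::
    "('p::{t2_space,second_countable_topology}, complex^'m) chart set \<Rightarrow>
     ('p, complex^'m) tensor2 \<Rightarrow> ('p \<Rightarrow> real) \<Rightarrow> ('p, complex^'m, complex) form \<Rightarrow> bool" where
  "soliton_volume_form A g f \<Omega> \<longleftrightarrow> holomorphic_top_form A \<Omega> \<and>
     (\<forall>c\<in>A. \<forall>y\<in>chart_img c. (\<exists>v. \<Omega> c y v \<noteq> 0) \<and>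
        (\<forall>v. complex_of_real (exp (- f (param c y)) *
                wedge_power CARD('m) (kaehler_form g c y) v / fact CARD('m)) =
             (-1) ^ (CARD('m) * (CARD('m) - 1) div 2) * (\<i> / 2) ^ CARD('m) *
                wedge CARD('m) CARD('m) (\<Omega> c y) (\<lambda>w. cnj (\<Omega> c y w)) v))"


section \<open>Immersed submanifolds\<close>

definition local_map :: "('l, 'a) chart \<Rightarrow> ('p, 'e) chart \<Rightarrow> ('l \<Rightarrow> 'p) \<Rightarrow> 'a \<Rightarrow> 'e" where
  "local_map c d F = coord d \<circ> F \<circ> param c"

definition immersion ::
    "('l::{t2_space,second_countable_topology}, 'a::euclidean_space) chart set \<Rightarrow>
     ('p::{t2_space,second_countable_topology}, 'e::euclidean_space) chart set \<Rightarrow>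
     ('l \<Rightarrow> 'p) \<Rightarrow> bool" where
  "immersion B A F \<longleftrightarrow> continuous_on UNIV F \<and>
     (\<forall>c\<in>B. \<forall>d\<in>A.
        smooth_on (coord c ` (chart_dom c \<inter> F -` chart_dom d)) (local_map c d F) \<and>
        (\<forall>y\<in>coord c ` (chart_dom c \<inter> F -` chart_dom d).
           inj (frechet_derivative (local_map c d F) (at y))))"

text \<open>Pullbacks along \<open>F\<close> are computed in some chart around the image point. By the
  transformation rule the choice does not matter.\<close>

definition chart_around :: "('p, 'e) chart set \<Rightarrow> 'p \<Rightarrow> ('p, 'e) chart" where
  "chart_around A p = (SOME d. d \<in> A \<and> p \<in> chart_dom d)"

definition pullback :: "('p, 'e::euclidean_space) chart set \<Rightarrow> ('l \<Rightarrow> 'p) \<Rightarrow> ('p, 'e, 'b) form \<Rightarrow>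
    ('l, 'a::euclidean_space, 'b) form" where
  "pullback A F \<alpha> c y v = (let p = F (param c y); d = chart_around A p in
     \<alpha> d (coord d p) (\<lambda>i. frechet_derivative (local_map c d F) (at y) (v i)))"

definition induced_metric :: "('p, 'e::euclidean_space) chart set \<Rightarrow> ('p, 'e) tensor2 \<Rightarrow>
    ('l \<Rightarrow> 'p) \<Rightarrow> ('l, 'a::euclidean_space) tensor2" where
  "induced_metric A g F c y v w = (let p = F (param c y); d = chart_around A p in
     g d (coord d p) (frechet_derivative (local_map c d F) (at y) v)
       (frechet_derivative (local_map c d F) (at y) w))"

text \<open>A vector field along \<open>F\<close> assigns to a chart \<open>d\<close> of the ambient manifold and a point \<open>q\<close>
  with \<open>F q \<in> chart_dom d\<close> the components in \<open>d\<close> of a tangent vector at \<open>F q\<close>.\<close>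

type_synonym ('l, 'p, 'e) field_along = "('p, 'e) chart \<Rightarrow> 'l \<Rightarrow> 'e"

text \<open>The pullback \<open>F\<^sup>*(\<iota>\<^sub>\<xi> \<alpha>)\<close>.\<close>

definition pullback_interior :: "('p, 'e::euclidean_space) chart set \<Rightarrow> ('l \<Rightarrow> 'p) \<Rightarrow>
    ('l, 'p, 'e) field_along \<Rightarrow> ('p, 'e, 'b) form \<Rightarrow> ('l, 'a::euclidean_space, 'b) form" where
  "pullback_interior A F \<xi> \<alpha> c y v = (let p = F (param c y); d = chart_around A p in
     interior_product (\<xi> d (param c y)) (\<alpha> d (coord d p))
       (\<lambda>i. frechet_derivative (local_map c d F) (at y) (v i)))"

definition normal_field ::
    "('p::{t2_space,second_countable_topology}, 'e::euclidean_space) chart set \<Rightarrow>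
     ('p, 'e) tensor2 \<Rightarrow>
     ('l::{t2_space,second_countable_topology}, 'a::euclidean_space) chart set \<Rightarrow>
     ('l \<Rightarrow> 'p) \<Rightarrow> ('l, 'p, 'e) field_along \<Rightarrow> bool" where
  "normal_field A g B F \<xi> \<longleftrightarrow>
     (\<forall>c\<in>A. \<forall>d\<in>A. \<forall>q. F q \<in> chart_dom c \<inter> chart_dom d \<longrightarrow>
        \<xi> d q = dtrans c d (F q) (\<xi> c q)) \<and>
     (\<forall>c\<in>B. \<forall>d\<in>A.
        smooth_on (coord c ` (chart_dom c \<inter> F -` chart_dom d)) (\<lambda>y. \<xi> d (param c y)) \<and>
        (\<forall>y\<in>coord c ` (chart_dom c \<inter> F -` chart_dom d). \<forall>w.
           g d (coord d (F (param c y))) (\<xi> d (param c y))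
             (frechet_derivative (local_map c d F) (at y) w) = 0))"


section \<open>Special Lagrangian submanifolds and their deformations\<close>

text \<open>The real form \<open>Re (e\<^bsup>-\<i>\<theta>\<^esup> \<Omega>)\<close> and its imaginary counterpart.\<close>

definition Re_phase :: "real \<Rightarrow> ('p, 'e, complex) form \<Rightarrow> ('p, 'e, real) form" where
  "Re_phase \<theta> \<Omega> c y v = Re (exp (- \<i> * of_real \<theta>) * \<Omega> c y v)"

definition Im_phase :: "real \<Rightarrow> ('p, 'e, complex) form \<Rightarrow> ('p, 'e, real) form" where
  "Im_phase \<theta> \<Omega> c y v = Im (exp (- \<i> * of_real \<theta>) * \<Omega> c y v)"

definition f_special_lagrangian ::
    "('p::{t2_space,second_countable_topology}, complex^'m::{finite,linorder}) chart set \<Rightarrow>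
     ('p, complex^'m::{finite,linorder}) tensor2 \<Rightarrow> ('p \<Rightarrow> real) \<Rightarrow> ('p, complex^'m::{finite,linorder}, complex) form \<Rightarrow>
     ('l::{t2_space,second_countable_topology}, real^'m::{finite,linorder}) chart set \<Rightarrow> ('l \<Rightarrow> 'p) \<Rightarrow> real \<Rightarrow> bool" where
  "f_special_lagrangian A g f \<Omega> B F \<theta> \<longleftrightarrow>
     oriented_atlas B \<and> connected (UNIV :: 'l set) \<and> immersion B A F \<and>
     (\<forall>c\<in>B. \<forall>y\<in>chart_img c. \<forall>v.
        pullback A F (Re_phase \<theta> \<Omega>) c y v =
        exp (- f (F (param c y)) / 2) * volume_form (induced_metric A g F c) y v)"

text \<open>A smooth family \<open>\<Phi>\<close> of immersions parametrised by \<open>{-\<epsilon><..<\<epsilon>}\<close>.\<close>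

definition smooth_immersion_family ::
    "('l::{t2_space,second_countable_topology}, 'a::euclidean_space) chart set \<Rightarrow>
     ('p::{t2_space,second_countable_topology}, 'e::euclidean_space) chart set \<Rightarrow>
     real \<Rightarrow> (real \<Rightarrow> 'l \<Rightarrow> 'p) \<Rightarrow> bool" where
  "smooth_immersion_family B A \<epsilon> \<Phi> \<longleftrightarrow> \<epsilon> > 0 \<and>
     continuous_on ({-\<epsilon><..<\<epsilon>} \<times> UNIV) (\<lambda>(t, q). \<Phi> t q) \<and>
     (\<forall>c\<in>B. \<forall>d\<in>A.
        smooth_on {(t, y). t \<in> {-\<epsilon><..<\<epsilon>} \<and> y \<in> chart_img c \<and> \<Phi> t (param c y) \<in> chart_dom d}
          (\<lambda>(t, y). local_map c d (\<Phi> t) y)) \<and>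
     (\<forall>t\<in>{-\<epsilon><..<\<epsilon>}. immersion B A (\<Phi> t))"

definition f_SL_deformation_field ::
    "('p::{t2_space,second_countable_topology}, complex^'m) chart set \<Rightarrow>
     ('p, complex^'m) tensor2 \<Rightarrow> ('p, complex^'m, complex) form \<Rightarrow>
     ('l::{t2_space,second_countable_topology}, real^'m) chart set \<Rightarrow> ('l \<Rightarrow> 'p) \<Rightarrow> real \<Rightarrow>
     ('l, 'p, complex^'m) field_along \<Rightarrow> bool" where
  "f_SL_deformation_field A g \<Omega> B F \<theta> \<xi> \<longleftrightarrow>
     (\<exists>\<epsilon> \<Phi>. smooth_immersion_family B A \<epsilon> \<Phi> \<and> \<Phi> 0 = F \<and>
        (\<forall>d\<in>A. \<forall>q. F q \<in> chart_dom d \<longrightarrow>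
           ((\<lambda>t. coord d (\<Phi> t q)) has_vector_derivative \<xi> d q) (at 0)) \<and>
        (\<forall>c\<in>B. \<forall>y\<in>chart_img c. \<forall>v.
           ((\<lambda>t. pullback A (\<Phi> t) (kaehler_form g) c y v) has_real_derivative 0) (at 0) \<and>
           ((\<lambda>t. pullback A (\<Phi> t) (Im_phase \<theta> \<Omega>) c y v) has_real_derivative 0) (at 0)))"

definition omega_tilde :: "('p, complex^'m) chart set \<Rightarrow> ('p, complex^'m) tensor2 \<Rightarrow>
    ('l \<Rightarrow> 'p) \<Rightarrow> ('l, 'p, complex^'m) field_along \<Rightarrow> ('l, real^'m, real) form" where
  "omega_tilde A g F \<xi> = pullback_interior A F \<xi> (kaehler_form g)"

end

theory Submission
  imports Defs
begin

text \<open>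
  For a family \<open>F\<^sub>t\<close> with initial velocity \<open>\<xi>\<close> and a closed form \<open>\<alpha>\<close>, Cartan's formula says that the
  derivative of \<open>F\<^sub>t\<^sup>* \<alpha>\<close> at \<open>t = 0\<close> is \<open>d (F\<^sup>* \<iota>\<^sub>\<xi> \<alpha>)\<close>. For the Kaehler form this is \<open>d\<close> of the
  one-form \<open>\<omega>(\<xi>) = F\<^sup>* \<iota>\<^sub>\<xi> \<omega>\<close>. In coordinates, the formula holds because the first derivatives of \<open>\<alpha>\<close>
  combine by closedness, while the second derivatives of the maps cancel or commute
  (\<open>two_form_variation\<close>). For the holomorphic volume form \<open>\<Omega> = \<kappa> dz\<^sub>1 \<and> \<dots> \<and> dz\<^sub>m\<close> both sides are a multiple
  of the coordinate volume by the same density (\<open>top_form_variation\<close>, \<open>ext_deriv_interior_top\<close>); here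
  holomorphy of \<open>\<kappa>\<close> and Cramer's rule take the place of closedness.

  It remains to identify \<open>F\<^sup>* \<iota>\<^sub>\<xi> Im (e\<^bsup>-i\<theta>\<^esup> \<Omega>)\<close>, a question at one point. The volume identity for \<open>\<Omega>\<close>
  gives \<open>|\<Omega>|\<^sup>2 = e\<^bsup>-f\<^esup>\<close> on unitary frames (\<open>unitary_volume\<close>); it is obtained by
  expanding the top power of the Kaehler form in a unitary coframe. Hadamard's inequality extends this to the
  bound \<open>|\<Omega>|\<^sup>2 \<le> e\<^bsup>-f\<^esup>\<close> on real orthonormal frames, and equality forces the frame to be Lagrangian
  (\<open>calibrated_imp_lagrangian\<close>). Since the tangent plane is calibrated, it is Lagrangian, and a normal vector is
  \<open>\<xi> = - J F\<^sub>* x\<close> for the vector \<open>x\<close> dual to \<open>\<omega>(\<xi>)\<close>. As \<open>\<Omega>\<close> is complex linear, the imaginary part of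
  \<open>\<iota>\<^sub>\<xi> e\<^bsup>-i\<theta>\<^esup> \<Omega>\<close> is minus the real part of \<open>\<iota>\<^sub>x e\<^bsup>-i\<theta>\<^esup> \<Omega>\<close>, that is \<open>- e\<^bsup>-f/2\<^esup> \<star> \<omega>(\<xi>)\<close>
  (\<open>Im_interior_normal\<close>). The codifferential for the measure with weight \<open>e\<^bsup>-f/2\<^esup>\<close> is
  \<open>- e\<^bsup>f/2\<^esup> \<star> d (e\<^bsup>-f/2\<^esup> \<star> \<cdot>)\<close> on one-forms, so that the derivative of \<open>F\<^sub>t\<^sup>* Im (e\<^bsup>-i\<theta>\<^esup> \<Omega>)\<close> vanishes at a point if and
  only if the weighted codifferential of \<open>\<omega>(\<xi>)\<close> does (\<open>codiff_weighted_eq\<close>, \<open>first_variation\<close>).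

  A deformation field is by definition the initial velocity of a family of immersions whose first
  variations vanish. The above computes these variations for any family, hence the
  converse needs one family with initial velocity \<open>\<xi>\<close>. It is constructed without an auxiliary
  metric or exponential map: along a countable cover by coordinate balls, one adds the pieces of
  \<open>\<xi>\<close> given by a partition of unity one after the other. In a chart a piece \<open>\<eta>\<close> is added as \<open>\<delta> sin(t/\<delta>) \<eta>\<close>, which
  has velocity \<open>\<eta>\<close> at \<open>t = 0\<close> but stays so small that the maps remain immersions
  (\<open>modify_family\<close>, \<open>field_is_velocity\<close>).
\<close>

section \<open>Calculus of smooth maps\<close>

lemma Ck_on_subset: "Ck_on k S u \<Longrightarrow> T \<subseteq> S \<Longrightarrow> Ck_on k T u"
  by (induction k arbitrary: u) (auto intro: continuous_on_subset)

lemma Ck_on_cong: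
  assumes "open S" "Ck_on k S u" "\<And>x. x \<in> S \<Longrightarrow> u x = w x"
  shows "Ck_on k S w"
  using assms(2,3)
proof (induction k arbitrary: u w)
  case 0
  then show ?case by (auto intro: continuous_on_eq)
next
  case (Suc k)
  have 1: "w differentiable (at x)" if "x \<in> S" for x
  proof -
    have "u differentiable (at x)" using Suc.prems(1) that by simp
    then obtain D where "(u has_derivative D) (at x)"
      by (auto simp: differentiable_def)
    then have "(w has_derivative D) (at x)"
      by (rule has_derivative_transform_within_open[OF _ assms(1) that]) (rule Suc.prems(2))
    then show ?thesis by (auto simp: differentiable_def)
  qed
  have 2: "frechet_derivative u (at x) = frechet_derivative w (at x)" if "x \<in> S" for x
    using Suc.prems that assms(1) frechet_derivative_transform_within_open[of u x S w] by auto
  have "Ck_on k S (\<lambda>x. frechet_derivative w (at x) v)" for v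
    by (rule Suc.IH[of "\<lambda>x. frechet_derivative u (at x) v"]) (use Suc.prems 2 in auto)
  with 1 show ?case by simp
qed

lemma Ck_on_imp_continuous_on:
  assumes "Ck_on k S u" shows "continuous_on S u"
proof (cases k)
  case 0
  with assms show ?thesis by simp
next
  case (Suc j)
  with assms show ?thesis
    by (intro continuous_at_imp_continuous_on ballI differentiable_imp_continuous_within) auto
qed

lemma Ck_on_SucD: "Ck_on (Suc k) S u \<Longrightarrow> Ck_on k S u"
proof (induction k arbitrary: u)
  case 0
  then show ?case using Ck_on_imp_continuous_on by (simp del: Ck_on.simps(2)) 
next
  case (Suc k)
  then show ?case by auto
qed

lemma Ck_on_SucI:
  assumes "open S" "\<And>x. x \<in> S \<Longrightarrow> (u has_derivative D x) (at x)"
    and "\<And>v. Ck_on k S (\<lambda>x. D x v)"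
  shows "Ck_on (Suc k) S u"
proof -
  have "frechet_derivative u (at x) = D x" if "x \<in> S" for x
    using assms(2)[OF that] frechet_derivative_at by force
  then have "Ck_on k S (\<lambda>x. frechet_derivative u (at x) v)" for v
    using Ck_on_cong[OF assms(1) assms(3)[of v]] by simp
  then show ?thesis
    using assms(2) by (auto simp: differentiable_def)
qed

lemma Ck_on_Suc_has_derivative:
  "Ck_on (Suc k) S u \<Longrightarrow> x \<in> S \<Longrightarrow> (u has_derivative frechet_derivative u (at x)) (at x)"
  by (auto simp: frechet_derivative_works)

lemma Ck_on_const: "open S \<Longrightarrow> Ck_on k S (\<lambda>x. c)"
  by (induction k arbitrary: c) auto

lemma Ck_on_bounded_linear:
  assumes "bounded_linear L" "open S" "Ck_on k S u"
  shows "Ck_on k S (\<lambda>x. L (u x))"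
  using assms(3)
proof (induction k arbitrary: u)
  case 0
  then show ?case by (simp add: bounded_linear.continuous_on[OF assms(1)])
next
  case (Suc k)
  show ?case
    by (rule Ck_on_SucI[OF assms(2), where D = "\<lambda>x v. L (frechet_derivative u (at x) v)"])
      (use Suc bounded_linear.has_derivative[OF assms(1) Ck_on_Suc_has_derivative[OF Suc.prems]] in auto)
qed

lemma Ck_on_ident: "open S \<Longrightarrow> Ck_on k S (\<lambda>x. x)"
  by (cases k) (auto intro!: Ck_on_const)

lemma Ck_on_add:
  assumes "open S" "Ck_on k S u" "Ck_on k S w"
  shows "Ck_on k S (\<lambda>x. u x + w x)"
  using assms(2,3)
proof (induction k arbitrary: u w)
  case 0
  then show ?case by (simp add: continuous_on_add)
next
  case (Suc k)
  show ?case
    by (rule Ck_on_SucI[OF assms(1), where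
          D = "\<lambda>x v. frechet_derivative u (at x) v + frechet_derivative w (at x) v"])
      (use Suc in \<open>auto intro!: has_derivative_add Ck_on_Suc_has_derivative[OF Suc.prems(1)]
        Ck_on_Suc_has_derivative[OF Suc.prems(2)]\<close>)
qed

lemma Ck_on_sum:
  assumes "open S" "\<And>i. i \<in> I \<Longrightarrow> Ck_on k S (u i)"
  shows "Ck_on k S (\<lambda>x. \<Sum>i\<in>I. u i x)"
  using assms(2)
  by (induction I rule: infinite_finite_induct)
    (auto intro!: Ck_on_const assms(1) Ck_on_add)

lemma Ck_on_bounded_bilinear:
  assumes "bounded_bilinear P" "open S" "Ck_on k S u" "Ck_on k S w"
  shows "Ck_on k S (\<lambda>x. P (u x) (w x))"
  using assms(3,4)
proof (induction k arbitrary: u w)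
  case 0
  then show ?case by (simp add: bounded_bilinear.continuous_on[OF assms(1)])
next
  case (Suc k)
  show ?case
  proof (rule Ck_on_SucI[OF assms(2), where D = "\<lambda>x v. P (u x) (frechet_derivative w (at x) v)
      + P (frechet_derivative u (at x) v) (w x)"])
    show "Ck_on k S (\<lambda>x. P (u x) (frechet_derivative w (at x) v)
      + P (frechet_derivative u (at x) v) (w x))" for v
      using Suc.prems Ck_on_SucD[OF Suc.prems(1)] Ck_on_SucD[OF Suc.prems(2)]
      by (intro Ck_on_add[OF assms(2)] Suc.IH) auto
    show "((\<lambda>x. P (u x) (w x)) has_derivative (\<lambda>v. P (u x) (frechet_derivative w (at x) v) +
        P (frechet_derivative u (at x) v) (w x))) (at x)" if "x \<in> S" for x
      by (rule bounded_bilinear.FDERIV[OF assms(1)])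
        (use Ck_on_Suc_has_derivative[OF Suc.prems(1) that]
          Ck_on_Suc_has_derivative[OF Suc.prems(2) that] in auto)
  qed
qed

lemma linear_expand_Basis:
  fixes L :: "'a::euclidean_space \<Rightarrow> 'b::real_vector"
  assumes "linear L"
  shows "L x = (\<Sum>b\<in>Basis. (x \<bullet> b) *\<^sub>R L b)"
proof -
  have "L x = L (\<Sum>b\<in>Basis. (x \<bullet> b) *\<^sub>R b)" by (simp add: euclidean_representation)
  also have "\<dots> = (\<Sum>b\<in>Basis. (x \<bullet> b) *\<^sub>R L b)"
    by (simp add: linear_sum[OF assms] linear_scale[OF assms])
  finally show ?thesis .
qed

text \<open>Smoothness constrains derivatives in constant directions only; the direction
  \<open>D\<phi> v\<close> in the chain rule varies, and is expanded in a basis.\<close>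

lemma Ck_on_compose:
  fixes \<phi> :: "'a::euclidean_space \<Rightarrow> 'c::euclidean_space"
  assumes "open S" "Ck_on k T u" "Ck_on k S \<phi>" "\<phi> ` S \<subseteq> T"
  shows "Ck_on k S (\<lambda>x. u (\<phi> x))"
  using assms(2,3)
proof (induction k arbitrary: u)
  case 0
  then show ?case using assms(4) by (auto intro: continuous_on_compose2)
next
  case (Suc k)
  have D: "((\<lambda>x. u (\<phi> x)) has_derivative
      (\<lambda>v. \<Sum>b\<in>Basis. (frechet_derivative \<phi> (at x) v \<bullet> b) *\<^sub>R frechet_derivative u (at (\<phi> x)) b)) (at x)"
    if "x \<in> S" for x
  proof -
    have u: "(u has_derivative frechet_derivative u (at (\<phi> x))) (at (\<phi> x))"
      using Ck_on_Suc_has_derivative[OF Suc.prems(1)] that assms(4) by auto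
    have "linear (frechet_derivative u (at (\<phi> x)))"
      using u has_derivative_linear by blast
    then show ?thesis
      using diff_chain_at[OF Ck_on_Suc_has_derivative[OF Suc.prems(2) that] u]
      by (subst linear_expand_Basis[symmetric]) (auto simp: o_def)
  qed
  show ?case
  proof (rule Ck_on_SucI[OF assms(1) D], assumption)
    fix v
    show "Ck_on k S (\<lambda>x. \<Sum>b\<in>Basis. (frechet_derivative \<phi> (at x) v \<bullet> b) *\<^sub>R
        frechet_derivative u (at (\<phi> x)) b)"
    proof (intro Ck_on_sum assms(1) Ck_on_bounded_bilinear[OF bounded_bilinear_scaleR])
      fix b :: 'c assume "b \<in> Basis"
      show "Ck_on k S (\<lambda>x. frechet_derivative \<phi> (at x) v \<bullet> b)"
        using Suc.prems
        by (intro Ck_on_bounded_linear[OF bounded_linear_inner_left assms(1)]) auto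
      show "Ck_on k S (\<lambda>x. frechet_derivative u (at (\<phi> x)) b)"
        using Suc.prems(1) Ck_on_SucD[OF Suc.prems(2)]
        by (intro Suc.IH[of "\<lambda>z. frechet_derivative u (at z) b"]) auto
    qed
  qed
qed

lemma Ck_on_local:
  assumes "\<And>x. x \<in> S \<Longrightarrow> \<exists>N. open N \<and> x \<in> N \<and> Ck_on k N u"
  shows "Ck_on k S u"
  using assms
proof (induction k arbitrary: u)
  case 0
  then show ?case
    by (metis Ck_on.simps(1) continuous_at_imp_continuous_on continuous_on_eq_continuous_at)
next
  case (Suc k)
  then show ?case
    by (smt (verit) Ck_on.simps(2))
qed

lemma smooth_on_open: "smooth_on S u \<Longrightarrow> open S"
  by (simp add: smooth_on_def)

lemma smooth_on_subset: "smooth_on S u \<Longrightarrow> open T \<Longrightarrow> T \<subseteq> S \<Longrightarrow> smooth_on T u"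
  by (auto simp: smooth_on_def intro: Ck_on_subset)

lemma smooth_on_cong:
  "smooth_on S u \<Longrightarrow> (\<And>x. x \<in> S \<Longrightarrow> u x = w x) \<Longrightarrow> smooth_on S w"
  by (auto simp: smooth_on_def intro: Ck_on_cong)

lemma smooth_on_local:
  assumes "\<And>x. x \<in> S \<Longrightarrow> \<exists>N. x \<in> N \<and> N \<subseteq> S \<and> smooth_on N u"
  shows "smooth_on S u"
proof -
  have "open S" using assms by (subst open_subopen) (metis smooth_on_open)
  moreover have "Ck_on k S u" for k
    using assms by (intro Ck_on_local) (metis smooth_on_def)
  ultimately show ?thesis by (simp add: smooth_on_def)
qed

lemma smooth_on_imp_continuous_on: "smooth_on S u \<Longrightarrow> continuous_on S u"
  using Ck_on_imp_continuous_on by (auto simp: smooth_on_def)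

lemma smooth_on_const: "open S \<Longrightarrow> smooth_on S (\<lambda>x. c)"
  by (simp add: smooth_on_def Ck_on_const)

lemma smooth_on_ident: "open S \<Longrightarrow> smooth_on S (\<lambda>x. x)"
  by (simp add: smooth_on_def Ck_on_ident)

lemma smooth_on_add: "smooth_on S u \<Longrightarrow> smooth_on S w \<Longrightarrow> smooth_on S (\<lambda>x. u x + w x)"
  by (simp add: smooth_on_def Ck_on_add)

lemma smooth_on_bounded_linear:
  "bounded_linear L \<Longrightarrow> smooth_on S u \<Longrightarrow> smooth_on S (\<lambda>x. L (u x))"
  by (simp add: smooth_on_def Ck_on_bounded_linear)

lemma smooth_on_bounded_bilinear:
  "bounded_bilinear P \<Longrightarrow> smooth_on S u \<Longrightarrow> smooth_on S w \<Longrightarrow> smooth_on S (\<lambda>x. P (u x) (w x))"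
  by (simp add: smooth_on_def Ck_on_bounded_bilinear)

lemmas smooth_on_scaleR = smooth_on_bounded_bilinear[OF bounded_bilinear_scaleR]
lemmas smooth_on_mult = smooth_on_bounded_bilinear[OF bounded_bilinear_mult]

lemma smooth_on_compose:
  fixes \<phi> :: "'a::euclidean_space \<Rightarrow> 'c::euclidean_space"
  assumes "smooth_on T u" "smooth_on S \<phi>" "\<phi> ` S \<subseteq> T"
  shows "smooth_on S (\<lambda>x. u (\<phi> x))"
  using assms by (auto simp: smooth_on_def intro: Ck_on_compose)

lemma smooth_on_diff: "smooth_on S u \<Longrightarrow> smooth_on S w \<Longrightarrow> smooth_on S (\<lambda>x. u x - w x)"
  using smooth_on_add[of S u "\<lambda>x. - w x"]
    smooth_on_bounded_linear[OF bounded_linear_minus[OF bounded_linear_ident], of S w] by simp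

lemma smooth_on_Pair:
  fixes a :: "'a::euclidean_space \<Rightarrow> 'b::real_normed_vector"
    and b :: "'a \<Rightarrow> 'c::real_normed_vector"
  assumes "smooth_on S a" "smooth_on S b"
  shows "smooth_on S (\<lambda>x. (a x, b x))"
proof -
  have "bounded_linear (\<lambda>x::'b. (x, 0::'c))" "bounded_linear (\<lambda>x::'c. (0::'b, x))"
    by (auto intro: bounded_linear_Pair bounded_linear_ident bounded_linear_zero)
  then have "smooth_on S (\<lambda>x. (a x, 0) + (0, b x))"
    by (intro smooth_on_add smooth_on_bounded_linear[where L = "\<lambda>x. (x, 0)"]
        smooth_on_bounded_linear[where L = "\<lambda>x. (0, x)"] assms)
  then show ?thesis by simp
qed

lemma smooth_on_has_derivative:
  "smooth_on S u \<Longrightarrow> x \<in> S \<Longrightarrow> (u has_derivative frechet_derivative u (at x)) (at x)"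
  using Ck_on_Suc_has_derivative unfolding smooth_on_def by blast

lemma smooth_on_frechet_derivative:
  "smooth_on S u \<Longrightarrow> smooth_on S (\<lambda>x. frechet_derivative u (at x) v)"
  unfolding smooth_on_def by (metis Ck_on.simps(2))

lemma frechet_derivative_eqI: "(u has_derivative D) (at x) \<Longrightarrow> frechet_derivative u (at x) = D"
  using frechet_derivative_at by force

text \<open>Both iterated derivatives are limits of the symmetric second difference
  \<open>u (x + ha + hb) - u (x + ha) - u (x + hb) + u x\<close> divided by \<open>h\<^sup>2\<close>: two applications of the mean
  value theorem, in either order of the directions, express it by a nearby value of the
  corresponding second derivative.\<close>

lemma second_difference_mean_value:
  fixes u :: "'a::euclidean_space \<Rightarrow> real"
  assumes "smooth_on S u" "h > 0"
    and inS: "\<And>s t. s \<in> {0..h} \<Longrightarrow> t \<in> {0..h} \<Longrightarrow> x + s *\<^sub>R a + t *\<^sub>R b \<in> S"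
  shows "\<exists>s\<in>{0..h}. \<exists>t\<in>{0..h}.
    u (x + h *\<^sub>R a + h *\<^sub>R b) - u (x + h *\<^sub>R a) - u (x + h *\<^sub>R b) + u x =
    h * h * frechet_derivative (\<lambda>z. frechet_derivative u (at z) a) (at (x + s *\<^sub>R a + t *\<^sub>R b)) b"
proof -
  let ?D = "\<lambda>z. frechet_derivative u (at z)"
  let ?w = "\<lambda>z. ?D z a"
  define \<phi> where "\<phi> s = u (x + s *\<^sub>R a + h *\<^sub>R b) - u (x + s *\<^sub>R a)" for s
  have d\<phi>: "DERIV \<phi> s :> ?D (x + s *\<^sub>R a + h *\<^sub>R b) a - ?D (x + s *\<^sub>R a) a"
    if s: "0 \<le> s" "s \<le> h" for s
  proof -
    have m: "x + s *\<^sub>R a + h *\<^sub>R b \<in> S" "x + s *\<^sub>R a \<in> S"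
      using inS[of s h] inS[of s 0] s \<open>h > 0\<close> by auto
    note 1 = smooth_on_has_derivative[OF assms(1) m(1)]
    note 2 = smooth_on_has_derivative[OF assms(1) m(2)]
    have l: "linear (?D (x + s *\<^sub>R a + h *\<^sub>R b))" "linear (?D (x + s *\<^sub>R a))"
      using 1 2 has_derivative_linear by blast+
    have "((\<lambda>s. u (x + s *\<^sub>R a + h *\<^sub>R b)) has_derivative (\<lambda>r. ?D (x + s *\<^sub>R a + h *\<^sub>R b) (r *\<^sub>R a))) (at s)"
      by (rule has_derivative_compose[where g = u and f = "\<lambda>s. x + s *\<^sub>R a + h *\<^sub>R b", OF _ 1])
        (auto intro!: derivative_eq_intros)
    moreover have "((\<lambda>s. u (x + s *\<^sub>R a)) has_derivative (\<lambda>r. ?D (x + s *\<^sub>R a) (r *\<^sub>R a))) (at s)"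
      by (rule has_derivative_compose[where g = u and f = "\<lambda>s. x + s *\<^sub>R a", OF _ 2])
        (auto intro!: derivative_eq_intros)
    ultimately have "(\<phi> has_derivative
        (\<lambda>r. ?D (x + s *\<^sub>R a + h *\<^sub>R b) (r *\<^sub>R a) - ?D (x + s *\<^sub>R a) (r *\<^sub>R a))) (at s)"
      unfolding \<phi>_def by (rule has_derivative_diff)
    then show ?thesis
      by (simp add: has_field_derivative_def linear_scale[OF l(1)] linear_scale[OF l(2)]
          right_diff_distrib[symmetric] mult.commute[of _ "_ - _"])
  qed
  obtain s where s: "0 < s" "s < h" "\<phi> h - \<phi> 0 = (h - 0) * (?w (x + s *\<^sub>R a + h *\<^sub>R b) - ?w (x + s *\<^sub>R a))"
    using MVT2[OF \<open>h > 0\<close> d\<phi>] by auto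
  let ?E = "\<lambda>z. frechet_derivative ?w (at z)"
  have d: "DERIV (\<lambda>t. ?w (x + s *\<^sub>R a + t *\<^sub>R b)) t :> ?E (x + s *\<^sub>R a + t *\<^sub>R b) b"
    if t: "0 \<le> t" "t \<le> h" for t
  proof -
    have m: "x + s *\<^sub>R a + t *\<^sub>R b \<in> S" using inS[of s t] s t by auto
    note 1 = smooth_on_has_derivative[OF smooth_on_frechet_derivative[OF assms(1)] m, of a]
    have "((\<lambda>t. ?w (x + s *\<^sub>R a + t *\<^sub>R b)) has_derivative (\<lambda>r. ?E (x + s *\<^sub>R a + t *\<^sub>R b) (r *\<^sub>R b))) (at t)"
      by (rule has_derivative_compose[where g = "\<lambda>z. frechet_derivative u (at z) a"
            and f = "\<lambda>t. x + s *\<^sub>R a + t *\<^sub>R b", OF _ 1])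
        (auto intro!: derivative_eq_intros)
    then show ?thesis
      using linear_scale[OF has_derivative_linear[OF 1]]
      by (simp add: has_field_derivative_def mult.commute[of _ "frechet_derivative _ _ _"])
  qed
  obtain t where t: "0 < t" "t < h"
    "?w (x + s *\<^sub>R a + h *\<^sub>R b) - ?w (x + s *\<^sub>R a + 0 *\<^sub>R b) = (h - 0) * ?E (x + s *\<^sub>R a + t *\<^sub>R b) b"
    using MVT2[OF \<open>h > 0\<close> d] by auto
  have "u (x + h *\<^sub>R a + h *\<^sub>R b) - u (x + h *\<^sub>R a) - u (x + h *\<^sub>R b) + u x = \<phi> h - \<phi> 0"
    by (simp add: \<phi>_def)
  also have "\<dots> = h * h * ?E (x + s *\<^sub>R a + t *\<^sub>R b) b"
    using s t by simp
  finally show ?thesis using s t by force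
qed

lemma second_derivative_symmetric_real:
  fixes u :: "'a::euclidean_space \<Rightarrow> real"
  assumes "smooth_on S u" "x \<in> S"
  shows "frechet_derivative (\<lambda>z. frechet_derivative u (at z) a) (at x) b =
    frechet_derivative (\<lambda>z. frechet_derivative u (at z) b) (at x) a" (is "?A x = ?B x")
proof -
  have "\<bar>?A x - ?B x\<bar> \<le> 2 * e" if "e > 0" for e
  proof -
    have cont: "isCont ?A x" "isCont ?B x"
      using smooth_on_imp_continuous_on[OF smooth_on_frechet_derivative[OF
            smooth_on_frechet_derivative[OF assms(1)]]] smooth_on_open[OF assms(1)] assms(2)
      by (auto simp: continuous_on_eq_continuous_at)
    obtain d1 where d1: "d1 > 0" "\<And>z. dist z x < d1 \<Longrightarrow> dist (?A z) (?A x) < e"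
      using cont(1) \<open>e > 0\<close> unfolding continuous_at_eps_delta by blast
    obtain d2 where d2: "d2 > 0" "\<And>z. dist z x < d2 \<Longrightarrow> dist (?B z) (?B x) < e"
      using cont(2) \<open>e > 0\<close> unfolding continuous_at_eps_delta by blast
    obtain d3 where d3: "d3 > 0" "ball x d3 \<subseteq> S"
      using smooth_on_open[OF assms(1)] assms(2) open_contains_ball by blast
    define d where "d = min d1 (min d2 d3)"
    define h where "h = d / (2 * (norm a + norm b + 1))"
    have "d > 0" using d1 d2 d3 by (simp add: d_def)
    have np: "norm a + norm b + 1 > 0" by (smt (verit) norm_ge_zero)
    have "h > 0" using \<open>d > 0\<close> np by (simp add: h_def)
    have near: "dist (x + s *\<^sub>R a + t *\<^sub>R b) x < d" if "s \<in> {0..h}" "t \<in> {0..h}" for s t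
    proof -
      have "norm (s *\<^sub>R a + t *\<^sub>R b) \<le> h * norm a + h * norm b"
        by (rule order_trans[OF norm_triangle_ineq]) (use that in \<open>auto intro!: add_mono mult_right_mono\<close>)
      also have "\<dots> \<le> h * (norm a + norm b + 1)" using \<open>h > 0\<close> by (simp add: algebra_simps)
      also have "\<dots> = d / 2" using np unfolding h_def by (simp add: divide_simps del: distrib_left_numeral)
      also have "\<dots> < d" using \<open>d > 0\<close> by simp
      finally show ?thesis by (simp add: dist_norm add.assoc)
    qed
    have near': "dist (x + s *\<^sub>R b + t *\<^sub>R a) x < d" if "s \<in> {0..h}" "t \<in> {0..h}" for s t
      using near[OF that(2,1)] by (simp add: algebra_simps)
    have inS: "x + s *\<^sub>R a + t *\<^sub>R b \<in> S" "x + s *\<^sub>R b + t *\<^sub>R a \<in> S"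
      if "s \<in> {0..h}" "t \<in> {0..h}" for s t
      using near[OF that] near'[OF that] d3 by (auto simp: d_def dist_commute)
    obtain s t where st: "s \<in> {0..h}" "t \<in> {0..h}"
      "u (x + h *\<^sub>R a + h *\<^sub>R b) - u (x + h *\<^sub>R a) - u (x + h *\<^sub>R b) + u x = h * h * ?A (x + s *\<^sub>R a + t *\<^sub>R b)"
      using second_difference_mean_value[OF assms(1) \<open>h > 0\<close> inS(1)] by blast
    obtain s' t' where st': "s' \<in> {0..h}" "t' \<in> {0..h}"
      "u (x + h *\<^sub>R b + h *\<^sub>R a) - u (x + h *\<^sub>R b) - u (x + h *\<^sub>R a) + u x = h * h * ?B (x + s' *\<^sub>R b + t' *\<^sub>R a)"
      using second_difference_mean_value[OF assms(1) \<open>h > 0\<close> inS(2)] by blast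
    have "u (x + h *\<^sub>R b + h *\<^sub>R a) = u (x + h *\<^sub>R a + h *\<^sub>R b)" by (simp add: add_ac)
    then have "h * h * ?A (x + s *\<^sub>R a + t *\<^sub>R b) = h * h * ?B (x + s' *\<^sub>R b + t' *\<^sub>R a)"
      using st(3) st'(3) by linarith
    then have "?A (x + s *\<^sub>R a + t *\<^sub>R b) = ?B (x + s' *\<^sub>R b + t' *\<^sub>R a)"
      using \<open>h > 0\<close> by simp
    moreover have "dist (?A (x + s *\<^sub>R a + t *\<^sub>R b)) (?A x) < e"
      using d1(2) near[OF st(1,2)] by (simp add: d_def)
    moreover have "dist (?B (x + s' *\<^sub>R b + t' *\<^sub>R a)) (?B x) < e"
      using d2(2) near'[OF st'(1,2)] by (simp add: d_def)
    ultimately show ?thesis by (simp add: dist_real_def)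
  qed
  from this[of "\<bar>?A x - ?B x\<bar> / 3"] show ?thesis
    by (cases "?A x = ?B x") auto
qed

lemma second_derivative_symmetric:
  fixes u :: "'a::euclidean_space \<Rightarrow> 'b::euclidean_space"
  assumes "smooth_on S u" "x \<in> S"
  shows "frechet_derivative (\<lambda>z. frechet_derivative u (at z) a) (at x) b =
    frechet_derivative (\<lambda>z. frechet_derivative u (at z) b) (at x) a"
proof (rule euclidean_eqI)
  fix c :: 'b assume "c \<in> Basis"
  have 1: "frechet_derivative (\<lambda>z. u z \<bullet> c) (at z) a = frechet_derivative u (at z) a \<bullet> c"
    if "z \<in> S" for z a
    by (subst frechet_derivative_eqI[OF
          has_derivative_inner_left[OF smooth_on_has_derivative[OF assms(1) that]]]) simp
  have 2: "frechet_derivative (\<lambda>z. frechet_derivative (\<lambda>z. u z \<bullet> c) (at z) a) (at x) b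
    = frechet_derivative (\<lambda>z. frechet_derivative u (at z) a) (at x) b \<bullet> c" for a b
  proof -
    have "((\<lambda>z. frechet_derivative u (at z) a \<bullet> c) has_derivative
       (\<lambda>b. frechet_derivative (\<lambda>z. frechet_derivative u (at z) a) (at x) b \<bullet> c)) (at x)"
      by (rule has_derivative_inner_left, rule smooth_on_has_derivative[OF
            smooth_on_frechet_derivative[OF assms(1)] assms(2)])
    then have "((\<lambda>z. frechet_derivative (\<lambda>z. u z \<bullet> c) (at z) a) has_derivative
       (\<lambda>b. frechet_derivative (\<lambda>z. frechet_derivative u (at z) a) (at x) b \<bullet> c)) (at x)"
      by (rule has_derivative_transform_within_open[OF _ smooth_on_open[OF assms(1)] assms(2)])
        (simp add: 1)
    then show ?thesis by (simp add: frechet_derivative_eqI)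
  qed
  have "smooth_on S (\<lambda>z. u z \<bullet> c)"
    by (rule smooth_on_bounded_linear[OF bounded_linear_inner_left assms(1)])
  from second_derivative_symmetric_real[OF this assms(2), of a b]
  show "frechet_derivative (\<lambda>z. frechet_derivative u (at z) a) (at x) b \<bullet> c =
    frechet_derivative (\<lambda>z. frechet_derivative u (at z) b) (at x) a \<bullet> c"
    by (simp add: 2)
qed

section \<open>Determinants of frames and alternating forms of top degree\<close>

text \<open>A form is evaluated on a sequence of vectors, while the coordinates are indexed by a type.
  Numbering this type in increasing order turns the first vectors of a sequence into the rows of a
  square matrix.\<close>

definition frame_matrix :: "(nat \<Rightarrow> 'a^'m::{finite,linorder}) \<Rightarrow> 'a^'m::{finite,linorder}^'m::{finite,linorder}" where
  "frame_matrix v = (\<chi> j. v (index_rank j))"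

definition unrank :: "nat \<Rightarrow> 'm::{finite,linorder}" where
  "unrank = inv index_rank"

definition axis_seq :: "nat \<Rightarrow> 'a::zero_neq_one^'m::{finite,linorder}" where
  "axis_seq i = axis (unrank i) 1"

lemma index_rank_less: "index_rank (j::'m::{finite,linorder}) < CARD('m)"
  unfolding index_rank_def by (rule psubset_card_mono) auto

lemma inj_index_rank: "inj (index_rank :: 'm::{finite,linorder} \<Rightarrow> nat)"
proof (rule linorder_injI)
  fix i j :: 'm assume "i < j"
  then have "{k. k < i} \<subset> {k. k < j}" by auto
  then have "index_rank i < index_rank j" unfolding index_rank_def by (rule psubset_card_mono[rotated]) simp
  then show "index_rank i \<noteq> index_rank j" by simp
qed

lemma range_index_rank: "range (index_rank :: 'm::{finite,linorder} \<Rightarrow> nat) = {..<CARD('m)}"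
  by (rule card_subset_eq) (auto simp: index_rank_less card_image[OF inj_index_rank])

lemma bij_index_rank: "bij_betw (index_rank :: 'm::{finite,linorder} \<Rightarrow> nat) UNIV {..<CARD('m)}"
  using inj_index_rank range_index_rank by (simp add: bij_betw_def)

lemma unrank_rank [simp]: "unrank (index_rank j) = j"
  by (simp add: unrank_def inj_index_rank)

lemma rank_unrank [simp]: "i < CARD('m) \<Longrightarrow> index_rank (unrank i :: 'm::{finite,linorder}) = i"
  unfolding unrank_def by (rule f_inv_into_f) (simp add: range_index_rank)

lemma bij_unrank: "bij_betw (unrank :: nat \<Rightarrow> 'm::{finite,linorder}) {..<CARD('m)} UNIV"
  by (rule bij_betw_byWitness[where f' = index_rank]) (auto simp: index_rank_less)

lemma sum_index_rank:
  "(\<Sum>j\<in>(UNIV::'m::{finite,linorder} set). h (index_rank j)) = (\<Sum>i<CARD('m). h i)"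
  by (rule sum.reindex_bij_betw[OF bij_index_rank])

lemma frame_matrix_nth [simp]: "frame_matrix v $ j = v (index_rank j)"
  by (simp add: frame_matrix_def)

lemma frame_matrix_cong:
  "(\<And>i. i < CARD('m) \<Longrightarrow> v i = w i) \<Longrightarrow> frame_matrix v = frame_matrix (w :: nat \<Rightarrow> 'a^'m::{finite,linorder})"
  by (simp add: frame_matrix_def index_rank_less)

lemma frame_matrix_upd:
  fixes v :: "nat \<Rightarrow> 'a^'m::{finite,linorder}"
  assumes "i < CARD('m)"
  shows "frame_matrix (v(i := x)) = (\<chi> k. if k = unrank i then x else frame_matrix v $ k)"
  using assms by (auto simp: vec_eq_iff)

lemma frame_matrix_axis: "frame_matrix (axis_seq :: nat \<Rightarrow> 'a::zero_neq_one^'m::{finite,linorder}) = mat 1"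
  by (simp add: vec_eq_iff axis_seq_def axis_def mat_def) 

lemma det_frame_matrix_axis [simp]:
  "det (frame_matrix (axis_seq :: nat \<Rightarrow> 'a::{comm_ring_1}^'m::{finite,linorder})) = 1"
  by (simp add: frame_matrix_axis)

lemma frame_expand:
  fixes x :: "'a::field^'m::{finite,linorder}"
  shows "x = (\<Sum>i<CARD('m). x $ unrank i *s axis_seq i)"
proof -
  have "(\<Sum>i<CARD('m). x $ unrank i *s axis_seq i) = (\<Sum>j\<in>UNIV. x $ j *s axis j 1)"
    unfolding axis_seq_def by (rule sum.reindex_bij_betw[OF bij_unrank])
  then show ?thesis by (simp add: basis_expansion)
qed

subsection \<open>Alternating complex multilinear forms\<close>

lemma form_type_k0_cong: "form_type_k0 k \<alpha> \<Longrightarrow> (\<And>i. i < k \<Longrightarrow> v i = w i) \<Longrightarrow> \<alpha> v = \<alpha> w"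
  unfolding form_type_k0_def by blast

lemma form_type_k0_slot:
  "form_type_k0 k \<alpha> \<Longrightarrow> i < k \<Longrightarrow> \<alpha> (v(i := x + a *s y)) = \<alpha> (v(i := x)) + a * \<alpha> (v(i := y))"
  unfolding form_type_k0_def by blast

lemma form_type_k0_alt:
  "form_type_k0 k \<alpha> \<Longrightarrow> i \<noteq> j \<Longrightarrow> i < k \<Longrightarrow> j < k \<Longrightarrow> v i = v j \<Longrightarrow> \<alpha> v = 0"
  unfolding form_type_k0_def by (metis linorder_neqE_nat)

lemma form_type_k0_zero: "form_type_k0 k \<alpha> \<Longrightarrow> i < k \<Longrightarrow> \<alpha> (v(i := 0)) = 0"
  using form_type_k0_slot[of k \<alpha> i v 0 1 0] by simp

lemma form_type_k0_scale:
  "form_type_k0 k \<alpha> \<Longrightarrow> i < k \<Longrightarrow> \<alpha> (v(i := a *s y)) = a * \<alpha> (v(i := y))"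
  using form_type_k0_slot[of k \<alpha> i v 0 a y] form_type_k0_zero[of k \<alpha> i v] by simp

lemma form_type_k0_sum:
  assumes "form_type_k0 k \<alpha>" "i < k"
  shows "\<alpha> (v(i := \<Sum>j\<in>S. c j *s x j)) = (\<Sum>j\<in>S. c j * \<alpha> (v(i := x j)))"
proof (induction S rule: infinite_finite_induct)
  case (insert j S)
  then show ?case
    using form_type_k0_slot[OF assms, of v "\<Sum>j\<in>S. c j *s x j" "c j" "x j"]
    by (simp add: add.commute del: fun_upd_apply)
qed (auto simp: form_type_k0_zero[OF assms] simp del: fun_upd_apply)

lemma form_type_k0_swap:
  assumes "form_type_k0 k \<alpha>" "i < k" "j < k" "i \<noteq> j"
  shows "\<alpha> (v \<circ> Transposition.transpose i j) = - \<alpha> v"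
proof -
  have add: "\<alpha> (w(l := x + y)) = \<alpha> (w(l := x)) + \<alpha> (w(l := y))" if "l < k" for w x y l
    using form_type_k0_slot[OF assms(1) that, of w x 1 y] by simp
  let ?f = "\<lambda>a b. \<alpha> (v(i := a, j := b))"
  have z: "?f a a = 0" for a
    using form_type_k0_alt[OF assms(1) assms(4,2,3), of "v(i := a, j := a)"] assms(4) by simp
  have 1: "?f (a + b) c = ?f a c + ?f b c" for a b c
    using add[OF assms(2), of "v(j := c)" a b] assms(4) by (simp add: fun_upd_twist)
  have 2: "?f c (a + b) = ?f c a + ?f c b" for a b c
    using add[OF assms(3), of "v(i := c)" a b] by simp
  have "0 = ?f (v i + v j) (v i + v j)" by (simp only: z)
  also have "\<dots> = ?f (v i) (v i) + ?f (v i) (v j) + (?f (v j) (v i) + ?f (v j) (v j))"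
    by (simp only: 1 2 add_ac)
  also have "\<dots> = ?f (v i) (v j) + ?f (v j) (v i)"
    by (simp only: z add_0_left add_0_right)
  finally have "?f (v j) (v i) = - ?f (v i) (v j)" by (metis add.commute eq_neg_iff_add_eq_0)
  moreover have "v \<circ> Transposition.transpose i j = v(i := v j, j := v i)"
    using assms(4) by (auto simp: fun_eq_iff Transposition.transpose_def)
  ultimately show ?thesis by simp
qed

lemma form_type_k0_permute:
  assumes "form_type_k0 k \<alpha>" "p permutes {..<k}"
  shows "\<alpha> (v \<circ> p) = of_int (sign p) * \<alpha> v"
  using finite_lessThan[of k] assms(2)
proof (induction p arbitrary: v rule: permutes_rev_induct)
  case id
  then show ?case by simp
next
  case (swap a b p)
  then have "\<alpha> ((v \<circ> p) \<circ> Transposition.transpose a b) = - \<alpha> (v \<circ> p)"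
    by (intro form_type_k0_swap[OF assms(1)]) auto
  moreover have "permutation p" using swap.hyps(4) permutation_permutes finite_lessThan by blast
  ultimately show ?case
    using swap.IH[of v] swap.hyps(3)
    by (simp only: o_assoc sign_compose permutation_swap_id sign_swap_id) simp
qed

text \<open>Multilinearity reduces to frames of coordinate vectors, and there either a vector is repeated or
  the frame is a permutation of the coordinate frame.\<close>

lemma form_type_k0_eq_0I:
  fixes \<phi> :: "(nat \<Rightarrow> complex^'m::{finite,linorder}) \<Rightarrow> complex"
  assumes \<phi>: "form_type_k0 CARD('m) \<phi>" and 0: "\<phi> axis_seq = 0"
  shows "\<phi> v = 0"
proof -
  have basis: "\<phi> (\<lambda>i. axis (J i) 1) = 0" for J :: "nat \<Rightarrow> 'm"
  proof (cases "inj_on J {..<CARD('m)}")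
    case False
    then obtain i j where "i < CARD('m)" "j < CARD('m)" "i \<noteq> j" "J i = J j"
      by (auto simp: inj_on_def)
    then show ?thesis by (intro form_type_k0_alt[OF \<phi>, of i j]) auto
  next
    case True
    define p where "p i = (if i < CARD('m) then index_rank (J i) else i)" for i
    have "inj_on p {..<CARD('m)}"
      using True inj_index_rank by (auto simp: inj_on_def p_def inj_def)
    moreover have "p ` {..<CARD('m)} \<subseteq> {..<CARD('m)}"
      by (auto simp: p_def index_rank_less)
    ultimately have "p ` {..<CARD('m)} = {..<CARD('m)}"
      by (intro endo_inj_surj) auto
    with \<open>inj_on p {..<CARD('m)}\<close> have "p permutes {..<CARD('m)}"
      by (intro bij_imp_permutes) (auto simp: bij_betw_def p_def)
    then have "\<phi> (axis_seq \<circ> p) = 0"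
      using form_type_k0_permute[OF \<phi>] 0 by simp
    moreover have "\<phi> (axis_seq \<circ> p) = \<phi> (\<lambda>i. axis (J i) 1)"
      by (rule form_type_k0_cong[OF \<phi>]) (simp add: axis_seq_def p_def)
    ultimately show ?thesis by simp
  qed
  have "\<phi> v = 0" if "n \<le> CARD('m)" "\<forall>i. n \<le> i \<longrightarrow> (\<exists>j. v i = axis j 1)" for n v
    using that
  proof (induction n arbitrary: v)
    case 0
    then obtain J where "\<And>i. v i = axis (J i) 1" by (metis le0)
    then have "v = (\<lambda>i. axis (J i) 1)" by auto
    then show ?case using basis by simp
  next
    case (Suc n)
    have n: "n < CARD('m)" using Suc.prems by simp
    have "\<phi> (v(n := v n)) = \<phi> (v(n := \<Sum>j\<in>UNIV. v n $ j *s axis j 1))" by (simp only: basis_expansion)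
    also have "\<dots> = (\<Sum>j\<in>UNIV. v n $ j * \<phi> (v(n := axis j 1)))"
      by (rule form_type_k0_sum[OF \<phi> n])
    also have "\<dots> = 0"
    proof (intro sum.neutral ballI)
      fix j
      have "\<phi> (v(n := axis j 1)) = 0"
        using Suc.prems by (intro Suc.IH) (auto simp: Suc_le_eq)
      then show "v n $ j * \<phi> (v(n := axis j 1)) = 0" by simp
    qed
    finally show ?case by simp
  qed
  from this[of "CARD('m)" "\<lambda>i. if i < CARD('m) then v i else axis undefined 1"]
  have "\<phi> (\<lambda>i. if i < CARD('m) then v i else axis undefined 1) = 0" by auto
  then show ?thesis
    using form_type_k0_cong[OF \<phi>, of v "\<lambda>i. if i < CARD('m) then v i else axis undefined 1"] by simp
qed

lemma det_frame_slot:
  fixes v :: "nat \<Rightarrow> 'a::comm_ring_1^'m::{finite,linorder}"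
  assumes "i < CARD('m)"
  shows "det (frame_matrix (v(i := x + a *s y))) =
    det (frame_matrix (v(i := x))) + a * det (frame_matrix (v(i := y)))"
  unfolding frame_matrix_upd[OF assms] det_row_add[of "unrank i"] det_row_mul[of "unrank i"] ..

lemma det_frame_alt:
  fixes v :: "nat \<Rightarrow> 'a::comm_ring_1^'m::{finite,linorder}"
  assumes "i \<noteq> j" "i < CARD('m)" "j < CARD('m)" "v i = v j"
  shows "det (frame_matrix v) = 0"
  by (rule det_identical_rows[of "unrank i" "unrank j"])
    (use assms in \<open>auto simp: row_def dest: arg_cong[where f = index_rank]\<close>)

lemma form_type_k0_det:
  "form_type_k0 CARD('m) (\<lambda>v :: nat \<Rightarrow> complex^'m::{finite,linorder}. det (frame_matrix v))"
  unfolding form_type_k0_def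
proof (intro conjI allI impI)
  fix v :: "nat \<Rightarrow> complex^'m::{finite,linorder}" and i j
  assume "i < j \<and> j < CARD('m) \<and> v i = v j"
  then show "det (frame_matrix v) = 0" by (intro det_frame_alt[of i j]) auto
qed (auto simp: det_frame_slot simp del: fun_upd_apply intro: arg_cong[where f = det] frame_matrix_cong)

text \<open>The difference of the two sides is a form that vanishes on the coordinate frame.\<close>

lemma form_type_k0_top:
  fixes \<alpha> :: "(nat \<Rightarrow> complex^'m::{finite,linorder}) \<Rightarrow> complex"
  assumes "form_type_k0 CARD('m) \<alpha>"
  shows "\<alpha> v = \<alpha> axis_seq * det (frame_matrix v)"
proof -
  have "form_type_k0 CARD('m) (\<lambda>v. \<alpha> v - \<alpha> axis_seq * det (frame_matrix v))"
    using assms form_type_k0_det[where 'm = 'm] unfolding form_type_k0_def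
    by (simp add: algebra_simps) metis
  from form_type_k0_eq_0I[OF this, of v] show ?thesis by simp
qed

subsection \<open>Determinants\<close>

lemma det_frame_swap:
  fixes v :: "nat \<Rightarrow> 'a::comm_ring_1^'m::{finite,linorder}"
  assumes "i < CARD('m)" "j < CARD('m)" "i \<noteq> j"
  shows "det (frame_matrix (v \<circ> Transposition.transpose i j)) = - det (frame_matrix v)"
proof -
  let ?p = "Transposition.transpose (unrank i) (unrank j :: 'm)"
  have "index_rank (?p k) = Transposition.transpose i j (index_rank k)" for k
    using assms by (auto simp: Transposition.transpose_def)
  then have "frame_matrix (v \<circ> Transposition.transpose i j) = (\<chi> k. frame_matrix v $ ?p k)"
    by (simp add: vec_eq_iff)
  moreover have "unrank i \<noteq> (unrank j :: 'm)" using assms by (metis rank_unrank)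
  ultimately show ?thesis
    using det_permute_rows[of ?p "frame_matrix v"] by (simp add: permutes_swap_id sign_swap_id)
qed

text \<open>Moving a vector from the front of a frame into slot \<open>i\<close> takes \<open>i\<close> adjacent transpositions.\<close>

lemma det_frame_front:
  fixes v :: "nat \<Rightarrow> 'a::comm_ring_1^'m::{finite,linorder}"
  assumes "i < CARD('m)"
  shows "det (frame_matrix (case_nat x (\<lambda>j. v (if j < i then j else Suc j)))) =
    (-1) ^ i * det (frame_matrix (v(i := x)))"
  using assms
proof (induction i arbitrary: v)
  case 0
  have "case_nat x (\<lambda>j. v (if j < 0 then j else Suc j)) = v(0 := x)"
    by (auto split: nat.splits)
  then show ?case by (simp only: power_0 mult_1)
next
  case (Suc i)
  let ?t = "Transposition.transpose i (Suc i)"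
  have 1: "case_nat x (\<lambda>j. v (if j < Suc i then j else Suc j)) =
      case_nat x (\<lambda>j. (v \<circ> ?t) (if j < i then j else Suc j))"
    by (auto simp: fun_eq_iff Transposition.transpose_def split: nat.splits)
  have 2: "(v \<circ> ?t)(i := x) = v(Suc i := x) \<circ> ?t"
    by (auto simp: fun_eq_iff Transposition.transpose_def)
  show ?case
    using Suc.IH[of "v \<circ> ?t"] Suc.prems
    unfolding 1 2 by (simp only: det_frame_swap) (simp del: fun_upd_apply)
qed

text \<open>On both sides only the permutations that map \<open>i\<close> to \<open>k\<close> contribute. With this symmetry of the cofactors,
  Cramer's rule for the rows follows from the rule for the columns without inverting the matrix, so
  that it also holds for singular matrices.\<close>

lemma det_row_axis_eq_column_axis:
  fixes V :: "'a::comm_ring_1^'n^'n"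
  shows "det (\<chi> a. if a = i then axis k 1 else V $ a) =
    det (\<chi> a b. if b = k then (if a = i then 1 else 0) else V $ a $ b)"
  unfolding det_def
proof (intro sum.cong refl arg_cong2[where f = "(*)"])
  fix p assume "p \<in> {p. p permutes (UNIV :: 'n set)}"
  then have p: "p permutes UNIV" by simp
  let ?f = "\<lambda>a. (\<chi> a. if a = i then axis k 1 else V $ a) $ a $ p a"
  let ?g = "\<lambda>a. (\<chi> a b. if b = k then (if a = i then 1 else 0) else V $ a $ b) $ a $ p a"
  show "prod ?f UNIV = prod ?g UNIV"
  proof (cases "p i = k")
    case True
    have "p a = k \<longleftrightarrow> a = i" for a using True permutes_inj[OF p] by (auto simp: inj_def)
    then have "?f a = ?g a" for a by (auto simp: axis_def)
    then show ?thesis by simp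
  next
    case False
    have "?f i = 0" using False by (auto simp: axis_def)
    then have "prod ?f UNIV = 0" by (intro prod_zero) auto
    moreover obtain a where a: "p a = k" using permutes_surj[OF p] by (metis surjD)
    then have "?g a = 0" using False by auto
    then have "prod ?g UNIV = 0" by (intro prod_zero bexI[of _ a]) auto
    ultimately show ?thesis by simp
  qed
qed

lemma cramer_rows:
  fixes V :: "'a::field^'n^'n"
  shows "(\<Sum>i\<in>UNIV. det (\<chi> a. if a = i then x else V $ a) *s V $ i) = det V *s x"
proof -
  have row: "det (\<chi> a. if a = i then x else V $ a) = (\<Sum>k\<in>UNIV. x $ k * det (\<chi> a. if a = i then axis k 1 else V $ a))" for i
  proof -
    have "det (\<chi> a. if a = i then x else V $ a) =
      det (\<chi> a. if a = i then (\<Sum>k\<in>UNIV. x $ k *s axis k 1) else V $ a)" by (subst basis_expansion) simp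
    also have "\<dots> = (\<Sum>k\<in>UNIV. det (\<chi> a. if a = i then x $ k *s axis k 1 else V $ a))"
      by (rule det_linear_row_sum) simp
    finally show ?thesis by (simp add: det_row_mul)
  qed
  have col: "(\<Sum>i\<in>UNIV. V $ i $ l * det (\<chi> a. if a = i then axis k 1 else V $ a)) = (if k = l then det V else 0)"
    for k l
  proof -
    have "(\<Sum>i\<in>UNIV. V $ i $ l * det (\<chi> a. if a = i then axis k 1 else V $ a)) =
       (\<Sum>i\<in>UNIV. V $ i $ l * det (\<chi> b. if b = k then axis i 1 else column b V))"
      by (intro sum.cong refl arg_cong2[where f = "(*)"], subst det_row_axis_eq_column_axis,
          subst det_transpose[symmetric], rule arg_cong[where f = det])
        (auto simp: vec_eq_iff transpose_def axis_def column_def)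
    also have "\<dots> = det (\<chi> b. if b = k then (\<Sum>i\<in>UNIV. column l V $ i *s axis i 1) else column b V)"
      by (subst det_linear_row_sum) (simp_all add: det_row_mul column_def)
    also have "\<dots> = det (\<chi> b. if b = k then column l V else column b V)"
      by (subst basis_expansion) simp
    also have "\<dots> = (if k = l then det V else 0)"
    proof (cases "k = l")
      case True
      have "(\<chi> b. if b = k then column l V else column b V) = transpose V"
        using True by (auto simp: vec_eq_iff column_def transpose_def)
      then show ?thesis using True by simp
    next
      case False
      then show ?thesis
        by (auto intro!: det_identical_rows[of k l] simp: row_def vec_eq_iff)
    qed
    finally show ?thesis .
  qed
  show ?thesis
  proof (rule vec_eq_iff[THEN iffD2], rule allI)
    fix l
    have "(\<Sum>i\<in>UNIV. det (\<chi> a. if a = i then x else V $ a) *s V $ i) $ l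
      = (\<Sum>i\<in>UNIV. \<Sum>k\<in>UNIV. x $ k * (V $ i $ l * det (\<chi> a. if a = i then axis k 1 else V $ a)))"
      by (simp add: row sum_distrib_left mult_ac)
    also have "\<dots> = (\<Sum>k\<in>UNIV. x $ k * (if k = l then det V else 0))"
      by (subst sum.swap) (simp add: sum_distrib_left[symmetric] col)
    also have "\<dots> = det V * x $ l"
      by (simp add: if_distrib[where f = "(*) _"] cong: if_cong)
    finally show "(\<Sum>i\<in>UNIV. det (\<chi> a. if a = i then x else V $ a) *s V $ i) $ l = (det V *s x) $ l"
      by simp
  qed
qed

lemma cramer_frame:
  fixes v :: "nat \<Rightarrow> 'a::field^'m::{finite,linorder}"
  shows "(\<Sum>i<CARD('m). det (frame_matrix (v(i := x))) *s v i) = det (frame_matrix v) *s x"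
proof -
  have "(\<Sum>i<CARD('m). det (frame_matrix (v(i := x))) *s v i) =
     (\<Sum>j\<in>UNIV. det (frame_matrix (v(index_rank (j::'m) := x))) *s v (index_rank j))"
    by (rule sum_index_rank[symmetric])
  also have "\<dots> = det (frame_matrix v) *s x"
    unfolding cramer_rows[of x "frame_matrix v", symmetric]
    by (simp add: frame_matrix_upd index_rank_less)
  finally show ?thesis .
qed

lemma has_derivative_det_frame:
  fixes w :: "'b::real_normed_vector \<Rightarrow> nat \<Rightarrow> 'a::real_normed_field^'m::{finite,linorder}"
  assumes "\<And>i. i < CARD('m) \<Longrightarrow> ((\<lambda>z. w z i) has_derivative w' i) (at y)"
  shows "((\<lambda>z. det (frame_matrix (w z))) has_derivative
     (\<lambda>h. \<Sum>i<CARD('m). det (frame_matrix ((w y)(i := w' i h))))) (at y)"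
proof -
  let ?U = "UNIV :: 'm set"
  have nth: "((\<lambda>z. w z (index_rank j) $ k) has_derivative (\<lambda>h. w' (index_rank j) h $ k)) (at y)" for j k :: 'm
    using bounded_linear.has_derivative[OF bounded_linear_vec_nth assms[OF index_rank_less]] .
  have "((\<lambda>z. \<Sum>p | p permutes ?U. of_int (sign p) * (\<Prod>j\<in>?U. w z (index_rank j) $ p j)) has_derivative
    (\<lambda>h. \<Sum>p | p permutes ?U. of_int (sign p) *
      (\<Sum>i\<in>?U. w' (index_rank i) h $ p i * (\<Prod>j\<in>?U - {i}. w y (index_rank j) $ p j)))) (at y)"
    by (intro has_derivative_sum has_derivative_mult_right has_derivative_prod nth)
  moreover have "(\<Sum>p | p permutes ?U. of_int (sign p) *
      (\<Sum>i\<in>?U. w' (index_rank i) h $ p i * (\<Prod>j\<in>?U - {i}. w y (index_rank j) $ p j))) =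
      (\<Sum>i<CARD('m). det (frame_matrix ((w y)(i := w' i h))))" for h
  proof -
    have "det (frame_matrix ((w y)(index_rank i := w' (index_rank i) h))) =
      (\<Sum>p | p permutes ?U. of_int (sign p) *
        (w' (index_rank i) h $ p i * (\<Prod>j\<in>?U - {i}. w y (index_rank j) $ p j)))" for i :: 'm
      unfolding det_def
    proof (intro sum.cong refl arg_cong2[where f = "(*)"])
      fix p :: "'m \<Rightarrow> 'm"
      have "(\<Prod>j\<in>?U. frame_matrix ((w y)(index_rank i := w' (index_rank i) h)) $ j $ p j) =
         frame_matrix ((w y)(index_rank i := w' (index_rank i) h)) $ i $ p i *
         (\<Prod>j\<in>?U - {i}. frame_matrix ((w y)(index_rank i := w' (index_rank i) h)) $ j $ p j)"
        by (rule prod.remove) auto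
      also have "(\<Prod>j\<in>?U - {i}. frame_matrix ((w y)(index_rank i := w' (index_rank i) h)) $ j $ p j) =
         (\<Prod>j\<in>?U - {i}. w y (index_rank j) $ p j)"
        by (rule prod.cong) (auto dest: injD[OF inj_index_rank])
      finally show "(\<Prod>j\<in>?U. frame_matrix ((w y)(index_rank i := w' (index_rank i) h)) $ j $ p j) =
         w' (index_rank i) h $ p i * (\<Prod>j\<in>?U - {i}. w y (index_rank j) $ p j)"
        by simp
    qed
    then have "(\<Sum>i\<in>?U. det (frame_matrix ((w y)(index_rank i := w' (index_rank i) h)))) =
      (\<Sum>p | p permutes ?U. of_int (sign p) *
      (\<Sum>i\<in>?U. w' (index_rank i) h $ p i * (\<Prod>j\<in>?U - {i}. w y (index_rank j) $ p j)))"
      by (simp add: sum_distrib_left) (rule sum.swap)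
    then show ?thesis
      using sum_index_rank[where 'm = 'm and h = "\<lambda>i. det (frame_matrix ((w y)(i := w' i h)))"]
      by metis
  qed
  ultimately show ?thesis unfolding det_def by (simp only: frame_matrix_nth)
qed

lemma frame_expand_real:
  fixes x :: "real^'m::{finite,linorder}"
  shows "x = (\<Sum>i<CARD('m). x $ unrank i *\<^sub>R axis_seq i)"
  using frame_expand[of x] by (simp add: scalar_mult_eq_scaleR)

lemma det_frame_linear_image:
  fixes D :: "real^'m::{finite,linorder} \<Rightarrow> 'a::real_normed_field^'m::{finite,linorder}"
  assumes "linear D"
  shows "det (frame_matrix (\<lambda>i. D (v i))) =
    of_real (det (frame_matrix v)) * det (frame_matrix (\<lambda>i. D (axis_seq i)))"
proof -
  have "frame_matrix (\<lambda>i. D (v i)) =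
    (\<chi> i j. of_real (frame_matrix v $ i $ j)) ** frame_matrix (\<lambda>i. D (axis_seq i))"
  proof (simp add: vec_eq_iff[of "frame_matrix _"] vec_eq_iff[of "D _"] matrix_matrix_mult_def, intro allI)
    fix i j :: 'm
    have "D (v (index_rank i)) = D (\<Sum>k<CARD('m). v (index_rank i) $ unrank k *\<^sub>R axis_seq k)"
      using frame_expand_real by metis
    also have "\<dots> = (\<Sum>k<CARD('m). v (index_rank i) $ unrank k *\<^sub>R D (axis_seq k))"
      by (simp add: linear_sum[OF assms] linear_scale[OF assms])
    also have "\<dots> = (\<Sum>k\<in>UNIV. v (index_rank i) $ k *\<^sub>R D (axis_seq (index_rank k)))"
      using sum_index_rank[where 'm = 'm and h = "\<lambda>k. v (index_rank i) $ unrank k *\<^sub>R D (axis_seq k)"]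
      by simp
    finally have "D (v (index_rank i)) $ j =
      (\<Sum>k\<in>UNIV. v (index_rank i) $ k *\<^sub>R (D (axis_seq (index_rank k)) $ j))"
      by simp
    then show "D (v (index_rank i)) $ j =
      (\<Sum>k\<in>UNIV. of_real (v (index_rank i) $ k) * D (axis_seq (index_rank k)) $ j)"
      by (simp only: scaleR_conv_of_real)
  qed
  moreover have "det (\<chi> i j. (of_real (frame_matrix v $ i $ j) :: 'a)) = of_real (det (frame_matrix v))"
    by (simp add: det_def)
  ultimately show ?thesis by (simp add: det_mul)
qed

text \<open>Differentiate the previous lemma for the linear maps \<open>D + s E\<close> at \<open>s = 0\<close>.\<close>

lemma det_frame_linear_variation:
  fixes D E :: "real^'m::{finite,linorder} \<Rightarrow> 'a::real_normed_field^'m::{finite,linorder}"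
  assumes "linear D" "linear E"
  shows "(\<Sum>i<CARD('m). det (frame_matrix ((\<lambda>j. D (v j))(i := E (v i))))) =
    of_real (det (frame_matrix v)) *
    (\<Sum>i<CARD('m). det (frame_matrix ((\<lambda>j. D (axis_seq j))(i := E (axis_seq i)))))"
proof -
  let ?c = "of_real (det (frame_matrix v)) :: 'a"
  have d: "((\<lambda>s::real. det (frame_matrix (\<lambda>j. D (w j) + s *\<^sub>R E (w j)))) has_derivative
    (\<lambda>h. \<Sum>i<CARD('m). det (frame_matrix ((\<lambda>j. D (w j))(i := h *\<^sub>R E (w i)))))) (at 0)" for w
  proof -
    have "((\<lambda>s. D (w i) + s *\<^sub>R E (w i)) has_derivative (\<lambda>h. h *\<^sub>R E (w i))) (at 0)" for i
      by (auto intro!: derivative_eq_intros)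
    from has_derivative_det_frame[where w = "\<lambda>s j. D (w j) + s *\<^sub>R E (w j)", OF this]
    show ?thesis by (simp del: fun_upd_apply)
  qed
  have "linear (\<lambda>x. D x + s *\<^sub>R E x)" for s
    using assms by (intro linear_compose_add linear_compose_scale_right)
  then have "(\<lambda>s::real. det (frame_matrix (\<lambda>j. D (v j) + s *\<^sub>R E (v j)))) =
     (\<lambda>s. ?c * det (frame_matrix (\<lambda>j. D (axis_seq j) + s *\<^sub>R E (axis_seq j))))"
    using det_frame_linear_image by (intro ext) blast
  with has_derivative_mult_right[OF d[of axis_seq], of ?c]
  have "((\<lambda>s::real. det (frame_matrix (\<lambda>j. D (v j) + s *\<^sub>R E (v j)))) has_derivative
    (\<lambda>h. ?c * (\<Sum>i<CARD('m). det (frame_matrix ((\<lambda>j. D (axis_seq j))(i := h *\<^sub>R E (axis_seq i))))))) (at 0)"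
    by simp
  from fun_cong[OF has_derivative_unique[OF d[of v] this], of 1] show ?thesis by simp
qed

subsection \<open>Orthogonalisation\<close>

text \<open>The Gram-Schmidt process for a form that is only assumed to be linear in its first argument
  covers real scalar products and hermitian forms at once. It changes each row by a combination of
  the others, so that the determinant is preserved; and the correction of a row is orthogonal to the
  new row, which therefore is not longer than the old one.\<close>

lemma gram_schmidt_rows:
  fixes H :: "'a::field^'n \<Rightarrow> 'a^'n \<Rightarrow> 'a"
  assumes add: "\<And>x y z. H (x + y) z = H x z + H y z"
    and scale: "\<And>a x z. H (a *s x) z = a * H x z"
    and orth_sym: "\<And>x y. H x y = 0 \<Longrightarrow> H y x = 0"
    and nondeg: "\<And>x. x \<noteq> 0 \<Longrightarrow> H x x \<noteq> 0"
  obtains W :: "'a^'n^'n" where "det W = det V" "\<And>i j. i \<noteq> j \<Longrightarrow> H (W $ i) (W $ j) = 0"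
    "\<And>i. H (V $ i - W $ i) (W $ i) = 0"
proof -
  have zero: "H 0 z = 0" for z using scale[of 0 0 z] by simp
  have Hsum: "H (\<Sum>j\<in>S. c j *s x j) z = (\<Sum>j\<in>S. c j * H (x j) z)" for S :: "'n set" and c x z
    by (induction S rule: infinite_finite_induct) (auto simp: zero add scale)
  have minus: "H (x - y) z = H x z - H y z" for x y z
    using add[of x "(-1) *s y" z] scale[of "-1" y z] by (simp add: vector_sneg_minus1[symmetric])
  have "\<exists>W :: 'a^'n^'n. det W = det V \<and> (\<forall>i. i \<notin> S \<longrightarrow> W $ i = V $ i) \<and>
    (\<forall>i\<in>S. \<forall>j\<in>S. i \<noteq> j \<longrightarrow> H (W $ i) (W $ j) = 0) \<and> (\<forall>i\<in>S. H (V $ i - W $ i) (W $ i) = 0)" for S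
    using finite[of S]
  proof (induction S rule: finite_induct)
    case empty
    show ?case by (rule exI[of _ V]) auto
  next
    case (insert k S)
    then obtain W :: "'a^'n^'n" where W: "det W = det V" "\<And>i. i \<notin> S \<Longrightarrow> W $ i = V $ i"
      "\<And>i j. i \<in> S \<Longrightarrow> j \<in> S \<Longrightarrow> i \<noteq> j \<Longrightarrow> H (W $ i) (W $ j) = 0"
      "\<And>i. i \<in> S \<Longrightarrow> H (V $ i - W $ i) (W $ i) = 0" by auto
    define c where "c j = H (V $ k) (W $ j) / H (W $ j) (W $ j)" for j
    define p where "p = (\<Sum>j\<in>S. c j *s W $ j)"
    have Hp: "H p (W $ l) = H (V $ k) (W $ l)" if "l \<in> S" for l
    proof -
      have "H p (W $ l) = (\<Sum>j\<in>S. c j * H (W $ j) (W $ l))" unfolding p_def by (rule Hsum)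
      also have "\<dots> = (\<Sum>j\<in>S. if j = l then c l * H (W $ l) (W $ l) else 0)"
        using W(3) that by (intro sum.cong) auto
      also have "\<dots> = c l * H (W $ l) (W $ l)" using that insert.hyps by simp
      also have "\<dots> = H (V $ k) (W $ l)"
      proof (cases "W $ l = 0")
        case True
        then show ?thesis using orth_sym[OF zero] zero by simp
      qed (simp add: c_def nondeg)
      finally show ?thesis .
    qed
    define W' where "W' = (\<chi> i. if i = k then row k W + (- p) else row i W)"
    have W'k: "W' $ k = V $ k - p" using W(2)[OF insert.hyps(2)] by (simp add: W'_def row_def)
    have W'o: "W' $ i = W $ i" if "i \<noteq> k" for i using that by (simp add: W'_def row_def)
    have "p \<in> vec.span {row j W |j. j \<noteq> k}"
      unfolding p_def using insert.hyps(2)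
      by (intro vec.span_sum vec.span_scale vec.span_base) (auto simp: row_def)
    then have "det W' = det W"
      unfolding W'_def by (intro det_row_span vec.span_neg)
    moreover have "H (W' $ k) (W $ l) = 0" if "l \<in> S" for l
      using Hp[OF that] by (simp add: W'k minus)
    moreover have "H p (W' $ k) = 0"
    proof -
      have "H (W $ j) (W' $ k) = 0" if "j \<in> S" for j
        using Hp[OF that] by (intro orth_sym[of "W' $ k"]) (simp only: W'k minus diff_self)
      then show ?thesis unfolding p_def Hsum by simp
    qed
    moreover have "W' $ i = W $ i" if "i \<in> S" for i using W'o insert.hyps(2) that by metis
    moreover have "V $ k - W' $ k = p" by (simp add: W'k)
    moreover have "H (W $ l) (W' $ k) = 0" if "l \<in> S" for l
      using orth_sym calculation(2) that by blast
    ultimately show ?case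
      using W insert.hyps(2) W'o by (intro exI[of _ W'] conjI ballI allI impI) auto
  qed
  from this[of UNIV] show ?thesis using that by auto
qed

section \<open>Wedge products of decomposable forms\<close>

text \<open>The wedge product \<open>\<phi>\<^sub>0 \<and> \<dots> \<and> \<phi>\<^bsub>n-1\<^esub>\<close> of one-forms.\<close>

definition decomposable :: "nat \<Rightarrow> (nat \<Rightarrow> 'v \<Rightarrow> complex) \<Rightarrow> (nat \<Rightarrow> 'v) \<Rightarrow> complex" where
  "decomposable n \<phi> v = (\<Sum>\<sigma> | \<sigma> permutes {..<n}. of_int (sign \<sigma>) * (\<Prod>i<n. \<phi> i (v (\<sigma> i))))"

lemma decomposable_cong: "(\<And>i. i < n \<Longrightarrow> \<phi> i = \<psi> i) \<Longrightarrow> decomposable n \<phi> v = decomposable n \<psi> v"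
  by (simp add: decomposable_def)

lemma permutation_of_permutes: "\<sigma> permutes {..<n::nat} \<Longrightarrow> permutation \<sigma>"
  using permutation_permutes finite_lessThan by blast

lemma sign_square: "of_int (sign \<sigma>) * of_int (sign \<sigma>) = (1::'a::ring_1)"
  by (simp add: sign_def)

lemma decomposable_permute:
  assumes "\<pi> permutes {..<n}"
  shows "decomposable n (\<lambda>i. \<phi> (\<pi> i)) v = of_int (sign \<pi>) * decomposable n \<phi> v"
proof -
  have "decomposable n (\<lambda>i. \<phi> (\<pi> i)) v =
    (\<Sum>\<sigma> | \<sigma> permutes {..<n}. of_int (sign (\<sigma> \<circ> \<pi>)) * (\<Prod>i<n. \<phi> (\<pi> i) (v ((\<sigma> \<circ> \<pi>) i))))"
    unfolding decomposable_def by (rule sum_permutations_compose_right[OF assms])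
  also have "\<dots> = (\<Sum>\<sigma> | \<sigma> permutes {..<n}. of_int (sign \<pi>) * (of_int (sign \<sigma>) * (\<Prod>i<n. \<phi> i (v (\<sigma> i)))))"
  proof (intro sum.cong refl)
    fix \<sigma> assume "\<sigma> \<in> {\<sigma>. \<sigma> permutes {..<n}}"
    then have "sign (\<sigma> \<circ> \<pi>) = sign \<sigma> * sign \<pi>"
      using assms by (simp add: sign_compose permutation_of_permutes)
    moreover have "(\<Prod>i<n. \<phi> (\<pi> i) (v ((\<sigma> \<circ> \<pi>) i))) = (\<Prod>i<n. \<phi> i (v (\<sigma> i)))"
      using prod.permute[OF assms, of "\<lambda>i. \<phi> i (v (\<sigma> i))"] by (simp add: o_def)
    ultimately show "of_int (sign (\<sigma> \<circ> \<pi>)) * (\<Prod>i<n. \<phi> (\<pi> i) (v ((\<sigma> \<circ> \<pi>) i))) =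
        of_int (sign \<pi>) * (of_int (sign \<sigma>) * (\<Prod>i<n. \<phi> i (v (\<sigma> i))))"
      by simp
  qed
  finally show ?thesis by (simp add: decomposable_def sum_distrib_left)
qed

lemma decomposable_permute_vectors:
  assumes "\<pi> permutes {..<n}"
  shows "decomposable n \<phi> (\<lambda>i. v (\<pi> i)) = of_int (sign \<pi>) * decomposable n \<phi> v"
proof -
  have "of_int (sign \<pi>) * decomposable n \<phi> v =
    (\<Sum>\<sigma> | \<sigma> permutes {..<n}. of_int (sign \<pi>) * (of_int (sign (\<pi> \<circ> \<sigma>)) * (\<Prod>i<n. \<phi> i (v ((\<pi> \<circ> \<sigma>) i)))))"
    unfolding decomposable_def sum_distrib_left by (rule setum_permutations_compose_left[OF assms])
  also have "\<dots> = decomposable n \<phi> (\<lambda>i. v (\<pi> i))"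
    unfolding decomposable_def
  proof (intro sum.cong refl)
    fix \<sigma> assume "\<sigma> \<in> {\<sigma>. \<sigma> permutes {..<n}}"
    then have "sign (\<pi> \<circ> \<sigma>) = sign \<pi> * sign \<sigma>"
      using assms by (simp add: sign_compose permutation_of_permutes)
    then have "of_int (sign \<pi>) * of_int (sign (\<pi> \<circ> \<sigma>)) = (of_int (sign \<sigma>) :: complex)"
      using sign_square[of \<pi>, where 'a = complex] by (simp add: mult.assoc[symmetric])
    then show "of_int (sign \<pi>) * (of_int (sign (\<pi> \<circ> \<sigma>)) * (\<Prod>i<n. \<phi> i (v ((\<pi> \<circ> \<sigma>) i)))) =
      of_int (sign \<sigma>) * (\<Prod>i<n. \<phi> i (v (\<pi> (\<sigma> i))))"
      by (simp add: mult.assoc[symmetric])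
  qed
  finally show ?thesis by simp
qed

lemma decomposable_repeated:
  assumes "i < n" "j < n" "i \<noteq> j" "\<phi> i = \<phi> j"
  shows "decomposable n \<phi> v = 0"
proof -
  let ?t = "Transposition.transpose i j"
  have "(\<lambda>k. \<phi> (?t k)) = \<phi>" using assms by (auto simp: Transposition.transpose_def)
  moreover have "?t permutes {..<n}" using assms by (intro permutes_swap_id) auto
  ultimately have "decomposable n \<phi> v = - decomposable n \<phi> v"
    using decomposable_permute[of ?t n \<phi> v] assms(3) by (simp add: sign_swap_id)
  then show ?thesis by simp
qed

lemma decomposable_repeated_vector:
  assumes "i < n" "j < n" "i \<noteq> j" "v i = v j"
  shows "decomposable n \<phi> v = 0"
proof -
  let ?t = "Transposition.transpose i j"
  have "(\<lambda>k. v (?t k)) = v" using assms by (auto simp: Transposition.transpose_def)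
  moreover have "?t permutes {..<n}" using assms by (intro permutes_swap_id) auto
  ultimately have "decomposable n \<phi> v = - decomposable n \<phi> v"
    using decomposable_permute_vectors[of ?t n \<phi> v] assms(3) by (simp add: sign_swap_id)
  then show ?thesis by simp
qed

text \<open>In the added term the one-form \<open>\<phi> k\<close> occurs twice.\<close>

lemma decomposable_add_row:
  assumes "i < n" "k < n" "i \<noteq> k"
  shows "decomposable n (\<phi>(i := \<lambda>v. \<phi> i v + \<phi> k v)) v = decomposable n \<phi> v"
proof -
  have split: "(\<Prod>j<n. \<psi> j (v (\<sigma> j))) = \<psi> i (v (\<sigma> i)) * (\<Prod>j\<in>{..<n} - {i}. \<psi> j (v (\<sigma> j)))"
    for \<psi> :: "nat \<Rightarrow> 'a \<Rightarrow> complex" and \<sigma>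
    by (rule prod.remove) (use assms in auto)
  have other: "(\<Prod>j\<in>{..<n} - {i}. (\<phi>(i := a)) j (v (\<sigma> j))) = (\<Prod>j\<in>{..<n} - {i}. \<phi> j (v (\<sigma> j)))" for a \<sigma>
    by (rule prod.cong) auto
  have "decomposable n (\<phi>(i := \<lambda>v. \<phi> i v + \<phi> k v)) v =
    decomposable n (\<phi>(i := \<phi> i)) v + decomposable n (\<phi>(i := \<phi> k)) v"
    unfolding decomposable_def split other sum.distrib[symmetric]
    by (intro sum.cong refl) (simp add: algebra_simps)
  moreover have "decomposable n (\<phi>(i := \<phi> k)) v = 0"
    using assms by (intro decomposable_repeated[of i n k]) auto
  ultimately show ?thesis by simp
qed

lemma form_type_k0_decomposable:
  fixes \<phi> :: "nat \<Rightarrow> complex^'m \<Rightarrow> complex"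
  assumes "\<And>i x y a. \<phi> i (x + a *s y) = \<phi> i x + a * \<phi> i y"
  shows "form_type_k0 n (decomposable n \<phi>)"
  unfolding form_type_k0_def
proof (intro conjI allI impI)
  fix v w :: "nat \<Rightarrow> complex^'m" assume vw: "\<forall>i<n. v i = w i"
  show "decomposable n \<phi> v = decomposable n \<phi> w"
    unfolding decomposable_def
  proof (intro sum.cong refl arg_cong2[where f = "(*)"] prod.cong)
    fix \<sigma> i assume "\<sigma> \<in> {\<sigma>. \<sigma> permutes {..<n}}" "i \<in> {..<n}"
    then show "\<phi> i (v (\<sigma> i)) = \<phi> i (w (\<sigma> i))"
      using vw permutes_in_image by fastforce
  qed
next
  fix v :: "nat \<Rightarrow> complex^'m" and x y a i assume i: "i < n"
  have split: "(\<Prod>j<n. \<phi> j ((v(i := z)) (\<sigma> j))) =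
      \<phi> (inv \<sigma> i) z * (\<Prod>j\<in>{..<n} - {inv \<sigma> i}. \<phi> j (v (\<sigma> j)))" if "\<sigma> permutes {..<n}" for z \<sigma>
  proof -
    have "inv \<sigma> i \<in> {..<n}"
      using i permutes_in_image[OF permutes_inv[OF that]] by simp
    then have "(\<Prod>j<n. \<phi> j ((v(i := z)) (\<sigma> j))) = \<phi> (inv \<sigma> i) ((v(i := z)) (\<sigma> (inv \<sigma> i))) *
      (\<Prod>j\<in>{..<n} - {inv \<sigma> i}. \<phi> j ((v(i := z)) (\<sigma> j)))"
      by (intro prod.remove) auto
    also have "\<sigma> (inv \<sigma> i) = i" using permutes_inverses(1)[OF that] .
    also have "(\<Prod>j\<in>{..<n} - {inv \<sigma> i}. \<phi> j ((v(i := z)) (\<sigma> j))) = (\<Prod>j\<in>{..<n} - {inv \<sigma> i}. \<phi> j (v (\<sigma> j)))"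
      using permutes_inverses(2)[OF that] by (intro prod.cong) auto
    finally show ?thesis by simp
  qed
  show "decomposable n \<phi> (v(i := x + a *s y)) = decomposable n \<phi> (v(i := x)) + a * decomposable n \<phi> (v(i := y))"
    unfolding decomposable_def sum_distrib_left sum.distrib[symmetric]
    by (intro sum.cong refl) (simp only: mem_Collect_eq split assms, simp add: algebra_simps)
next
  fix v :: "nat \<Rightarrow> complex^'m" and i j assume "i < j \<and> j < n \<and> v i = v j"
  then show "decomposable n \<phi> v = 0" by (intro decomposable_repeated_vector[of i n j]) auto
qed

lemma permutes_shift:
  assumes "\<tau> permutes {..<l::nat}"
  shows "(\<lambda>i. if i < k then i else k + \<tau> (i - k)) permutes {..<k + l} \<and>
    sign (\<lambda>i. if i < k then i else k + \<tau> (i - k)) = sign \<tau>"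
proof -
  have inj: "inj_on ((+) k) {..<l}" by simp
  have im: "(+) k ` {..<l} = {k..<k + l}" by (simp add: lessThan_atLeast0 add.commute)
  have "map_permutation {..<l} ((+) k) \<tau> = (\<lambda>i. if i < k then i else k + \<tau> (i - k))"
  proof
    fix i
    show "map_permutation {..<l} ((+) k) \<tau> i = (if i < k then i else k + \<tau> (i - k))"
    proof (cases "i \<in> {k..<k + l}")
      case True
      then have "inv_into {..<l} ((+) k) i = i - k"
        by (intro inv_into_f_eq[OF inj]) auto
      then show ?thesis using True unfolding map_permutation_def im restrict_id_def by auto
    next
      case False
      then have "\<not> i < k \<Longrightarrow> \<tau> (i - k) = i - k" using permutes_not_in[OF assms] by auto
      then show ?thesis using False unfolding map_permutation_def im restrict_id_def by auto
    qed
  qed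
  moreover have "map_permutation {..<l} ((+) k) \<tau> permutes {k..<k + l}"
    using map_permutation_permutes[OF _ assms, of "(+) k" "{k..<k + l}"] inj im
    by (simp add: bij_betw_def)
  ultimately show ?thesis
    using sign_map_permutation[OF inj assms] by (auto intro: permutes_subset)
qed

text \<open>For fixed permutations of the two blocks of indices, the sum over all permutations of
  \<open>k + l\<close> indices absorbs them; hence each of the \<open>k! l!\<close> pairs contributes the same.\<close>

lemma wedge_decomposable:
  "wedge k l (decomposable k \<phi>) (decomposable l \<psi>) v =
    decomposable (k + l) (\<lambda>i. if i < k then \<phi> i else \<psi> (i - k)) v"
proof -
  let ?P = "\<lambda>n. {\<sigma>. \<sigma> permutes {..<n::nat}}"
  let ?\<chi> = "\<lambda>i. if i < k then \<phi> i else \<psi> (i - k)"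
  define summand where "summand \<sigma> \<tau> \<tau>' = of_int (sign \<sigma>) *
    (of_int (sign \<tau>) * (\<Prod>i<k. \<phi> i (v (\<sigma> (\<tau> i))))) *
    (of_int (sign \<tau>') * (\<Prod>i<l. \<psi> i (v (\<sigma> (k + \<tau>' i)))))" for \<sigma> \<tau> \<tau>'
  have block: "(\<Sum>\<sigma>\<in>?P (k + l). summand \<sigma> \<tau> \<tau>') = decomposable (k + l) ?\<chi> v"
    if \<tau>: "\<tau> \<in> ?P k" and \<tau>': "\<tau>' \<in> ?P l" for \<tau> \<tau>'
  proof -
    let ?s = "\<lambda>i. if i < k then i else k + \<tau>' (i - k)"
    have s: "?s permutes {..<k + l}" "sign ?s = sign \<tau>'" using permutes_shift \<tau>' by auto
    have t: "\<tau> permutes {..<k + l}" using \<tau> by (auto intro: permutes_subset)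
    define \<rho> where "\<rho> = \<tau> \<circ> ?s"
    have \<rho>: "\<rho> permutes {..<k + l}" unfolding \<rho>_def by (rule permutes_compose[OF s(1) t])
    have sign\<rho>: "sign \<rho> = sign \<tau> * sign \<tau>'"
      unfolding \<rho>_def using s t by (simp add: sign_compose permutation_of_permutes)
    have lo: "\<rho> i = \<tau> i" if "i < k" for i using that by (simp add: \<rho>_def)
    have hi: "\<rho> (k + i) = k + \<tau>' i" for i
      unfolding \<rho>_def using permutes_not_in[of \<tau> "{..<k}"] \<tau> by simp
    have "(\<Sum>\<sigma>\<in>?P (k + l). summand \<sigma> \<tau> \<tau>') =
      (\<Sum>\<sigma>\<in>?P (k + l). of_int (sign (\<sigma> \<circ> \<rho>)) * (\<Prod>i<k + l. ?\<chi> i (v ((\<sigma> \<circ> \<rho>) i))))"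
    proof (intro sum.cong refl)
      fix \<sigma> assume "\<sigma> \<in> ?P (k + l)"
      then have "sign (\<sigma> \<circ> \<rho>) = sign \<sigma> * (sign \<tau> * sign \<tau>')"
        using \<rho> sign\<rho> by (simp add: sign_compose permutation_of_permutes)
      moreover have "(\<Prod>i<k + l. ?\<chi> i (v ((\<sigma> \<circ> \<rho>) i))) =
          (\<Prod>i<k. \<phi> i (v (\<sigma> (\<tau> i)))) * (\<Prod>i<l. \<psi> i (v (\<sigma> (k + \<tau>' i))))"
      proof -
        define X where "X i = ?\<chi> i (v ((\<sigma> \<circ> \<rho>) i))" for i
        have "(\<Prod>i<k + l. X i) = (\<Prod>i<k. X i) * (\<Prod>i\<in>{k..<k + l}. X i)"
          using prod.atLeastLessThan_concat[of 0 k "k + l" X] by (simp add: lessThan_atLeast0)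
        also have "(\<Prod>i\<in>{k..<k + l}. X i) = (\<Prod>i<l. X (k + i))"
          using prod.shift_bounds_nat_ivl[of X 0 k l] by (simp add: lessThan_atLeast0 add.commute)
        finally show ?thesis by (simp add: X_def lo hi)
      qed
      ultimately show "summand \<sigma> \<tau> \<tau>' = of_int (sign (\<sigma> \<circ> \<rho>)) * (\<Prod>i<k + l. ?\<chi> i (v ((\<sigma> \<circ> \<rho>) i)))"
        by (simp add: summand_def mult_ac)
    qed
    also have "\<dots> = decomposable (k + l) ?\<chi> v"
      unfolding decomposable_def by (rule sum_permutations_compose_right[OF \<rho>, symmetric])
    finally show ?thesis .
  qed
  have "(\<Sum>\<sigma>\<in>?P (k + l). of_int (sign \<sigma>) * decomposable k \<phi> (\<lambda>i. v (\<sigma> i)) *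
      decomposable l \<psi> (\<lambda>i. v (\<sigma> (k + i)))) =
    (\<Sum>\<sigma>\<in>?P (k + l). \<Sum>\<tau>\<in>?P k. \<Sum>\<tau>'\<in>?P l. summand \<sigma> \<tau> \<tau>')"
    unfolding decomposable_def summand_def by (simp add: sum_product sum_distrib_left mult_ac)
  also have "\<dots> = (\<Sum>\<tau>\<in>?P k. \<Sum>\<tau>'\<in>?P l. \<Sum>\<sigma>\<in>?P (k + l). summand \<sigma> \<tau> \<tau>')"
    by (subst sum.swap, rule sum.cong[OF refl], rule sum.swap)
  also have "\<dots> = (\<Sum>\<tau>\<in>?P k. \<Sum>\<tau>'\<in>?P l. decomposable (k + l) ?\<chi> v)"
    by (intro sum.cong refl block)
  also have "\<dots> = fact k * fact l * decomposable (k + l) ?\<chi> v"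
    by (simp add: card_permutations[of "{..<k}"] card_permutations[of "{..<l}"])
  finally show ?thesis unfolding wedge_def by simp
qed

lemma wedge_sum:
  "wedge k l (\<lambda>v. c * (\<Sum>j\<in>S. \<alpha> j v)) (\<lambda>v. d * (\<Sum>x\<in>X. \<beta> x v)) v =
    c * d * (\<Sum>j\<in>S. \<Sum>x\<in>X. wedge k l (\<alpha> j) (\<beta> x) v)"
proof -
  have "wedge k l (\<lambda>v. c * (\<Sum>j\<in>S. \<alpha> j v)) (\<lambda>v. d * (\<Sum>x\<in>X. \<beta> x v)) v =
    (\<Sum>\<sigma> | \<sigma> permutes {..<k + l}. \<Sum>j\<in>S. \<Sum>x\<in>X. c * d * (of_int (sign \<sigma>) * \<alpha> j (\<lambda>i. v (\<sigma> i)) *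
      \<beta> x (\<lambda>i. v (\<sigma> (k + i))))) / (fact k * fact l)"
    unfolding wedge_def by (simp add: sum_product sum_distrib_left mult_ac)
  also have "\<dots> = (\<Sum>j\<in>S. \<Sum>x\<in>X. \<Sum>\<sigma> | \<sigma> permutes {..<k + l}. c * d * (of_int (sign \<sigma>) * \<alpha> j (\<lambda>i. v (\<sigma> i)) *
      \<beta> x (\<lambda>i. v (\<sigma> (k + i))))) / (fact k * fact l)"
    by (rule arg_cong2[where f = "(/)"], subst sum.swap, rule sum.cong[OF refl], rule sum.swap, rule refl)
  also have "\<dots> = c * d * (\<Sum>j\<in>S. \<Sum>x\<in>X. wedge k l (\<alpha> j) (\<beta> x) v)"
    unfolding wedge_def by (simp add: sum_distrib_left sum_divide_distrib)
  finally show ?thesis .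
qed

lemma wedge_scale: "wedge k l (\<lambda>v. c * \<alpha> v) (\<lambda>v. d * \<beta> v) v = c * d * wedge k l \<alpha> \<beta> v"
  using wedge_sum[of k l c "\<lambda>_. \<alpha>" "{()}" d "\<lambda>_. \<beta>" "{()}" v] by simp

lemma decomposable_two: "decomposable 2 \<phi> v = \<phi> 0 (v 0) * \<phi> 1 (v 1) - \<phi> 0 (v 1) * \<phi> 1 (v 0)"
proof -
  have ne: "id \<noteq> Transposition.transpose 0 (1::nat)"
    by (metis id_apply transpose_apply_first zero_neq_one)
  have "{id, Transposition.transpose 0 1} = {\<sigma>. \<sigma> permutes {..<2::nat}}"
  proof (rule card_subset_eq)
    show "{id, Transposition.transpose 0 1} \<subseteq> {\<sigma>. \<sigma> permutes {..<2::nat}}"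
      by (auto intro: permutes_id permutes_swap_id)
    show "card {id, Transposition.transpose 0 (1::nat)} = card {\<sigma>. \<sigma> permutes {..<2::nat}}"
      using ne by (subst card_permutations[OF refl finite_lessThan]) simp
  qed (simp add: finite_permutations)
  then have P: "{\<sigma>. \<sigma> permutes {..<2::nat}} = {id, Transposition.transpose 0 1}" ..
  show ?thesis using ne
    unfolding decomposable_def P by (simp add: sign_swap_id lessThan_Suc numeral_2_eq_2 mult_ac)
qed

lemma wedge_power_of_real:
  "wedge_power n (\<lambda>v. complex_of_real (\<omega> v)) v = complex_of_real (wedge_power n \<omega> v)"
proof (induction n arbitrary: v)
  case (Suc n)
  have "wedge_power n (\<lambda>v. complex_of_real (\<omega> v)) = (\<lambda>v. complex_of_real (wedge_power n \<omega> v))"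
    by (rule ext, rule Suc.IH)
  then show ?case by (simp add: wedge_def)
qed simp

section \<open>The calibration inequality at a point\<close>

text \<open>The data of the soliton at one point: a hermitian scalar product \<open>G\<close> on \<open>\<complex>\<^sup>m\<close>, an
  \<open>(m, 0)\<close>-form \<open>T\<close>, and the number \<open>s = e\<^sup>-\<^sup>f\<close> that compares their volume forms.\<close>

locale hermitian_volume =
  fixes G :: "complex^'m::{finite,linorder} \<Rightarrow> complex^'m::{finite,linorder} \<Rightarrow> real"
    and T :: "(nat \<Rightarrow> complex^'m::{finite,linorder}) \<Rightarrow> complex" and s :: real
  assumes bilin: "bilinear G" and sym: "\<And>x y. G x y = G y x" and pos: "\<And>x. x \<noteq> 0 \<Longrightarrow> G x x > 0"
    and J_inv: "\<And>x y. G (cplx_J x) (cplx_J y) = G x y"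
    and type: "form_type_k0 CARD('m) T" and nonzero: "\<exists>v. T v \<noteq> 0" and s_pos: "s > 0"
    and volume: "\<And>v. complex_of_real (s * wedge_power CARD('m) (\<lambda>v. G (cplx_J (v 0)) (v 1)) v / fact CARD('m)) =
      (-1) ^ (CARD('m) * (CARD('m) - 1) div 2) * (\<i> / 2) ^ CARD('m) *
      wedge CARD('m) CARD('m) T (\<lambda>w. cnj (T w)) v"
begin

definition \<omega> :: "complex^'m::{finite,linorder} \<Rightarrow> complex^'m::{finite,linorder} \<Rightarrow> real" where
  "\<omega> v w = G (cplx_J v) w"

definition h :: "complex^'m::{finite,linorder} \<Rightarrow> complex^'m::{finite,linorder} \<Rightarrow> complex" where
  "h v w = Complex (G v w) (- \<omega> v w)"

lemma G_simps:
  "G (x + y) z = G x z + G y z" "G z (x + y) = G z x + G z y"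
  "G (r *\<^sub>R x) z = r * G x z" "G z (r *\<^sub>R x) = r * G z x"
  "G (- x) z = - G x z" "G z (- x) = - G z x" "G 0 z = 0" "G z 0 = 0"
  "G (x - y) z = G x z - G y z"
  using bilin by (simp_all add: bilinear_ladd bilinear_radd bilinear_lmul bilinear_rmul
      bilinear_lneg bilinear_rneg bilinear_lzero bilinear_rzero bilinear_lsub)

lemma J_simps: "cplx_J (x + y) = cplx_J x + cplx_J y" "cplx_J (r *\<^sub>R x) = r *\<^sub>R cplx_J x"
  "cplx_J (- x) = - cplx_J x" "cplx_J (cplx_J x) = - x" "cplx_J 0 = 0" for x y :: "complex^'m::{finite,linorder}"
  by (simp_all add: cplx_J_def vec_eq_iff algebra_simps)

lemma G_J_left: "G (cplx_J x) y = - G x (cplx_J y)"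
  using J_inv[of "cplx_J x" y] by (simp add: J_simps G_simps)

lemma \<omega>_antisym: "\<omega> x y = - \<omega> y x"
  using G_J_left[of x y] sym[of x "cplx_J y"] by (simp add: \<omega>_def)

lemma \<omega>_self [simp]: "\<omega> x x = 0"
  using \<omega>_antisym[of x x] by simp

lemma h_add: "h (x + y) z = h x z + h y z"
  by (simp add: h_def \<omega>_def J_simps G_simps complex_eq_iff)

lemma scale_J: "a *s (x::complex^'m::{finite,linorder}) = Re a *\<^sub>R x + Im a *\<^sub>R cplx_J x"
  by (auto simp: vec_eq_iff cplx_J_def complex_eq_iff)

lemma h_scale: "h (a *s x) z = a * h x z"
  unfolding scale_J by (simp add: h_def \<omega>_def J_simps G_simps complex_eq_iff algebra_simps)

lemma h_cnj: "h y x = cnj (h x y)"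
  using \<omega>_antisym[of x y] by (simp add: h_def complex_eq_iff sym)

lemma h_self: "h x x = of_real (G x x)"
  by (simp add: h_def complex_eq_iff)

lemma G_nonneg: "G x x \<ge> 0"
  using pos[of x] by (cases "x = 0") (auto simp: G_simps)

lemma h_0 [simp]: "h 0 z = 0" "h z 0 = 0"
  by (simp_all add: h_def \<omega>_def J_simps G_simps complex_eq_iff)

lemma h_linear: "h (x + a *s y) z = h x z + a * h y z"
  by (simp add: h_add h_scale)

lemma h_diff: "h (x - y) z = h x z - h y z"
  using h_linear[of x "-1" y z] by (simp add: vector_sneg_minus1[symmetric])

lemma h_sum: "h (\<Sum>j\<in>S. c j *s x j) z = (\<Sum>j\<in>S. c j * h (x j) z)"
  by (induction S rule: infinite_finite_induct) (auto simp: h_add h_scale)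

lemma h_scale_right: "h z (a *s x) = cnj a * h z x"
  using h_scale[of a x z] h_cnj by (metis complex_cnj_mult)

lemma h_diff_right: "h z (x - y) = h z x - h z y"
  using h_diff[of x y z] h_cnj by (metis complex_cnj_diff)

lemma h_add_right: "h z (x + y) = h z x + h z y"
  using h_add[of x y z] h_cnj by (metis complex_cnj_add)

lemma \<omega>_eq_h: "complex_of_real (\<omega> x y) = \<i> / 2 * (h x y - cnj (h x y))"
  by (simp add: h_def complex_eq_iff)

definition \<kappa> :: complex where "\<kappa> = T axis_seq"

lemma T_eq: "T v = \<kappa> * det (frame_matrix v)"
  unfolding \<kappa>_def by (rule form_type_k0_top[OF type])

lemma \<kappa>_nonzero: "\<kappa> \<noteq> 0"
  using nonzero T_eq by auto

subsection \<open>Unitary frames\<close>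

context
  fixes U :: "complex^'m::{finite,linorder}^'m::{finite,linorder}"
  assumes unitary: "\<And>i j. h (U $ i) (U $ j) = (if i = j then 1 else 0)"
    and det_U: "det U \<noteq> 0"
begin

definition \<theta> :: "'m \<Rightarrow> complex^'m::{finite,linorder} \<Rightarrow> complex" where "\<theta> i v = h v (U $ i)"

definition \<theta>' :: "'m \<Rightarrow> complex^'m::{finite,linorder} \<Rightarrow> complex" where "\<theta>' i v = cnj (\<theta> i v)"

lemma \<theta>_linear: "\<theta> i (x + a *s y) = \<theta> i x + a * \<theta> i y"
  by (simp add: \<theta>_def h_linear)

lemma unitary_expand: "v = (\<Sum>i\<in>UNIV. \<theta> i v *s U $ i)"
proof -
  have "det U *s v = (\<Sum>i\<in>UNIV. det (\<chi> a. if a = i then v else U $ a) *s U $ i)"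
    by (rule cramer_rows[symmetric])
  then have v: "v = (\<Sum>i\<in>UNIV. (det (\<chi> a. if a = i then v else U $ a) / det U) *s U $ i)"
    using det_U by (simp add: vec_eq_iff sum_divide_distrib[symmetric] eq_divide_eq mult.commute)
  define c where "c i = det (\<chi> a. if a = i then v else U $ a) / det U" for i
  have "\<theta> j v = c j" for j
  proof -
    have "\<theta> j v = (\<Sum>i\<in>UNIV. c i * h (U $ i) (U $ j))"
      unfolding \<theta>_def by (subst v) (simp add: c_def h_sum)
    also have "\<dots> = c j" by (simp add: unitary if_distrib cong: if_cong)
    finally show ?thesis .
  qed
  then show ?thesis using v by (simp add: c_def)
qed

lemma h_unitary_expand: "h x y = (\<Sum>i\<in>UNIV. \<theta> i x * cnj (\<theta> i y))"
proof -
  have "h x y = h (\<Sum>i\<in>UNIV. \<theta> i x *s U $ i) y" using unitary_expand[of x] by simp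
  also have "\<dots> = (\<Sum>i\<in>UNIV. \<theta> i x * h (U $ i) y)" by (rule h_sum)
  also have "\<dots> = (\<Sum>i\<in>UNIV. \<theta> i x * cnj (\<theta> i y))" by (simp add: \<theta>_def h_cnj[of "U $ _" y])
  finally show ?thesis .
qed

text \<open>The coframe of \<open>\<omega>\<^sup>n\<close> that belongs to a list of indices: the one-forms \<open>\<theta>\<^sub>i\<close> and their
  conjugates alternate.\<close>

definition interleaved :: "'m list \<Rightarrow> nat \<Rightarrow> complex^'m::{finite,linorder} \<Rightarrow> complex" where
  "interleaved xs k = (if even k then \<theta> (xs ! (k div 2)) else \<theta>' (xs ! (k div 2)))"

lemma lists_Suc: "{xs :: 'm list. length xs = Suc n} = (\<lambda>(j, xs). j # xs) ` (UNIV \<times> {xs. length xs = n})"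
  by (auto simp: length_Suc_conv image_iff)

lemma \<omega>_eq_sum: "complex_of_real (\<omega> (v 0) (v 1)) =
    \<i> / 2 * (\<Sum>j\<in>UNIV. decomposable 2 (\<lambda>i. if i = 0 then \<theta> j else \<theta>' j) v)"
  by (simp add: \<omega>_eq_h h_unitary_expand decomposable_two \<theta>'_def sum_subtractf cnj_sum mult.commute)

text \<open>Multiplying out the power of \<open>\<omega> = i/2 \<Sum>\<^sub>j \<theta>\<^sub>j \<and> cnj \<theta>\<^sub>j\<close> gives one term for every list of indices.\<close>

lemma wedge_power_\<omega>:
  "wedge_power n (\<lambda>v. complex_of_real (\<omega> (v 0) (v 1))) =
    (\<lambda>v. (\<i> / 2) ^ n * (\<Sum>xs | length xs = n. decomposable (2 * n) (interleaved xs) v))"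
proof (induction n)
  case 0
  have "{xs :: 'm list. length xs = 0} = {[]}" by auto
  then show ?case by (simp add: decomposable_def)
next
  case (Suc n)
  show ?case
  proof
    fix v :: "nat \<Rightarrow> complex^'m::{finite,linorder}"
    have "wedge_power (Suc n) (\<lambda>v. complex_of_real (\<omega> (v 0) (v 1))) v =
      wedge 2 (2 * n) (\<lambda>v. \<i> / 2 * (\<Sum>j\<in>UNIV. decomposable 2 (\<lambda>i. if i = 0 then \<theta> j else \<theta>' j) v))
        (\<lambda>v. (\<i> / 2) ^ n * (\<Sum>xs | length xs = n. decomposable (2 * n) (interleaved xs) v)) v"
      by (simp only: wedge_power.simps(2) Suc.IH) (simp only: \<omega>_eq_sum)
    also have "\<dots> = (\<i> / 2) ^ Suc n * (\<Sum>j\<in>UNIV. \<Sum>xs | length xs = n.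
        wedge 2 (2 * n) (decomposable 2 (\<lambda>i. if i = 0 then \<theta> j else \<theta>' j))
          (decomposable (2 * n) (interleaved xs)) v)"
      by (simp only: wedge_sum power_Suc)
    also have "(\<Sum>j\<in>UNIV. \<Sum>xs | length xs = n.
        wedge 2 (2 * n) (decomposable 2 (\<lambda>i. if i = 0 then \<theta> j else \<theta>' j))
          (decomposable (2 * n) (interleaved xs)) v) =
      (\<Sum>j\<in>UNIV. \<Sum>xs | length xs = n. decomposable (2 * Suc n) (interleaved (j # xs)) v)"
    proof (intro sum.cong refl)
      fix j and xs :: "'m list"
      have "(if i < 2 then if i = 0 then \<theta> j else \<theta>' j else interleaved xs (i - 2)) = interleaved (j # xs) i" for i
      proof (cases "i < 2")
        case True
        then have "i = 0 \<or> i = 1" by auto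
        then show ?thesis by (auto simp: interleaved_def)
      next
        case False
        then obtain k where "i = k + 2" by (metis add.commute le_Suc_ex not_less)
        then show ?thesis by (simp add: interleaved_def)
      qed
      then show "wedge 2 (2 * n) (decomposable 2 (\<lambda>i. if i = 0 then \<theta> j else \<theta>' j))
          (decomposable (2 * n) (interleaved xs)) v = decomposable (2 * Suc n) (interleaved (j # xs)) v"
        by (simp add: wedge_decomposable)
    qed
    also have "\<dots> = (\<Sum>xs | length xs = Suc n. decomposable (2 * Suc n) (interleaved xs) v)"
      unfolding lists_Suc sum.cartesian_product
      by (subst sum.reindex) (auto simp: inj_on_def intro!: sum.cong)
    finally show "wedge_power (Suc n) (\<lambda>v. complex_of_real (\<omega> (v 0) (v 1))) v =
      (\<i> / 2) ^ Suc n * (\<Sum>xs | length xs = Suc n. decomposable (2 * Suc n) (interleaved xs) v)" .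
  qed
qed

text \<open>Sorting the interleaved coframe into the \<open>\<theta>\<close>'s followed by their conjugates is one and the
  same permutation for all lists.\<close>

definition unshuffle :: "nat \<Rightarrow> nat" where
  "unshuffle k = (if k < 2 * CARD('m) then if even k then k div 2 else CARD('m) + k div 2 else k)"

definition blocks :: "'m list \<Rightarrow> nat \<Rightarrow> complex^'m::{finite,linorder} \<Rightarrow> complex" where
  "blocks xs k = (if k < CARD('m) then \<theta> (xs ! k) else \<theta>' (xs ! (k - CARD('m))))"

lemma unshuffle_permutes: "unshuffle permutes {..<2 * CARD('m)}"
proof (rule bij_imp_permutes)
  have "inj_on unshuffle {..<2 * CARD('m)}"
  proof (rule inj_onI)
    fix a b assume "a \<in> {..<2 * CARD('m)}" "b \<in> {..<2 * CARD('m)}" "unshuffle a = unshuffle b"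
    then show "a = b"
      by (cases "even a"; cases "even b") (auto simp: unshuffle_def elim!: evenE oddE)
  qed
  moreover from this have "unshuffle ` {..<2 * CARD('m)} = {..<2 * CARD('m)}"
    by (intro endo_inj_surj) (auto simp: unshuffle_def)
  ultimately show "bij_betw unshuffle {..<2 * CARD('m)} {..<2 * CARD('m)}" by (simp add: bij_betw_def)
qed (simp add: unshuffle_def)

lemma decomposable_interleaved:
  "decomposable (2 * CARD('m)) (interleaved xs) v =
    of_int (sign unshuffle) * decomposable (2 * CARD('m)) (blocks xs) v"
proof -
  have "decomposable (2 * CARD('m)) (interleaved xs) v =
      decomposable (2 * CARD('m)) (\<lambda>k. blocks xs (unshuffle k)) v"
    by (rule decomposable_cong) (auto simp: interleaved_def blocks_def unshuffle_def)
  then show ?thesis using decomposable_permute[OF unshuffle_permutes] by simp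
qed

text \<open>Forms of top holomorphic degree are proportional, and on the frame \<open>U\<close> the wedge product of the dual
  coframe is \<open>1\<close>.\<close>

lemma T_eq_decomposable:
  assumes "distinct xs" "length xs = CARD('m)"
  shows "T v = T (\<lambda>i. U $ (xs ! i)) * decomposable CARD('m) (\<lambda>i. \<theta> (xs ! i)) v"
proof -
  let ?D = "decomposable CARD('m) (\<lambda>i. \<theta> (xs ! i))"
  have k0: "form_type_k0 CARD('m) ?D"
    by (rule form_type_k0_decomposable) (simp add: \<theta>_linear)
  have "?D (\<lambda>i. U $ (xs ! i)) = 1"
  proof -
    have "?D (\<lambda>i. U $ (xs ! i)) = (\<Sum>\<sigma> | \<sigma> permutes {..<CARD('m)}. if \<sigma> = id then 1 else 0)"
      unfolding decomposable_def
    proof (intro sum.cong refl)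
      fix \<sigma> assume "\<sigma> \<in> {\<sigma>. \<sigma> permutes {..<CARD('m)}}"
      then have \<sigma>: "\<sigma> permutes {..<CARD('m)}" by simp
      show "of_int (sign \<sigma>) * (\<Prod>i<CARD('m). \<theta> (xs ! i) (U $ (xs ! \<sigma> i))) = (if \<sigma> = id then 1 else 0)"
      proof (cases "\<sigma> = id")
        case False
        then obtain i where i: "\<sigma> i \<noteq> i" by (auto simp: fun_eq_iff)
        then have "i < CARD('m)" using permutes_not_in[OF \<sigma>] by auto
        moreover have "\<sigma> i < CARD('m)" using permutes_in_image[OF \<sigma>] calculation by auto
        ultimately have "\<theta> (xs ! i) (U $ (xs ! \<sigma> i)) = 0"
          using assms i by (simp add: \<theta>_def unitary nth_eq_iff_index_eq)
        then have "(\<Prod>i<CARD('m). \<theta> (xs ! i) (U $ (xs ! \<sigma> i))) = 0"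
          using \<open>i < CARD('m)\<close> by (intro prod_zero) auto
        then show ?thesis using False by simp
      qed (simp add: \<theta>_def unitary)
    qed
    also have "\<dots> = 1" by (simp add: permutes_id finite_permutations)
    finally show ?thesis .
  qed
  then have d: "?D axis_seq * det (frame_matrix (\<lambda>i. U $ (xs ! i))) = 1"
    using form_type_k0_top[OF k0] by metis
  have "T (\<lambda>i. U $ (xs ! i)) * ?D v = \<kappa> * (?D axis_seq * det (frame_matrix (\<lambda>i. U $ (xs ! i)))) * det (frame_matrix v)"
    using form_type_k0_top[OF k0, of v] T_eq by (simp add: mult_ac)
  then show ?thesis using T_eq[of v] by (simp only: d mult_1_right)
qed

lemma norm_T_unitary:
  assumes "distinct xs" "length xs = CARD('m)"
  shows "cmod (T (\<lambda>i. U $ (xs ! i))) = cmod (\<kappa> * det U)"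
proof -
  define p where "p j = xs ! index_rank j" for j :: 'm
  have "inj p" using assms inj_index_rank
    by (auto simp: inj_def p_def nth_eq_iff_index_eq index_rank_less)
  then have p: "p permutes UNIV" by (intro bij_imp_permutes) (auto simp: bij_def finite_UNIV_inj_surj)
  have "frame_matrix (\<lambda>i. U $ (xs ! i)) = (\<chi> j. U $ p j)" by (simp add: vec_eq_iff p_def)
  then have "det (frame_matrix (\<lambda>i. U $ (xs ! i))) = of_int (sign p) * det U"
    using det_permute_rows[OF p, of U] by simp
  then show ?thesis by (simp add: T_eq norm_mult sign_def)
qed

lemma wedge_T_cnj_T:
  assumes "distinct xs" "length xs = CARD('m)"
  shows "wedge CARD('m) CARD('m) T (\<lambda>w. cnj (T w)) v =
    of_real ((cmod (\<kappa> * det U))\<^sup>2) * decomposable (2 * CARD('m)) (blocks xs) v"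
proof -
  let ?t = "T (\<lambda>i. U $ (xs ! i))"
  have T: "T = (\<lambda>v. ?t * decomposable CARD('m) (\<lambda>i. \<theta> (xs ! i)) v)"
    using T_eq_decomposable[OF assms] by (rule ext)
  have cT: "(\<lambda>w. cnj (T w)) = (\<lambda>v. cnj ?t * decomposable CARD('m) (\<lambda>i. \<theta>' (xs ! i)) v)"
    by (rule ext, subst T_eq_decomposable[OF assms]) (simp add: decomposable_def cnj_sum cnj_prod \<theta>'_def)
  have "wedge CARD('m) CARD('m) T (\<lambda>w. cnj (T w)) v =
     ?t * cnj ?t * wedge CARD('m) CARD('m) (decomposable CARD('m) (\<lambda>i. \<theta> (xs ! i)))
       (decomposable CARD('m) (\<lambda>i. \<theta>' (xs ! i))) v"
    unfolding cT by (subst (1) T) (rule wedge_scale)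
  also have "\<dots> = of_real ((cmod ?t)\<^sup>2) * decomposable (CARD('m) + CARD('m))
      (\<lambda>i. if i < CARD('m) then \<theta> (xs ! i) else \<theta>' (xs ! (i - CARD('m)))) v"
    by (simp only: wedge_decomposable complex_norm_square)
  also have "(\<lambda>i. if i < CARD('m) then \<theta> (xs ! i) else \<theta>' (xs ! (i - CARD('m)))) = blocks xs"
    by (auto simp: blocks_def fun_eq_iff)
  finally show ?thesis using norm_T_unitary[OF assms] by (simp add: mult_2)
qed

text \<open>Adding the first block of rows to the second turns \<open>cnj \<theta>\<^sub>i\<close> into \<open>2 Re \<theta>\<^sub>i\<close>, which vanishes on
  the vectors \<open>i U\<^sub>k\<close>. On the frame \<open>i U\<^sub>0, \<dots>, U\<^sub>0, \<dots>\<close> the determinant is then upper triangular.\<close>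

lemma decomposable_blocks_nonzero:
  assumes "distinct xs" "length xs = CARD('m)"
  shows "\<exists>v. decomposable (2 * CARD('m)) (blocks xs) v \<noteq> 0"
proof -
  let ?m = "CARD('m)"
  \<comment> \<open>the coframe after the first \<open>j\<close> of these row operations\<close>
  define row where "row j k = (if k < ?m then \<theta> (xs ! k) else if k < ?m + j
     then (\<lambda>v. \<theta>' (xs ! (k - ?m)) v + \<theta> (xs ! (k - ?m)) v) else \<theta>' (xs ! (k - ?m)))" for j k
  define v where "v k = (if k < ?m then \<i> *s U $ (xs ! k) else U $ (xs ! (k - ?m)))" for k
  have step: "decomposable (2 * ?m) (row j) v = decomposable (2 * ?m) (blocks xs) v" if "j \<le> ?m" for j
    using that
  proof (induction j)
    case 0
    have "row 0 = blocks xs" by (auto simp: row_def blocks_def fun_eq_iff)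
    then show ?case by simp
  next
    case (Suc j)
    have "row (Suc j) = (row j)(?m + j := \<lambda>v. row j (?m + j) v + row j j v)"
      using Suc.prems by (auto simp: row_def fun_eq_iff)
    moreover have "decomposable (2 * ?m) ((row j)(?m + j := \<lambda>v. row j (?m + j) v + row j j v)) v =
        decomposable (2 * ?m) (row j) v"
      using Suc.prems by (intro decomposable_add_row) auto
    ultimately show ?case using Suc by (simp del: fun_upd_apply)
  qed
  have \<theta>v: "\<theta> (xs ! k) (U $ (xs ! l)) = (if k = l then 1 else 0)"
    "\<theta> (xs ! k) (\<i> *s U $ (xs ! l)) = (if k = l then \<i> else 0)" if "k < ?m" "l < ?m" for k l
    using assms that by (auto simp: \<theta>_def h_scale unitary nth_eq_iff_index_eq)
  have lower: "row ?m i (v k) = 0" if "k < i" "i < 2 * ?m" for i k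
    using that \<theta>v[of i k] \<theta>v[of "i - ?m" k] \<theta>v[of "i - ?m" "k - ?m"]
    by (cases "i < ?m"; cases "k < ?m"; cases "k = i - ?m") (auto simp: row_def v_def \<theta>'_def)
  have diag: "row ?m i (v i) \<noteq> 0" if "i < 2 * ?m" for i
    using that \<theta>v[of i i] \<theta>v[of "i - ?m" "i - ?m"]
    by (cases "i < ?m") (auto simp: row_def v_def \<theta>'_def)
  have "decomposable (2 * ?m) (row ?m) v = (\<Sum>\<sigma> | \<sigma> permutes {..<2 * ?m}.
      if \<sigma> = id then \<Prod>i<2 * ?m. row ?m i (v i) else 0)"
    unfolding decomposable_def
  proof (intro sum.cong refl)
    fix \<sigma> assume "\<sigma> \<in> {\<sigma>. \<sigma> permutes {..<2 * ?m}}"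
    then have \<sigma>: "\<sigma> permutes {..<2 * ?m}" by simp
    show "of_int (sign \<sigma>) * (\<Prod>i<2 * ?m. row ?m i (v (\<sigma> i))) =
      (if \<sigma> = id then \<Prod>i<2 * ?m. row ?m i (v i) else 0)"
    proof (cases "\<sigma> = id")
      case False
      then obtain i where i: "i < 2 * ?m" "\<sigma> i < i"
        using permutes_natset_ge[OF \<sigma>] by (metis lessThan_iff not_le)
      then have "row ?m i (v (\<sigma> i)) = 0" by (intro lower)
      then have "(\<Prod>i<2 * ?m. row ?m i (v (\<sigma> i))) = 0" using i by (intro prod_zero) auto
      then show ?thesis using False by simp
    qed simp
  qed
  also have "\<dots> = (\<Prod>i<2 * ?m. row ?m i (v i))" by (simp add: permutes_id finite_permutations)
  also have "\<dots> \<noteq> 0" using diag by simp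
  finally show ?thesis using step[of ?m] by auto
qed

text \<open>A list with a repeated index contributes nothing to the power of \<open>\<omega>\<close>, and each of the \<open>m!\<close> other
  lists contributes the same multiple of \<open>T \<and> cnj T\<close>.\<close>

lemma wedge_power_\<omega>_top:
  "complex_of_real ((cmod (\<kappa> * det U))\<^sup>2 * wedge_power CARD('m) (\<lambda>v. \<omega> (v 0) (v 1)) v / fact CARD('m)) =
    (\<i> / 2) ^ CARD('m) * of_int (sign unshuffle) * wedge CARD('m) CARD('m) T (\<lambda>w. cnj (T w)) v"
proof -
  let ?m = "CARD('m)" and ?a = "complex_of_real ((cmod (\<kappa> * det U))\<^sup>2)"
  let ?L = "{xs :: 'm list. length xs = ?m}"
  have fin: "finite ?L" using finite_lists_length_eq[of "UNIV :: 'm set" ?m] by simp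
  have each: "?a * decomposable (2 * ?m) (interleaved xs) v =
     (if distinct xs then of_int (sign unshuffle) * wedge ?m ?m T (\<lambda>w. cnj (T w)) v else 0)"
    if L: "xs \<in> ?L" for xs
  proof (cases "distinct xs")
    case True
    have "?a * decomposable (2 * ?m) (interleaved xs) v =
        of_int (sign unshuffle) * (?a * decomposable (2 * ?m) (blocks xs) v)"
      by (simp only: decomposable_interleaved mult.left_commute)
    then show ?thesis using wedge_T_cnj_T[OF True, of v] L True by (simp del: of_real_power)
  next
    case False
    then obtain a b where ab: "a < ?m" "b < ?m" "a \<noteq> b" "xs ! a = xs ! b"
      using L distinct_conv_nth[of xs] by (metis mem_Collect_eq)
    then have "decomposable (2 * ?m) (interleaved xs) v = 0"
      by (intro decomposable_repeated[of "2 * a" _ "2 * b"]) (auto simp: interleaved_def)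
    then show ?thesis using False by simp
  qed
  have card: "card {xs \<in> ?L. distinct xs} = fact ?m"
    using card_lists_distinct_length_eq[of "UNIV :: 'm set" ?m]
    by (simp add: fact_prod conj_commute)
  have "?a * complex_of_real (wedge_power ?m (\<lambda>v. \<omega> (v 0) (v 1)) v) =
      ?a * wedge_power ?m (\<lambda>v. complex_of_real (\<omega> (v 0) (v 1))) v"
    by (simp only: wedge_power_of_real)
  also have "\<dots> = (\<i> / 2) ^ ?m * (\<Sum>xs\<in>?L. ?a * decomposable (2 * ?m) (interleaved xs) v)"
    by (simp only: wedge_power_\<omega> sum_distrib_left mult.left_commute)
  also have "(\<Sum>xs\<in>?L. ?a * decomposable (2 * ?m) (interleaved xs) v) =
      (\<Sum>xs\<in>?L. if distinct xs then of_int (sign unshuffle) * wedge ?m ?m T (\<lambda>w. cnj (T w)) v else 0)"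
    by (rule sum.cong[OF refl each])
  also have "\<dots> = fact ?m * (of_int (sign unshuffle) * wedge ?m ?m T (\<lambda>w. cnj (T w)) v)"
    using fin card by (simp add: sum.If_cases Int_def)
  finally show ?thesis by (simp add: field_simps)
qed

text \<open>Both sides of the volume identity being multiples of \<open>T \<and> cnj T\<close>, only absolute values need to
  be compared, and the signs of the permutations do not matter.\<close>

lemma unitary_volume: "(cmod (\<kappa> * det U))\<^sup>2 = s"
proof -
  let ?m = "CARD('m)" and ?a = "(cmod (\<kappa> * det U))\<^sup>2"
  obtain xs :: "'m list" where xs: "distinct xs" "set xs = UNIV"
    using finite_distinct_list[of "UNIV :: 'm set"] by auto
  then have len: "length xs = ?m" using distinct_card by fastforce
  obtain v where v: "decomposable (2 * ?m) (blocks xs) v \<noteq> 0"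
    using decomposable_blocks_nonzero[OF xs(1) len] by blast
  let ?w = "wedge ?m ?m T (\<lambda>w. cnj (T w)) v" and ?p = "wedge_power ?m (\<lambda>v. \<omega> (v 0) (v 1)) v / fact ?m"
  have a: "?a > 0" using \<kappa>_nonzero det_U by simp
  then have "?w \<noteq> 0"
    using v wedge_T_cnj_T[OF xs(1) len, of v] by simp
  have eq: "cmod (complex_of_real (?a * ?p)) = cmod (complex_of_real (s * ?p))"
  proof -
    have "cmod (complex_of_real (?a * ?p)) = cmod ((\<i> / 2) ^ ?m) * cmod ?w"
      using wedge_power_\<omega>_top[of v] by (simp add: norm_mult sign_def)
    moreover have "cmod (complex_of_real (s * ?p)) = cmod ((\<i> / 2) ^ ?m) * cmod ?w"
      using volume[of v] by (simp add: \<omega>_def norm_mult norm_power)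
    ultimately show ?thesis by simp
  qed
  have ne: "cmod (complex_of_real (?a * ?p)) \<noteq> 0"
  proof -
    have "cmod (complex_of_real (?a * ?p)) = cmod ((\<i> / 2) ^ ?m) * cmod ?w"
      using wedge_power_\<omega>_top[of v] by (simp add: norm_mult sign_def)
    then show ?thesis using \<open>?w \<noteq> 0\<close> by simp
  qed
  have "?a * \<bar>?p\<bar> = s * \<bar>?p\<bar>"
    using eq a s_pos by (simp only: norm_of_real abs_mult abs_of_pos)
  moreover have "\<bar>?p\<bar> \<noteq> 0"
  proof
    assume "\<bar>?p\<bar> = 0"
    then have "?a * ?p = 0" by (simp only: abs_eq_0 mult_zero_right)
    then show False using ne by (simp only: norm_of_real abs_zero not_True_eq_False)
  qed
  ultimately show ?thesis by (rule mult_right_cancel[THEN iffD1, rotated])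
qed

end

subsection \<open>The inequality and its equality case\<close>

text \<open>A version of Hadamard's inequality: orthogonalisation preserves the determinant and does not
  increase the lengths.\<close>

lemma hadamard: "(cmod (\<kappa> * det Z))\<^sup>2 \<le> s * (\<Prod>i\<in>UNIV. G (Z $ i) (Z $ i))"
proof (cases "det Z = 0")
  case True
  then show ?thesis using s_pos by (simp add: prod_nonneg G_nonneg)
next
  case False
  obtain W where W: "det W = det Z" "\<And>i j. i \<noteq> j \<Longrightarrow> h (W $ i) (W $ j) = 0"
    "\<And>i. h (Z $ i - W $ i) (W $ i) = 0"
  proof (rule gram_schmidt_rows[of h Z])
    show "h x y = 0 \<Longrightarrow> h y x = 0" for x y using h_cnj[of y x] by simp
    show "x \<noteq> 0 \<Longrightarrow> h x x \<noteq> 0" for x using pos[of x] by (simp add: h_self)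
  qed (auto simp: h_add h_scale)
  have Wnz: "W $ i \<noteq> 0" for i
    using False W(1) det_zero_row(2)[of i W] by (auto simp: row_def)
  define r where "r i = sqrt (G (W $ i) (W $ i))" for i
  have r: "r i > 0" "(r i)\<^sup>2 = G (W $ i) (W $ i)" for i
    using pos[OF Wnz[of i]] by (auto simp: r_def)
  define U where "U = (\<chi> i. complex_of_real (1 / r i) *s W $ i)"
  have U: "h (U $ i) (U $ j) = (if i = j then 1 else 0)" for i j
  proof (cases "i = j")
    case True
    then show ?thesis using r[of j]
      by (simp add: U_def h_scale h_scale_right) (simp add: h_self r(2)[symmetric] power2_eq_square)
  qed (simp add: U_def h_scale h_scale_right W(2))
  have detW: "det W = (\<Prod>i\<in>UNIV. complex_of_real (r i)) * det U"
  proof -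
    have "W = (\<chi> i. complex_of_real (r i) *s U $ i)"
      using r(1) by (auto simp: vec_eq_iff U_def less_imp_neq[THEN not_sym])
    then show ?thesis using det_rows_mul[of "\<lambda>i. complex_of_real (r i)" "\<lambda>i. U $ i"] by simp
  qed
  then have "det U \<noteq> 0" using False W(1) by auto
  from unitary_volume[OF U this] have "(cmod (\<kappa> * det U))\<^sup>2 = s" .
  then have "(cmod (\<kappa> * det Z))\<^sup>2 = s * (\<Prod>i\<in>UNIV. r i)\<^sup>2"
    unfolding W(1)[symmetric] detW
    using r(1) by (simp add: norm_mult power_mult_distrib mult_ac prod_norm[symmetric] less_imp_le)
  also have "\<dots> = s * (\<Prod>i\<in>UNIV. G (W $ i) (W $ i))"
    by (simp only: prod_power_distrib r(2))
  also have "\<dots> \<le> s * (\<Prod>i\<in>UNIV. G (Z $ i) (Z $ i))"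
  proof (intro mult_left_mono prod_mono conjI)
    fix i
    define p where "p = Z $ i - W $ i"
    have Z: "Z $ i = p + W $ i" by (simp add: p_def)
    have "h p (W $ i) = 0" "h (W $ i) p = 0"
      using W(3)[of i] h_cnj[of "W $ i" p] by (auto simp: p_def)
    then have "h (Z $ i) (Z $ i) = h p p + h (W $ i) (W $ i)"
      unfolding Z by (simp add: h_add h_add_right)
    then have "complex_of_real (G (Z $ i) (Z $ i)) = of_real (G p p + G (W $ i) (W $ i))"
      by (simp add: h_self)
    then show "G (W $ i) (W $ i) \<le> G (Z $ i) (Z $ i)"
      using G_nonneg[of p] by (simp only: of_real_eq_iff)
  qed (use s_pos G_nonneg in auto)
  finally show ?thesis .
qed

text \<open>If \<open>\<omega>\<close> does not vanish on two vectors of a real orthonormal frame, then removing the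
  hermitian projection of one to the other shortens it and preserves the determinant; this improves
  the inequality strictly.\<close>

lemma calibrated_imp_lagrangian:
  assumes orth: "\<And>i j. G (Z $ i) (Z $ j) = (if i = j then 1 else 0)"
    and eq: "(cmod (\<kappa> * det Z))\<^sup>2 \<ge> s"
  shows "\<omega> (Z $ i) (Z $ j) = 0"
proof (cases "i = j")
  case False
  define c where "c = h (Z $ j) (Z $ i)"
  define W where "W = (\<chi> k. if k = j then row j Z + (- c) *s row i Z else row k Z)"
  have "det W = det Z" unfolding W_def using False by (intro det_row_operation) auto
  have Wj: "W $ j = Z $ j - c *s Z $ i"
    by (simp add: W_def row_def vec_eq_iff)
  have "h (W $ j) (W $ j) = of_real (1 - (cmod c)\<^sup>2)"
  proof -
    have "h (W $ j) (W $ j) = h (Z $ j) (Z $ j) - cnj c * h (Z $ j) (Z $ i)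
        - c * (h (Z $ i) (Z $ j) - cnj c * h (Z $ i) (Z $ i))"
      unfolding Wj by (simp add: h_diff h_diff_right h_scale h_scale_right algebra_simps)
    also have "\<dots> = 1 - cnj c * c - c * (cnj c - cnj c * 1)"
      using h_cnj[of "Z $ i" "Z $ j"] orth[of i i] orth[of j j] by (simp add: c_def h_self)
    also have "\<dots> = of_real (1 - (cmod c)\<^sup>2)"
      by (simp only: of_real_diff of_real_1 complex_norm_square) (simp add: mult.commute)
    finally show ?thesis .
  qed
  then have Gj: "G (W $ j) (W $ j) = 1 - (cmod c)\<^sup>2" by (simp only: h_self of_real_eq_iff)
  have Go: "G (W $ k) (W $ k) = 1" if "k \<noteq> j" for k using that orth[of k k] by (simp add: W_def row_def)
  have "(\<Prod>k\<in>UNIV. G (W $ k) (W $ k)) = 1 - (cmod c)\<^sup>2"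
    using prod.remove[of "UNIV :: 'm set" j "\<lambda>k. G (W $ k) (W $ k)"] Gj Go by simp
  then have "s \<le> s * (1 - (cmod c)\<^sup>2)"
    using hadamard[of W] eq \<open>det W = det Z\<close> by simp
  then have "c = 0" using s_pos by (simp add: algebra_simps mult_le_0_iff)
  then show ?thesis using \<omega>_antisym[of "Z $ i" "Z $ j"] by (simp add: c_def h_def complex_eq_iff)
qed simp

end

section \<open>Hodge star and volume form of a metric at a point\<close>

text \<open>The permutations of a set are the identity outside of it, whereas the maps of an extensional function space are undefined
  there; restriction translates between them.\<close>

lemma card_inj_PiE:
  fixes S :: "'b set"
  assumes "finite S"
  shows "card {I \<in> S \<rightarrow>\<^sub>E S. inj_on I S} = fact (card S)"
proof -
  have "bij_betw (\<lambda>p. restrict p S) {p. p permutes S} {I \<in> S \<rightarrow>\<^sub>E S. inj_on I S}"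
  proof (rule bij_betw_byWitness[where f' = "\<lambda>I i. if i \<in> S then I i else i"])
    show "\<forall>p\<in>{p. p permutes S}. (\<lambda>i. if i \<in> S then restrict p S i else i) = p"
    proof (intro ballI ext)
      fix p i assume "p \<in> {p. p permutes S}"
      then show "(if i \<in> S then restrict p S i else i) = p i" using permutes_not_in[of p S i] by simp
    qed
    show "\<forall>I\<in>{I \<in> S \<rightarrow>\<^sub>E S. inj_on I S}. restrict (\<lambda>i. if i \<in> S then I i else i) S = I"
    proof (intro ballI ext)
      fix I i assume "I \<in> {I \<in> S \<rightarrow>\<^sub>E S. inj_on I S}"
      then show "restrict (\<lambda>i. if i \<in> S then I i else i) S i = I i"
        by (cases "i \<in> S") (simp_all add: PiE_arb[of I S "\<lambda>_. S" i])
    qed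
    show "(\<lambda>p. restrict p S) ` {p. p permutes S} \<subseteq> {I \<in> S \<rightarrow>\<^sub>E S. inj_on I S}"
    proof (rule image_subsetI)
      fix p assume "p \<in> {p. p permutes S}"
      then have p: "p permutes S" by simp
      have "restrict p S \<in> S \<rightarrow>\<^sub>E S" using permutes_in_image[OF p] by simp
      moreover have "inj_on (restrict p S) S" using permutes_inj_on[OF p] by simp
      ultimately show "restrict p S \<in> {I \<in> S \<rightarrow>\<^sub>E S. inj_on I S}" by simp
    qed
    show "(\<lambda>I i. if i \<in> S then I i else i) ` {I \<in> S \<rightarrow>\<^sub>E S. inj_on I S} \<subseteq> {p. p permutes S}"
    proof (rule image_subsetI)
      fix I assume "I \<in> {I \<in> S \<rightarrow>\<^sub>E S. inj_on I S}"
      then have I: "I \<in> S \<rightarrow>\<^sub>E S" "inj_on I S" by simp_all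
      then have "I ` S \<subseteq> S" by (intro image_subsetI) (rule PiE_mem)
      then have "I ` S = S" using assms I(2) by (intro endo_inj_surj)
      then have "bij_betw (\<lambda>i. if i \<in> S then I i else i) S S"
        using I(2) by (simp add: bij_betw_def inj_on_def)
      then have "(\<lambda>i. if i \<in> S then I i else i) permutes S" by (rule bij_imp_permutes) simp
      then show "(\<lambda>i. if i \<in> S then I i else i) \<in> {p. p permutes S}" by simp
    qed
  qed
  then have "card {p. p permutes S} = card {I \<in> S \<rightarrow>\<^sub>E S. inj_on I S}"
    by (rule bij_betw_same_card)
  then show ?thesis using card_permutations[OF refl assms] by simp
qed

locale real_metric =
  fixes q :: "real^'m::{finite,linorder} \<Rightarrow> real^'m::{finite,linorder} \<Rightarrow> real"
  assumes bilin: "bilinear q" and sym: "\<And>x y. q x y = q y x" and pos: "\<And>x. x \<noteq> 0 \<Longrightarrow> q x x > 0"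
begin

definition gram :: real where
  "gram = det (\<chi> i j. q (axis i 1) (axis j 1) :: real^'m::{finite,linorder}^'m::{finite,linorder})"

definition orthonormal :: "(nat \<Rightarrow> real^'m::{finite,linorder}) \<Rightarrow> bool" where
  "orthonormal e \<longleftrightarrow> (\<forall>i<CARD('m). \<forall>j<CARD('m). q (e i) (e j) = (if i = j then 1 else 0))"

definition vol :: "(nat \<Rightarrow> real^'m::{finite,linorder}) \<Rightarrow> real" where
  "vol v = sqrt gram * det (frame_matrix v)"

lemma volume_form_eq: "g y = q \<Longrightarrow> volume_form g y v = vol v"
  by (simp add: volume_form_def vol_def gram_def frame_matrix_def)

lemma orthonormal_frame_eq: "g y = q \<Longrightarrow> orthonormal_frame g y e \<longleftrightarrow> orthonormal e"
  by (simp add: orthonormal_frame_def orthonormal_def)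

lemma q_simps:
  "q (x + y) z = q x z + q y z" "q (r *\<^sub>R x) z = r * q x z" "q z (r *\<^sub>R x) = r * q z x" "q 0 z = 0"
  using bilin by (simp_all add: bilinear_ladd bilinear_lmul bilinear_rmul bilinear_lzero)

lemma q_sum: "q (\<Sum>i\<in>S. c i *\<^sub>R x i) y = (\<Sum>i\<in>S. c i * q (x i) y)"
  by (induction S rule: infinite_finite_induct) (auto simp: q_simps)

lemma q_eqI:
  assumes "\<And>w. q x w = q y w"
  shows "x = y"
proof -
  have "q (x - y) (x - y) = 0" using assms bilin by (simp add: bilinear_lsub)
  then show ?thesis using pos[of "x - y"] by fastforce
qed

lemma orthonormal_exists: "\<exists>e. orthonormal e"
proof -
  obtain W :: "real^'m::{finite,linorder}^'m::{finite,linorder}"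
    where W: "det W = det (mat 1 :: real^'m::{finite,linorder}^'m::{finite,linorder})"
      "\<And>i j. i \<noteq> j \<Longrightarrow> q (W $ i) (W $ j) = 0"
  proof (rule gram_schmidt_rows[of q "mat 1"])
    show "x \<noteq> 0 \<Longrightarrow> q x x \<noteq> 0" for x using pos[of x] by simp
    show "q x y = 0 \<Longrightarrow> q y x = 0" for x y using sym[of x y] by simp
  qed (auto simp: q_simps scalar_mult_eq_scaleR)
  have "W $ i \<noteq> 0" for i
    using W(1) det_zero_row(2)[of i W] by (auto simp: row_def)
  then have p: "q (W $ i) (W $ i) > 0" for i by (rule pos)
  have "orthonormal (\<lambda>i. (1 / sqrt (q (W $ unrank i) (W $ unrank i))) *\<^sub>R W $ unrank i)"
    unfolding orthonormal_def
  proof (intro allI impI)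
    fix i j assume ij: "i < CARD('m)" "j < CARD('m)"
    show "q ((1 / sqrt (q (W $ unrank i) (W $ unrank i))) *\<^sub>R W $ unrank i)
        ((1 / sqrt (q (W $ unrank j) (W $ unrank j))) *\<^sub>R W $ unrank j) = (if i = j then 1 else 0)"
    proof (cases "i = j")
      case True
      then show ?thesis using p[of "unrank j"] by (simp add: q_simps)
    next
      case False
      then have "unrank i \<noteq> (unrank j :: 'm)" using ij by (metis rank_unrank)
      then show ?thesis using False W(2) by (simp add: q_simps)
    qed
  qed
  then show ?thesis by blast
qed

text \<open>The rows of a matrix \<open>E\<close> are orthonormal if and only if \<open>E G E\<^sup>T = 1\<close> for the Gram matrix
  \<open>G\<close>; take determinants.\<close>

lemma orthonormal_det:
  assumes "orthonormal e"
  shows "(det (frame_matrix e))\<^sup>2 * gram = 1"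
proof -
  define E where "E = frame_matrix e"
  define Q where "Q = (\<chi> i j. q (axis i 1) (axis j 1) :: real^'m::{finite,linorder}^'m::{finite,linorder})"
  have expand: "q x y = (\<Sum>k\<in>UNIV. \<Sum>l\<in>UNIV. x $ k * (Q $ k $ l * y $ l))" for x y
  proof -
    have "q x y = q (\<Sum>k\<in>UNIV. x $ k *\<^sub>R axis k 1) y"
      using basis_expansion[of x] by (simp add: scalar_mult_eq_scaleR)
    also have "\<dots> = (\<Sum>k\<in>UNIV. x $ k * q (axis k 1) y)" by (rule q_sum)
    also have "\<dots> = (\<Sum>k\<in>UNIV. x $ k * (\<Sum>l\<in>UNIV. Q $ k $ l * y $ l))"
    proof (intro sum.cong refl arg_cong2[where f = "(*)"])
      fix k
      have "q (axis k 1) y = q (\<Sum>l\<in>UNIV. y $ l *\<^sub>R axis l 1) (axis k 1)"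
        using basis_expansion[of y] by (simp add: scalar_mult_eq_scaleR sym)
      also have "\<dots> = (\<Sum>l\<in>UNIV. Q $ k $ l * y $ l)"
        unfolding q_sum by (simp add: Q_def sym mult.commute)
      finally show "q (axis k 1) y = (\<Sum>l\<in>UNIV. Q $ k $ l * y $ l)" .
    qed
    finally show ?thesis by (simp add: sum_distrib_left)
  qed
  have "E ** (Q ** transpose E) = mat 1"
  proof (intro vec_eq_iff[THEN iffD2] allI)
    fix i j
    have "(E ** (Q ** transpose E)) $ i $ j = q (E $ i) (E $ j)"
      by (simp add: matrix_matrix_mult_def transpose_def expand sum_distrib_left)
    also have "\<dots> = (if i = j then 1 else 0)"
      using assms inj_index_rank by (auto simp: E_def orthonormal_def index_rank_less inj_def)
    finally show "(E ** (Q ** transpose E)) $ i $ j = mat 1 $ i $ j" by (simp add: mat_def)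
  qed
  then have "det E * (det Q * det E) = 1" by (metis det_I det_mul det_transpose)
  then show ?thesis by (simp add: E_def Q_def gram_def power2_eq_square mult_ac)
qed

lemma gram_pos: "gram > 0"
proof -
  obtain e where "orthonormal e" using orthonormal_exists by blast
  from orthonormal_det[OF this] show ?thesis
    using mult_nonneg_nonpos[of "(det (frame_matrix e))\<^sup>2" gram] by (cases "gram > 0") auto
qed

lemma orthonormal_vol: "orthonormal e \<Longrightarrow> (vol e)\<^sup>2 = 1"
  using orthonormal_det[of e] gram_pos by (simp add: vol_def power_mult_distrib mult.commute)

lemma orthonormal_expand:
  assumes "orthonormal e"
  shows "x = (\<Sum>i<CARD('m). q x (e i) *\<^sub>R e i)"
proof -
  let ?d = "det (frame_matrix e)"
  have "?d \<noteq> 0" using orthonormal_det[OF assms] by auto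
  define c where "c i = det (frame_matrix (e(i := x))) / ?d" for i
  have "(\<Sum>i<CARD('m). det (frame_matrix (e(i := x))) *\<^sub>R e i) = ?d *\<^sub>R x"
    using cramer_frame[of e x] by (simp add: scalar_mult_eq_scaleR)
  then have "(1 / ?d) *\<^sub>R (\<Sum>i<CARD('m). det (frame_matrix (e(i := x))) *\<^sub>R e i) = x"
    using \<open>?d \<noteq> 0\<close> by simp
  then have x: "x = (\<Sum>i<CARD('m). c i *\<^sub>R e i)"
    by (simp add: c_def scaleR_sum_right)
  have "q x (e j) = c j" if "j < CARD('m)" for j
  proof -
    have "q x (e j) = (\<Sum>i<CARD('m). c i * q (e i) (e j))" by (subst x) (rule q_sum)
    also have "\<dots> = (\<Sum>i<CARD('m). if i = j then c i else 0)"
      using assms that by (intro sum.cong) (auto simp: orthonormal_def)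
    finally show ?thesis using that by simp
  qed
  then show ?thesis using x by simp
qed

lemma riesz_orthonormal:
  assumes "orthonormal e" "linear a"
  shows "q (\<Sum>i<CARD('m). a (e i) *\<^sub>R e i) w = a w"
proof -
  have "q (\<Sum>i<CARD('m). a (e i) *\<^sub>R e i) w = (\<Sum>i<CARD('m). q w (e i) * a (e i))"
    unfolding q_sum by (simp add: sym mult.commute)
  also have "\<dots> = a (\<Sum>i<CARD('m). q w (e i) *\<^sub>R e i)"
    by (simp add: linear_sum[OF assms(2)] linear_scale[OF assms(2)])
  also have "(\<Sum>i<CARD('m). q w (e i) *\<^sub>R e i) = w" by (rule orthonormal_expand[OF assms(1), symmetric])
  finally show ?thesis .
qed

lemma sharp_eq:
  assumes "g y = q" "linear a"
  shows "q (sharp g y a) w = a w"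
proof -
  obtain e where "orthonormal e" using orthonormal_exists by blast
  from riesz_orthonormal[OF this assms(2)] have "\<exists>z. \<forall>w. q z w = a w" by blast
  then obtain z where z: "\<forall>w. q z w = a w" by blast
  then have "\<exists>!z. \<forall>w. q z w = a w"
    by (intro ex1I[of _ z]) (auto intro: q_eqI)
  from theI'[OF this] show ?thesis unfolding sharp_def assms(1) by (rule spec)
qed

lemma vol_slot_add:
  assumes "i < CARD('m)"
  shows "vol (v(i := x + c *\<^sub>R y)) = vol (v(i := x)) + c * vol (v(i := y))"
proof -
  have "det (frame_matrix (v(i := x + c *\<^sub>R y))) =
      det (frame_matrix (v(i := x))) + c * det (frame_matrix (v(i := y)))"
    using det_frame_slot[OF assms, of v x c y] by (simp only: scalar_mult_eq_scaleR)
  then show ?thesis by (simp only: vol_def distrib_left mult.left_commute)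
qed

lemma vol_slot:
  assumes i: "i < CARD('m)"
  shows "vol (v(i := \<Sum>j\<in>S. c j *\<^sub>R x j)) = (\<Sum>j\<in>S. c j * vol (v(i := x j)))"
proof -
  have "vol (v(i := 0 + 1 *\<^sub>R 0)) = vol (v(i := 0)) + 1 * vol (v(i := 0))"
    by (rule vol_slot_add[OF i])
  moreover have "0 + 1 *\<^sub>R 0 = (0 :: real^'m::{finite,linorder})" by simp
  ultimately have zero: "vol (v(i := 0)) = 0" by (metis add_cancel_left_right mult_1)
  show ?thesis
  proof (induction S rule: infinite_finite_induct)
    case (insert j S)
    have "(\<Sum>j\<in>insert j S. c j *\<^sub>R x j) = (\<Sum>j\<in>S. c j *\<^sub>R x j) + c j *\<^sub>R x j"
      using insert.hyps by (simp add: add.commute)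
    then show ?case
      using insert vol_slot_add[OF i, of v "\<Sum>j\<in>S. c j *\<^sub>R x j" "c j" "x j"]
      by (simp only: sum.insert[OF insert.hyps] add.commute)
  next
    case (infinite S)
    show ?case unfolding sum.infinite[OF infinite] by (rule zero)
  qed (unfold sum.empty, rule zero)
qed

lemma case_nat_upd: "case_nat x w = (case_nat undefined w)(0 := x)"
  by (auto simp: fun_eq_iff split: nat.splits)

lemma hodge_star_one:
  assumes g: "g y = q" and a: "linear a" "\<And>v. \<alpha> y v = a (v 0)" and x: "\<And>w. q x w = a w"
  shows "hodge_star g 1 \<alpha> y w = vol (case_nat x w)"
proof -
  define e where "e = (SOME e. orthonormal_frame g y e)"
  have e: "orthonormal e"
    using someI_ex[of "orthonormal_frame g y"] orthonormal_exists
    unfolding e_def orthonormal_frame_eq[of g y, OF g] by blast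
  have x_eq: "x = (\<Sum>i<CARD('m). a (e i) *\<^sub>R e i)"
    by (rule q_eqI) (simp add: x riesz_orthonormal[OF e a(1)])
  have cn: "(\<lambda>j. if j < 1 then e (I j) else w (j - 1)) = case_nat (e (I 0)) w" for I :: "nat \<Rightarrow> nat"
    by (auto simp: fun_eq_iff split: nat.splits)
  have "hodge_star g 1 \<alpha> y w = (\<Sum>I \<in> {..<1::nat} \<rightarrow>\<^sub>E {..<CARD('m)}. a (e (I 0)) * vol (case_nat (e (I 0)) w))"
    unfolding hodge_star_def e_def[symmetric] Let_def volume_form_eq[of g y, OF g] cn a(2) by simp
  also have "\<dots> = (\<Sum>i<CARD('m). a (e i) * vol (case_nat (e i) w))"
    by (rule sum.reindex_bij_witness[where j = "\<lambda>I. I 0" and i = "\<lambda>i. (\<lambda>_. undefined)(0 := i)"])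
      (auto simp: PiE_def extensional_def fun_eq_iff)
  also have "\<dots> = vol (case_nat x w)"
  proof -
    define W where "W = case_nat undefined w"
    have cu: "case_nat z w = W(0 := z)" for z
      unfolding W_def by (rule case_nat_upd)
    show ?thesis unfolding cu x_eq by (rule vol_slot[symmetric]) simp
  qed
  finally show ?thesis .
qed

text \<open>In the sum over all index maps that defines the Hodge star, a map with a repeated index gives \<open>0\<close>. Each of the
  \<open>m!\<close> others is a permutation, and contributes the same because its sign enters squared.\<close>

lemma hodge_star_top:
  assumes g: "g y = q" and \<beta>: "\<And>v. \<beta> y v = k * det (frame_matrix v)"
  shows "hodge_star g CARD('m) \<beta> y w = k / sqrt gram"
proof -
  let ?m = "CARD('m)"
  define e where "e = (SOME e. orthonormal_frame g y e)"
  have e: "orthonormal e"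
    using someI_ex[of "orthonormal_frame g y"] orthonormal_exists
    unfolding e_def orthonormal_frame_eq[of g y, OF g] by blast
  have sq: "(det (frame_matrix (\<lambda>i. e (I i))))\<^sup>2 = (if inj_on I {..<?m} then (det (frame_matrix e))\<^sup>2 else 0)"
    if I: "I \<in> {..<?m} \<rightarrow>\<^sub>E {..<?m}" for I :: "nat \<Rightarrow> nat"
  proof (cases "inj_on I {..<?m}")
    case True
    define p where "p j = (unrank (I (index_rank j)) :: 'm)" for j :: 'm
    have IM: "I (index_rank j) < ?m" for j :: 'm
      using I index_rank_less[of j] by (auto simp: PiE_def Pi_def)
    have "inj p"
    proof (rule injI)
      fix i j assume "p i = p j"
      then have "index_rank (p i) = index_rank (p j)" by simp
      then have "I (index_rank i) = I (index_rank j)"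
        unfolding p_def rank_unrank[OF IM] .
      then have "index_rank i = index_rank j"
        by (rule inj_onD[OF True]) (simp_all add: index_rank_less)
      then show "i = j" by (rule injD[OF inj_index_rank])
    qed
    then have p: "p permutes UNIV"
      by (intro bij_imp_permutes) (auto simp: bij_def finite_UNIV_inj_surj)
    have "frame_matrix (\<lambda>i. e (I i)) = (\<chi> j. frame_matrix e $ p j)"
      using IM by (simp add: vec_eq_iff p_def)
    then have "det (frame_matrix (\<lambda>i. e (I i))) = of_int (sign p) * det (frame_matrix e)"
      using det_permute_rows[OF p, of "frame_matrix e"] by simp
    then show ?thesis using True by (simp add: power_mult_distrib sign_def)
  next
    case False
    then obtain i j where "i < ?m" "j < ?m" "i \<noteq> j" "I i = I j" by (auto simp: inj_on_def)
    then have "det (frame_matrix (\<lambda>i. e (I i))) = 0" by (intro det_frame_alt[of i j]) auto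
    then show ?thesis using False by simp
  qed
  have fin: "finite ({..<?m} \<rightarrow>\<^sub>E {..<?m})" by (intro finite_PiE) auto
  have "hodge_star g ?m \<beta> y w = (\<Sum>I \<in> {..<?m} \<rightarrow>\<^sub>E {..<?m}.
      k * det (frame_matrix (\<lambda>i. e (I i))) * (sqrt gram * det (frame_matrix (\<lambda>i. e (I i))))) / fact ?m"
    unfolding hodge_star_def e_def[symmetric] Let_def volume_form_eq[of g y, OF g] vol_def \<beta>
    by (intro arg_cong2[where f = "(/)"] sum.cong refl arg_cong2[where f = "(*)"] arg_cong[where f = det]
        frame_matrix_cong) simp
  also have "\<dots> = (\<Sum>I \<in> {..<?m} \<rightarrow>\<^sub>E {..<?m}.
      k * sqrt gram * (if inj_on I {..<?m} then (det (frame_matrix e))\<^sup>2 else 0)) / fact ?m"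
    by (intro arg_cong2[where f = "(/)"] sum.cong refl)
      (simp add: sq[symmetric] power2_eq_square mult_ac del: if_cancel)
  also have "\<dots> = k * sqrt gram * (det (frame_matrix e))\<^sup>2"
    using card_inj_PiE[of "{..<?m}"] fin
    by (simp add: sum_distrib_left[symmetric] sum.If_cases Int_def)
  also have "\<dots> = k / sqrt gram"
  proof -
    have "(det (frame_matrix e))\<^sup>2 = 1 / gram"
      using orthonormal_det[OF e] gram_pos by (simp add: field_simps)
    moreover obtain r where "r > 0" "sqrt gram = r" "gram = r * r"
      using gram_pos by (metis real_sqrt_gt_zero real_sqrt_mult_self abs_of_pos)
    ultimately show ?thesis by simp
  qed
  finally show ?thesis .
qed

end

section \<open>Calibrated tangent planes\<close>

text \<open>The tangent space of an \<open>f\<close>-special Lagrangian at a point is the image of \<open>L\<close>; \<open>e\<close> is the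
  phase factor.\<close>

locale calibrated_plane = hermitian_volume G T s
  for G :: "complex^'m::{finite,linorder} \<Rightarrow> complex^'m::{finite,linorder} \<Rightarrow> real" and T s +
  fixes L :: "real^'m::{finite,linorder} \<Rightarrow> complex^'m::{finite,linorder}" and e :: complex
  assumes lin: "linear L" and inj: "inj L" and norm_e: "cmod e = 1"
    and calibrated: "\<And>v. Re (e * T (\<lambda>i. L (v i))) =
      sqrt s * volume_form (\<lambda>_ v w. G (L v) (L w)) (0 :: real^'m::{finite,linorder}) v"
begin

sublocale tangent: real_metric "\<lambda>v w. G (L v) (L w)"
proof
  show "bilinear (\<lambda>v w. G (L v) (L w))"
    unfolding bilinear_def
    by (auto intro!: linearI simp: linear_add[OF lin] linear_scale[OF lin] G_simps)
  show "x \<noteq> 0 \<Longrightarrow> G (L x) (L x) > 0" for x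
    using pos[of "L x"] inj lin linear_injective_0[of L] by auto
qed (rule sym)

lemma calibrated_vol: "Re (e * T (\<lambda>i. L (v i))) = sqrt s * tangent.vol v"
  unfolding calibrated by (subst tangent.volume_form_eq) auto

text \<open>In an orthonormal frame of the plane, calibration is the equality case of Hadamard's
  inequality.\<close>

lemma frame_norm_ge:
  assumes "tangent.orthonormal b"
  shows "(cmod (T (\<lambda>i. L (b i))))\<^sup>2 \<ge> s"
proof -
  have "s = (sqrt s * tangent.vol b)\<^sup>2"
    using s_pos tangent.orthonormal_vol[OF assms] by (simp add: power_mult_distrib)
  also have "\<dots> = (Re (e * T (\<lambda>i. L (b i))))\<^sup>2" by (simp only: calibrated_vol)
  also have "\<dots> \<le> (cmod (e * T (\<lambda>i. L (b i))))\<^sup>2"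
    by (intro power2_le_iff_abs_le[THEN iffD2] abs_Re_le_cmod) simp
  finally show ?thesis by (simp add: norm_mult norm_e)
qed

text \<open>The equality case is known on an orthonormal frame and extends by bilinearity.\<close>

lemma lagrangian: "\<omega> (L v) (L w) = 0"
proof -
  obtain b where b: "tangent.orthonormal b" using tangent.orthonormal_exists by blast
  define Z where "Z = frame_matrix (\<lambda>i. L (b i))"
  have orth: "G (Z $ i) (Z $ j) = (if i = j then 1 else 0)" for i j
    using b by (simp add: Z_def tangent.orthonormal_def index_rank_less inj_eq[OF inj_index_rank])
  have "(cmod (\<kappa> * det Z))\<^sup>2 \<ge> s"
    using frame_norm_ge[OF b] T_eq[of "\<lambda>i. L (b i)"] by (simp only: Z_def)
  note 1 = calibrated_imp_lagrangian[OF orth this]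
  have 0: "\<omega> (L (b i)) (L (b j)) = 0" if "i < CARD('m)" "j < CARD('m)" for i j
    using 1[of "unrank i" "unrank j"] that by (simp add: Z_def)
  have lin1: "linear (\<lambda>x. \<omega> (L x) y)" for y
    by (rule linearI) (simp_all add: \<omega>_def linear_add[OF lin] linear_scale[OF lin] J_simps G_simps)
  have lin2: "linear (\<lambda>y. \<omega> x (L y))" for x
    by (rule linearI) (simp_all add: \<omega>_def linear_add[OF lin] linear_scale[OF lin] G_simps)
  have "\<omega> (L v) (L (b j)) = 0" if "j < CARD('m)" for j
  proof -
    have "\<omega> (L v) (L (b j)) = \<omega> (L (\<Sum>i<CARD('m). G (L v) (L (b i)) *\<^sub>R b i)) (L (b j))"
      by (rule arg_cong[OF tangent.orthonormal_expand[OF b], of "\<lambda>v. \<omega> (L v) (L (b j))"])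
    also have "\<dots> = 0"
      using 0 that unfolding linear_sum[OF lin1] linear_scale[OF lin1] by simp
    finally show ?thesis .
  qed
  then have "\<omega> (L v) (L (\<Sum>i<CARD('m). G (L w) (L (b i)) *\<^sub>R b i)) = 0"
    unfolding linear_sum[OF lin2] linear_scale[OF lin2] by simp
  then show ?thesis unfolding tangent.orthonormal_expand[OF b, of w, symmetric] .
qed

text \<open>As the plane \<open>L\<close> is Lagrangian, \<open>J\<close> maps it to its orthogonal complement. A normal vector is
  therefore \<open>- J L x\<close> for the vector \<open>x\<close> dual to \<open>\<iota>\<^sub>\<eta> \<omega>\<close>.\<close>

lemma normal_vector_eq:
  assumes normal: "\<And>w. G \<eta> (L w) = 0" and x: "\<And>w. G (L x) (L w) = \<omega> \<eta> (L w)"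
  shows "\<eta> = - cplx_J (L x)"
proof -
  obtain b where b: "tangent.orthonormal b" using tangent.orthonormal_exists by blast
  define \<zeta> where "\<zeta> = \<eta> + cplx_J (L x)"
  have h0: "h (L w) \<zeta> = 0" for w
  proof -
    have "G \<zeta> (L w) = 0"
      using lagrangian[of x w] by (simp add: \<zeta>_def G_simps normal \<omega>_def)
    moreover have "\<omega> \<zeta> (L w) = 0"
      using x[of w] by (simp add: \<zeta>_def \<omega>_def J_simps G_simps)
    ultimately show ?thesis
      using \<omega>_antisym[of "L w" \<zeta>] by (simp add: h_def sym complex_eq_iff)
  qed
  let ?v = "\<lambda>i. L (b i)"
  \<comment> \<open>the difference is hermitian orthogonal to the plane, which spans the space over the complex numbers\<close>
  have "T ?v \<noteq> 0" using frame_norm_ge[OF b] s_pos by auto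
  then have det: "det (frame_matrix ?v) \<noteq> 0" using T_eq[of ?v] by auto
  have "det (frame_matrix ?v) * h \<zeta> \<zeta> = h (det (frame_matrix ?v) *s \<zeta>) \<zeta>" by (simp add: h_scale)
  also have "\<dots> = h (\<Sum>i<CARD('m). det (frame_matrix (?v(i := \<zeta>))) *s ?v i) \<zeta>"
    by (simp only: cramer_frame)
  also have "\<dots> = 0" by (simp add: h_sum h0 del: fun_upd_apply)
  finally have "h \<zeta> \<zeta> = 0" using det by simp
  then have "\<zeta> = 0" using pos[of \<zeta>] by (auto simp: h_self)
  then show ?thesis by (simp add: \<zeta>_def add_eq_0_iff)
qed

text \<open>Complex linearity of \<open>T\<close> in its first slot moves the factor \<open>- i\<close> out of \<open>\<eta> = - i L x\<close>, and exchanges the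
  imaginary part for the real part, which calibration determines.\<close>

lemma Im_interior_normal:
  assumes normal: "\<And>w. G \<eta> (L w) = 0" and x: "\<And>w. G (L x) (L w) = \<omega> \<eta> (L w)"
  shows "Im (e * T (case_nat \<eta> (\<lambda>i. L (w i)))) = - sqrt s * tangent.vol (case_nat x w)"
proof -
  have \<eta>: "\<eta> = (- \<i>) *s L x"
    using normal_vector_eq[OF normal x] by (simp add: cplx_J_def vec_eq_iff)
  have Lc: "case_nat (L x) (\<lambda>i. L (w i)) = (\<lambda>i. L (case_nat x w i))"
    by (auto simp: fun_eq_iff split: nat.splits)
  define W where "W = case_nat undefined (\<lambda>i. L (w i))"
  have cu: "case_nat z (\<lambda>i. L (w i)) = W(0 := z)" for z
    unfolding W_def by (rule tangent.case_nat_upd)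
  have "T (case_nat \<eta> (\<lambda>i. L (w i))) = - \<i> * T (case_nat (L x) (\<lambda>i. L (w i)))"
    unfolding \<eta> cu by (rule form_type_k0_scale[OF type]) simp
  then have "Im (e * T (case_nat \<eta> (\<lambda>i. L (w i)))) = - Re (e * T (\<lambda>i. L (case_nat x w i)))"
    by (simp add: Lc algebra_simps)
  then show ?thesis by (simp only: calibrated_vol minus_mult_left)
qed

end

section \<open>First variation of pulled-back forms in coordinates\<close>

lemma frechet_derivative_cong_open:
  assumes "open N" "y \<in> N" "\<And>z. z \<in> N \<Longrightarrow> a z = b z"
  shows "frechet_derivative a (at y) = frechet_derivative b (at y)"
proof -
  have "(a has_derivative D) (at y) \<longleftrightarrow> (b has_derivative D) (at y)" for D
    using assms has_derivative_transform_within_open[of a D y UNIV N b]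
      has_derivative_transform_within_open[of b D y UNIV N a] by auto
  then show ?thesis by (simp add: frechet_derivative_def)
qed

lemma ext_deriv_cong:
  assumes "open N" "y \<in> N" "\<And>z w. z \<in> N \<Longrightarrow> \<alpha> z w = \<beta> z w"
  shows "ext_deriv k \<alpha> y v = ext_deriv k \<beta> y v"
  unfolding ext_deriv_def
  by (intro sum.cong refl arg_cong2[where f = "(*)"], subst frechet_derivative_cong_open[OF assms(1,2)])
    (auto simp: assms(3))

subsection \<open>Top degree\<close>

text \<open>The derivative of \<open>\<kappa>(\<phi>) det (D\<phi>)\<close> when \<open>\<phi>\<close> moves with velocity \<open>\<zeta>\<close>: the coordinate expression of the pulled-back
  Lie derivative of \<open>\<kappa> dz\<^sub>1 \<and> \<dots> \<and> dz\<^sub>m\<close>.\<close>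

definition interior_density ::
    "(complex^'m::{finite,linorder} \<Rightarrow> complex) \<Rightarrow> (real^'m::{finite,linorder} \<Rightarrow> complex^'m::{finite,linorder}) \<Rightarrow>
     (real^'m::{finite,linorder} \<Rightarrow> complex^'m::{finite,linorder}) \<Rightarrow> real^'m::{finite,linorder} \<Rightarrow> complex" where
  "interior_density \<kappa> \<phi> \<zeta> y =
    frechet_derivative \<kappa> (at (\<phi> y)) (\<zeta> y) * det (frame_matrix (\<lambda>i. frechet_derivative \<phi> (at y) (axis_seq i))) +
    \<kappa> (\<phi> y) * (\<Sum>i<CARD('m). det (frame_matrix ((\<lambda>j. frechet_derivative \<phi> (at y) (axis_seq j))
      (i := frechet_derivative \<zeta> (at y) (axis_seq i)))))"

lemma has_derivative_form_along:
  fixes \<rho> :: "'c::real_normed_vector \<Rightarrow> complex^'m::{finite,linorder}"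
    and w :: "'c \<Rightarrow> nat \<Rightarrow> complex^'m::{finite,linorder}"
  assumes "smooth_on V \<kappa>" "\<rho> p \<in> V" "(\<rho> has_derivative \<rho>') (at p)"
    and "\<And>i. i < CARD('m) \<Longrightarrow> ((\<lambda>p. w p i) has_derivative w' i) (at p)"
  shows "((\<lambda>p. \<kappa> (\<rho> p) * det (frame_matrix (w p))) has_derivative
    (\<lambda>h. \<kappa> (\<rho> p) * (\<Sum>i<CARD('m). det (frame_matrix ((w p)(i := w' i h)))) +
      frechet_derivative \<kappa> (at (\<rho> p)) (\<rho>' h) * det (frame_matrix (w p)))) (at p)"
proof -
  have "((\<lambda>p. \<kappa> (\<rho> p)) has_derivative (\<lambda>h. frechet_derivative \<kappa> (at (\<rho> p)) (\<rho>' h))) (at p)"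
    by (rule has_derivative_compose[where g = \<kappa>, OF assms(3) smooth_on_has_derivative[OF assms(1,2)]])
  from has_derivative_mult[OF this has_derivative_det_frame[OF assms(4)]] show ?thesis .
qed

lemma holomorphic_linear:
  assumes "linear D" "\<And>u. D (cplx_J u) = \<i> * D u"
  shows "D (c *s u) = c * (D u :: complex)"
proof -
  have "c *s u = Re c *\<^sub>R u + Im c *\<^sub>R cplx_J u"
    by (auto simp: vec_eq_iff cplx_J_def complex_eq_iff)
  then show ?thesis
    by (simp add: linear_add[OF assms(1)] linear_scale[OF assms(1)] assms(2) complex_eq_iff)
qed

text \<open>Differentiating \<open>\<kappa> det(\<dots>)\<close> in the direction \<open>v\<^sub>i\<close>, with \<open>\<zeta>\<close> in slot \<open>i\<close>, and summing over \<open>i\<close>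
  produces three kinds of terms. The derivatives of \<open>\<kappa>\<close> combine by Cramer's rule, because \<open>\<kappa>\<close> is
  holomorphic; the derivatives of \<open>\<zeta>\<close> remain; the second derivatives of \<open>\<phi>\<close> cancel by symmetry.\<close>

lemma ext_deriv_interior_top:
  fixes \<phi> \<zeta> :: "real^'m::{finite,linorder} \<Rightarrow> complex^'m::{finite,linorder}"
  assumes \<kappa>: "smooth_on V \<kappa>" and holo: "\<And>x u. x \<in> V \<Longrightarrow>
      frechet_derivative \<kappa> (at x) (cplx_J u) = \<i> * frechet_derivative \<kappa> (at x) u"
    and \<phi>: "smooth_on N \<phi>" "\<phi> ` N \<subseteq> V" and \<zeta>: "smooth_on N \<zeta>" and y: "y \<in> N"
  shows "ext_deriv (CARD('m) - 1) (\<lambda>z w. \<kappa> (\<phi> z) * det (frame_matrix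
      (case_nat (\<zeta> z) (\<lambda>i. frechet_derivative \<phi> (at z) (w i))))) y v =
      interior_density \<kappa> \<phi> \<zeta> y * of_real (det (frame_matrix v))"
    and "i < CARD('m) \<Longrightarrow> (\<lambda>z. \<kappa> (\<phi> z) * det (frame_matrix (case_nat (\<zeta> z)
      (\<lambda>j. frechet_derivative \<phi> (at z) (v (if j < i then j else Suc j)))))) differentiable (at y)"
proof -
  let ?D = "\<lambda>z. frechet_derivative \<phi> (at z)" and ?Z = "frechet_derivative \<zeta> (at y)"
  let ?K = "frechet_derivative \<kappa> (at (\<phi> y))"
  let ?f = "\<lambda>j. ?D y (v j)"
  have \<phi>y: "\<phi> y \<in> V" using \<phi>(2) y by auto
  define b where "b i k = frechet_derivative (\<lambda>z. ?D z (v k)) (at y) (v i)" for i k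
  define a where "a i k = det (frame_matrix (?f(i := \<zeta> y, k := b i k)))" for i k
  define R where "R i k h = (if k = i then ?Z h else frechet_derivative (\<lambda>z. ?D z (v k)) (at y) h)" for i k h
  define D\<^sub>i where "D\<^sub>i i h = \<kappa> (\<phi> y) * (\<Sum>k<CARD('m). det (frame_matrix ((?f(i := \<zeta> y))(k := R i k h)))) +
      ?K (?D y h) * det (frame_matrix (?f(i := \<zeta> y)))" for i h
  have d: "((\<lambda>z. \<kappa> (\<phi> z) * det (frame_matrix ((\<lambda>j. ?D z (v j))(i := \<zeta> z)))) has_derivative D\<^sub>i i) (at y)" for i
    unfolding D\<^sub>i_def
  proof (rule has_derivative_form_along[where w = "\<lambda>z. (\<lambda>j. ?D z (v j))(i := \<zeta> z)"
        and \<rho> = \<phi> and p = y, OF \<kappa> \<phi>y])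
    show "(\<phi> has_derivative ?D y) (at y)" by (rule smooth_on_has_derivative[OF \<phi>(1) y])
    fix k
    show "((\<lambda>z. ((\<lambda>j. ?D z (v j))(i := \<zeta> z)) k) has_derivative R i k) (at y)"
      using smooth_on_has_derivative[OF \<zeta> y] smooth_on_has_derivative[OF smooth_on_frechet_derivative[OF \<phi>(1)] y]
      unfolding R_def by (cases "k = i") simp_all
  qed
  have front: "(\<lambda>z. \<kappa> (\<phi> z) * det (frame_matrix (case_nat (\<zeta> z) (\<lambda>j. ?D z (v (if j < i then j else Suc j)))))) =
     (\<lambda>z. (-1) ^ i * (\<kappa> (\<phi> z) * det (frame_matrix ((\<lambda>j. ?D z (v j))(i := \<zeta> z)))))" if "i < CARD('m)" for i
    using det_frame_front[OF that, of "\<zeta> _" "\<lambda>j. ?D _ (v j)"] by (intro ext) (simp del: fun_upd_apply)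
  have d': "((\<lambda>z. \<kappa> (\<phi> z) * det (frame_matrix (case_nat (\<zeta> z) (\<lambda>j. ?D z (v (if j < i then j else Suc j))))))
     has_derivative (\<lambda>h. (-1) ^ i * D\<^sub>i i h)) (at y)" if "i < CARD('m)" for i
    unfolding front[OF that] by (rule has_derivative_mult_right[OF d])
  then show "i < CARD('m) \<Longrightarrow> (\<lambda>z. \<kappa> (\<phi> z) * det (frame_matrix (case_nat (\<zeta> z)
      (\<lambda>j. ?D z (v (if j < i then j else Suc j)))))) differentiable (at y)"
    unfolding differentiable_def by blast
  have idx: "{..CARD('m) - 1} = {..<CARD('m)}"
    by (metis One_nat_def Suc_pred lessThan_Suc_atMost zero_less_card_finite)
  have "ext_deriv (CARD('m) - 1) (\<lambda>z w. \<kappa> (\<phi> z) * det (frame_matrix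
      (case_nat (\<zeta> z) (\<lambda>i. ?D z (w i))))) y v = (\<Sum>i<CARD('m). (-1) ^ i * ((-1) ^ i * D\<^sub>i i (v i)))"
    unfolding ext_deriv_def idx
    by (intro sum.cong refl arg_cong2[where f = "(*)"]) (simp only: frechet_derivative_eqI[OF d'] lessThan_iff)
  also have "\<dots> = (\<Sum>i<CARD('m). D\<^sub>i i (v i))"
    by (simp add: mult.assoc[symmetric] power_mult_distrib[symmetric])
  also have "\<dots> = \<kappa> (\<phi> y) * (\<Sum>i<CARD('m). \<Sum>k<CARD('m). det (frame_matrix ((?f(i := \<zeta> y))(k := R i k (v i))))) +
      (\<Sum>i<CARD('m). ?K (?D y (v i)) * det (frame_matrix (?f(i := \<zeta> y))))"
    by (simp only: D\<^sub>i_def sum.distrib sum_distrib_left)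
  also have "(\<Sum>i<CARD('m). ?K (?D y (v i)) * det (frame_matrix (?f(i := \<zeta> y)))) =
      ?K (\<zeta> y) * det (frame_matrix ?f)"
  proof -
    have lin: "linear ?K" using smooth_on_has_derivative[OF \<kappa> \<phi>y] has_derivative_linear by blast
    note hl = holomorphic_linear[OF lin holo[OF \<phi>y]]
    have "(\<Sum>i<CARD('m). ?K (?D y (v i)) * det (frame_matrix (?f(i := \<zeta> y)))) =
       ?K (\<Sum>i<CARD('m). det (frame_matrix (?f(i := \<zeta> y))) *s ?f i)"
      by (simp only: linear_sum[OF lin] hl mult.commute)
    then show ?thesis by (simp only: cramer_frame hl mult.commute)
  qed
  also have "(\<Sum>i<CARD('m). \<Sum>k<CARD('m). det (frame_matrix ((?f(i := \<zeta> y))(k := R i k (v i))))) =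
     (\<Sum>i<CARD('m). det (frame_matrix (?f(i := ?Z (v i)))))"
  proof -
    have bsym: "b i k = b k i" for i k
      unfolding b_def by (rule second_derivative_symmetric[OF \<phi>(1) y])
    have anti: "a k i = - a i k" if "i < CARD('m)" "k < CARD('m)" "i \<noteq> k" for i k
    proof -
      have "?f(k := \<zeta> y, i := b k i) = (?f(i := \<zeta> y, k := b i k)) \<circ> Transposition.transpose i k"
        using that(3) bsym[of i k] by (auto simp: fun_eq_iff Transposition.transpose_def)
      then show ?thesis unfolding a_def using det_frame_swap[OF that] by (simp del: fun_upd_apply)
    qed
    have "(\<Sum>k<CARD('m). det (frame_matrix ((?f(i := \<zeta> y))(k := R i k (v i))))) =
        det (frame_matrix (?f(i := ?Z (v i)))) + (\<Sum>k<CARD('m). if k = i then 0 else a i k)"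
      if "i < CARD('m)" for i
    proof -
      have "(\<Sum>k<CARD('m). det (frame_matrix ((?f(i := \<zeta> y))(k := R i k (v i))))) =
        (\<Sum>k<CARD('m). (if k = i then det (frame_matrix (?f(i := ?Z (v i)))) else 0) + (if k = i then 0 else a i k))"
        by (intro sum.cong refl) (simp add: R_def a_def b_def del: fun_upd_apply)
      then show ?thesis using that by (simp add: sum.distrib del: fun_upd_apply)
    qed
    then have "(\<Sum>i<CARD('m). \<Sum>k<CARD('m). det (frame_matrix ((?f(i := \<zeta> y))(k := R i k (v i))))) =
      (\<Sum>i<CARD('m). det (frame_matrix (?f(i := ?Z (v i))))) +
      (\<Sum>i<CARD('m). \<Sum>k<CARD('m). if k = i then 0 else a i k)"
      by (simp add: sum.distrib del: fun_upd_apply)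
    moreover have "(\<Sum>i<CARD('m). \<Sum>k<CARD('m). if k = i then 0 else a i k) = 0"
    proof -
      let ?s = "\<Sum>i<CARD('m). \<Sum>k<CARD('m). if k = i then 0 else a i k"
      have "?s = (\<Sum>i<CARD('m). \<Sum>k<CARD('m). if i = k then 0 else a k i)" by (rule sum.swap)
      also have "\<dots> = (\<Sum>i<CARD('m). \<Sum>k<CARD('m). - (if k = i then 0 else a i k))"
        by (intro sum.cong refl) (auto intro: anti)
      also have "\<dots> = - ?s" by (simp only: sum_negf)
      finally show ?thesis by simp
    qed
    ultimately show ?thesis by simp
  qed
  also have "(\<Sum>i<CARD('m). det (frame_matrix (?f(i := ?Z (v i))))) = of_real (det (frame_matrix v)) *
    (\<Sum>i<CARD('m). det (frame_matrix ((\<lambda>j. ?D y (axis_seq j))(i := ?Z (axis_seq i)))))"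
    using smooth_on_has_derivative[OF \<phi>(1) y] smooth_on_has_derivative[OF \<zeta> y]
    by (intro det_frame_linear_variation) (blast intro: has_derivative_linear)+
  also have "det (frame_matrix ?f) = of_real (det (frame_matrix v)) * det (frame_matrix (\<lambda>i. ?D y (axis_seq i)))"
    using smooth_on_has_derivative[OF \<phi>(1) y]
    by (intro det_frame_linear_image) (blast intro: has_derivative_linear)
  finally show "ext_deriv (CARD('m) - 1) (\<lambda>z w. \<kappa> (\<phi> z) * det (frame_matrix
      (case_nat (\<zeta> z) (\<lambda>i. ?D z (w i))))) y v = interior_density \<kappa> \<phi> \<zeta> y * of_real (det (frame_matrix v))"
    by (simp add: interior_density_def algebra_simps del: fun_upd_apply)
qed

text \<open>A smooth family of maps in coordinates, together with its initial map \<open>\<phi>\<close> and initial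
  velocity \<open>\<zeta>\<close>.\<close>

locale local_variation =
  fixes O\<^sub>\<Psi> :: "(real \<times> (real^'m::{finite,linorder})) set"
    and \<Psi> :: "real \<times> (real^'m::{finite,linorder}) \<Rightarrow> complex^'m::{finite,linorder}"
    and N :: "(real^'m::{finite,linorder}) set"
    and \<phi> \<zeta> :: "real^'m::{finite,linorder} \<Rightarrow> complex^'m::{finite,linorder}"
    and V :: "(complex^'m::{finite,linorder}) set"
  assumes \<Psi>: "smooth_on O\<^sub>\<Psi> \<Psi>" and \<Psi>_V: "\<And>p. p \<in> O\<^sub>\<Psi> \<Longrightarrow> \<Psi> p \<in> V"
    and N: "open N" and N_O: "\<And>z. z \<in> N \<Longrightarrow> (0, z) \<in> O\<^sub>\<Psi>"
    and \<phi>_eq: "\<And>z. z \<in> N \<Longrightarrow> \<phi> z = \<Psi> (0, z)"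
    and \<zeta>_eq: "\<And>z. z \<in> N \<Longrightarrow> \<zeta> z = frechet_derivative \<Psi> (at (0, z)) (1, 0)"
begin

abbreviation "D\<Psi> p \<equiv> frechet_derivative \<Psi> (at p)"

lemma slice: "smooth_on N (\<lambda>z. (0::real, z))"
  by (intro smooth_on_Pair smooth_on_const smooth_on_ident N)

lemma \<phi>_smooth: "smooth_on N \<phi>"
  by (rule smooth_on_cong[OF smooth_on_compose[OF \<Psi> slice]]) (auto simp: N_O \<phi>_eq)

lemma \<phi>_V: "\<phi> ` N \<subseteq> V"
  using \<phi>_eq \<Psi>_V N_O by auto

lemma \<zeta>_smooth: "smooth_on N \<zeta>"
  by (rule smooth_on_cong[OF smooth_on_compose[OF smooth_on_frechet_derivative[OF \<Psi>, of "(1, 0)"] slice]])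
    (auto simp: N_O \<zeta>_eq)

lemma slice_derivative:
  assumes "(u has_derivative u') (at (0, y))" "y \<in> N" "\<And>z. z \<in> N \<Longrightarrow> w z = u (0, z)"
  shows "frechet_derivative w (at y) = (\<lambda>v. u' (0, v))"
proof -
  have "((\<lambda>z. u (0, z)) has_derivative (\<lambda>v. u' (0, v))) (at y)"
    by (rule has_derivative_compose[where g = u and f = "\<lambda>z. (0, z)", OF _ assms(1)])
      (intro has_derivative_Pair has_derivative_const has_derivative_ident)
  then have "(w has_derivative (\<lambda>v. u' (0, v))) (at y)"
    by (rule has_derivative_transform_within_open[OF _ N assms(2)]) (simp add: assms(3))
  then show ?thesis by (rule frechet_derivative_eqI)
qed

lemma D\<phi>: "y \<in> N \<Longrightarrow> frechet_derivative \<phi> (at y) = (\<lambda>v. D\<Psi> (0, y) (0, v))"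
  by (rule slice_derivative[OF smooth_on_has_derivative[OF \<Psi> N_O]]) (auto simp: \<phi>_eq)

lemma D\<zeta>: "y \<in> N \<Longrightarrow> frechet_derivative \<zeta> (at y) v =
    frechet_derivative (\<lambda>p. D\<Psi> p (0, v)) (at (0, y)) (1, 0)"
proof -
  assume y: "y \<in> N"
  have "frechet_derivative \<zeta> (at y) = (\<lambda>v. frechet_derivative (\<lambda>p. D\<Psi> p (1, 0)) (at (0, y)) (0, v))"
    by (rule slice_derivative[where u = "\<lambda>p. D\<Psi> p (1, 0)", OF
          smooth_on_has_derivative[OF smooth_on_frechet_derivative[OF \<Psi>] N_O[OF y]] y \<zeta>_eq])
  then show ?thesis
    using second_derivative_symmetric[OF \<Psi> N_O[OF y], of "(1, 0)" "(0, v)"] by simp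
qed

lemma time_derivative:
  assumes "(u has_derivative u') (at (0, y))"
  shows "((\<lambda>t. u (t, y)) has_vector_derivative u' (1, 0)) (at (0::real))"
proof -
  have "((\<lambda>t. u (t, y)) has_derivative (\<lambda>t. u' (t, 0))) (at 0)"
    by (rule has_derivative_compose[where g = u and f = "\<lambda>t. (t, y)", OF _ assms])
      (intro has_derivative_Pair has_derivative_const has_derivative_ident)
  moreover have "(\<lambda>t. u' (t, 0)) = (\<lambda>t. t *\<^sub>R u' (1, 0))"
  proof
    fix t
    show "u' (t, 0) = t *\<^sub>R u' (1, 0)"
      using linear_scale[OF has_derivative_linear[OF assms], of t "(1, 0)"] by simp
  qed
  ultimately show ?thesis unfolding has_vector_derivative_def by (simp only:)
qed

text \<open>Time and space derivatives of \<open>\<Psi>\<close> commute, so that the differential of \<open>\<Psi> (t, \<cdot>)\<close> moves with velocity \<open>D\<zeta>\<close>.\<close>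

lemma top_form_variation:
  assumes "smooth_on V \<kappa>" "y \<in> N"
  shows "((\<lambda>t. \<kappa> (\<Psi> (t, y)) * det (frame_matrix (\<lambda>i. D\<Psi> (t, y) (0, v i)))) has_vector_derivative
    interior_density \<kappa> \<phi> \<zeta> y * of_real (det (frame_matrix v))) (at 0)"
proof -
  let ?D = "frechet_derivative \<phi> (at y)" and ?Z = "frechet_derivative \<zeta> (at y)"
  note O = N_O[OF assms(2)]
  have lin: "linear ?D" "linear ?Z"
    using smooth_on_has_derivative[OF \<phi>_smooth assms(2)] smooth_on_has_derivative[OF \<zeta>_smooth assms(2)]
    by (blast intro: has_derivative_linear)+
  have "((\<lambda>p. \<kappa> (\<Psi> p) * det (frame_matrix (\<lambda>i. D\<Psi> p (0, v i)))) has_derivative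
    (\<lambda>h. \<kappa> (\<Psi> (0, y)) * (\<Sum>i<CARD('m). det (frame_matrix ((\<lambda>i. D\<Psi> (0, y) (0, v i))
        (i := frechet_derivative (\<lambda>p. D\<Psi> p (0, v i)) (at (0, y)) h)))) +
      frechet_derivative \<kappa> (at (\<Psi> (0, y))) (D\<Psi> (0, y) h) * det (frame_matrix (\<lambda>i. D\<Psi> (0, y) (0, v i))))) (at (0, y))"
    by (rule has_derivative_form_along[where w = "\<lambda>p i. D\<Psi> p (0, v i)" and \<rho> = \<Psi> and p = "(0, y)",
          OF assms(1) \<Psi>_V[OF O]
          smooth_on_has_derivative[OF \<Psi> O]])
      (rule smooth_on_has_derivative[OF smooth_on_frechet_derivative[OF \<Psi>] O])
  from time_derivative[OF this]
  have "((\<lambda>t. \<kappa> (\<Psi> (t, y)) * det (frame_matrix (\<lambda>i. D\<Psi> (t, y) (0, v i)))) has_vector_derivative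
    (\<kappa> (\<phi> y) * (\<Sum>i<CARD('m). det (frame_matrix ((\<lambda>i. ?D (v i))(i := ?Z (v i))))) +
      frechet_derivative \<kappa> (at (\<phi> y)) (\<zeta> y) * det (frame_matrix (\<lambda>i. ?D (v i))))) (at 0)"
    unfolding D\<phi>[OF assms(2)] D\<zeta>[OF assms(2)] \<phi>_eq[OF assms(2)] \<zeta>_eq[OF assms(2)] .
  then show ?thesis
    unfolding det_frame_linear_variation[OF lin, of v] det_frame_linear_image[OF lin(1), of v]
    by (simp add: interior_density_def algebra_simps del: fun_upd_apply)
qed

end

subsection \<open>Two-forms\<close>

text \<open>Only the coefficients of \<open>\<sigma>\<close> are known to be differentiable, hence the two arguments are expanded in
  a basis.\<close>

lemma has_derivative_bilinear_along:
  fixes \<sigma> :: "'e::euclidean_space \<Rightarrow> 'e \<Rightarrow> 'e \<Rightarrow> real" and \<rho> :: "'c::real_normed_vector \<Rightarrow> 'e"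
  assumes \<sigma>: "\<And>a b. smooth_on V (\<lambda>x. \<sigma> x a b)" and bil: "\<And>x. x \<in> V \<Longrightarrow> bilinear (\<sigma> x)"
    and S: "open S" "p \<in> S" "\<rho> ` S \<subseteq> V"
    and d: "(\<rho> has_derivative \<rho>') (at p)" "(a has_derivative a') (at p)" "(b has_derivative b') (at p)"
  shows "((\<lambda>p. \<sigma> (\<rho> p) (a p) (b p)) has_derivative
    (\<lambda>h. frechet_derivative (\<lambda>x. \<sigma> x (a p) (b p)) (at (\<rho> p)) (\<rho>' h) +
      \<sigma> (\<rho> p) (a' h) (b p) + \<sigma> (\<rho> p) (a p) (b' h))) (at p)"
proof -
  have pV: "\<rho> p \<in> V" using S by auto
  have expand: "\<sigma> x u w = (\<Sum>i\<in>Basis. \<Sum>j\<in>Basis. (u \<bullet> i) * (w \<bullet> j) * \<sigma> x i j)" if "x \<in> V" for x u w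
  proof -
    have l: "linear (\<lambda>u. \<sigma> x u w)" "linear (\<sigma> x i)" for i
      using bil[OF that] by (auto simp: bilinear_def)
    have "\<sigma> x u w = (\<Sum>i\<in>Basis. (u \<bullet> i) *\<^sub>R \<sigma> x i w)" using linear_expand_Basis[OF l(1)] .
    also have "\<dots> = (\<Sum>i\<in>Basis. (u \<bullet> i) *\<^sub>R (\<Sum>j\<in>Basis. (w \<bullet> j) *\<^sub>R \<sigma> x i j))"
      by (intro sum.cong refl arg_cong2[where f = scaleR] linear_expand_Basis[OF l(2)])
    finally show ?thesis by (simp add: sum_distrib_left mult.assoc)
  qed
  have sd: "((\<lambda>x. \<sigma> x u w) has_derivative frechet_derivative (\<lambda>x. \<sigma> x u w) (at x)) (at x)" if "x \<in> V" for x u w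
    by (rule smooth_on_has_derivative[OF \<sigma> that])
  have Dexpand: "frechet_derivative (\<lambda>x. \<sigma> x u w) (at (\<rho> p)) h =
    (\<Sum>i\<in>Basis. \<Sum>j\<in>Basis. (u \<bullet> i) * (w \<bullet> j) * frechet_derivative (\<lambda>x. \<sigma> x i j) (at (\<rho> p)) h)" for u w h
  proof -
    have "((\<lambda>x. \<Sum>i\<in>Basis. \<Sum>j\<in>Basis. (u \<bullet> i) * (w \<bullet> j) * \<sigma> x i j) has_derivative
      (\<lambda>h. \<Sum>i\<in>Basis. \<Sum>j\<in>Basis. (u \<bullet> i) * (w \<bullet> j) * frechet_derivative (\<lambda>x. \<sigma> x i j) (at (\<rho> p)) h)) (at (\<rho> p))"
      by (intro has_derivative_sum has_derivative_mult_right sd pV)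
    then have "((\<lambda>x. \<sigma> x u w) has_derivative
      (\<lambda>h. \<Sum>i\<in>Basis. \<Sum>j\<in>Basis. (u \<bullet> i) * (w \<bullet> j) * frechet_derivative (\<lambda>x. \<sigma> x i j) (at (\<rho> p)) h)) (at (\<rho> p))"
      by (rule has_derivative_transform_within_open[OF _ smooth_on_open[OF \<sigma>] pV]) (simp add: expand)
    then show ?thesis by (simp add: frechet_derivative_eqI)
  qed
  have "((\<lambda>p. \<Sum>i\<in>Basis. \<Sum>j\<in>Basis. (a p \<bullet> i) * (b p \<bullet> j) * \<sigma> (\<rho> p) i j) has_derivative
    (\<lambda>h. \<Sum>i\<in>Basis. \<Sum>j\<in>Basis. (a p \<bullet> i) * (b p \<bullet> j) * frechet_derivative (\<lambda>x. \<sigma> x i j) (at (\<rho> p)) (\<rho>' h) +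
       ((a p \<bullet> i) * (b' h \<bullet> j) + (a' h \<bullet> i) * (b p \<bullet> j)) * \<sigma> (\<rho> p) i j)) (at p)"
    by (intro has_derivative_sum has_derivative_mult has_derivative_inner_left d
        has_derivative_compose[where g = "\<lambda>x. \<sigma> x _ _", OF d(1) sd[OF pV]])
  then have "((\<lambda>p. \<sigma> (\<rho> p) (a p) (b p)) has_derivative
    (\<lambda>h. \<Sum>i\<in>Basis. \<Sum>j\<in>Basis. (a p \<bullet> i) * (b p \<bullet> j) * frechet_derivative (\<lambda>x. \<sigma> x i j) (at (\<rho> p)) (\<rho>' h) +
       ((a p \<bullet> i) * (b' h \<bullet> j) + (a' h \<bullet> i) * (b p \<bullet> j)) * \<sigma> (\<rho> p) i j)) (at p)"
    by (rule has_derivative_transform_within_open[OF _ S(1,2)]) (use S(3) in \<open>auto simp: expand image_subset_iff\<close>)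
  moreover have "(\<Sum>i\<in>Basis. \<Sum>j\<in>Basis. (a p \<bullet> i) * (b p \<bullet> j) * frechet_derivative (\<lambda>x. \<sigma> x i j) (at (\<rho> p)) (\<rho>' h) +
       ((a p \<bullet> i) * (b' h \<bullet> j) + (a' h \<bullet> i) * (b p \<bullet> j)) * \<sigma> (\<rho> p) i j) =
    frechet_derivative (\<lambda>x. \<sigma> x (a p) (b p)) (at (\<rho> p)) (\<rho>' h) +
      \<sigma> (\<rho> p) (a' h) (b p) + \<sigma> (\<rho> p) (a p) (b' h)" for h
    unfolding Dexpand[of "a p" "b p" "\<rho>' h"] expand[OF pV, of "a' h" "b p"] expand[OF pV, of "a p" "b' h"]
      sum.distrib[symmetric]
    by (intro sum.cong refl) (simp add: algebra_simps)
  ultimately show ?thesis by simp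
qed

context local_variation
begin

text \<open>Cartan's formula for a closed two-form. On the right the second derivatives of \<open>\<phi>\<close> cancel by symmetry.
  What remains differs from the time derivative on the left by the cyclic sum of the derivatives of \<open>\<sigma>\<close>, which
  is \<open>d\<sigma>\<close>.\<close>

lemma two_form_variation:
  assumes \<sigma>: "\<And>a b. smooth_on V (\<lambda>x. \<sigma> x a b)" and bil: "\<And>x. x \<in> V \<Longrightarrow> bilinear (\<sigma> x)"
    and anti: "\<And>x a b. x \<in> V \<Longrightarrow> \<sigma> x a b = - \<sigma> x b a"
    and closed: "\<And>x v. x \<in> V \<Longrightarrow> ext_deriv 2 (\<lambda>x v. \<sigma> x (v 0) (v 1)) x v = (0::real)"
    and y: "y \<in> N"
  shows "((\<lambda>t. \<sigma> (\<Psi> (t, y)) (D\<Psi> (t, y) (0, v 0)) (D\<Psi> (t, y) (0, v 1))) has_vector_derivative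
    ext_deriv 1 (\<lambda>z w. \<sigma> (\<phi> z) (\<zeta> z) (frechet_derivative \<phi> (at z) (w 0))) y v) (at 0)"
proof -
  let ?D = "\<lambda>z. frechet_derivative \<phi> (at z)" and ?Z = "frechet_derivative \<zeta> (at y)"
  define S where "S u a b = frechet_derivative (\<lambda>x. \<sigma> x a b) (at (\<phi> y)) u" for u a b
  have x: "\<phi> y \<in> V" using \<phi>_V y by auto
  note O = N_O[OF y]
  have S_anti: "S u a b = - S u b a" for u a b
  proof -
    have "((\<lambda>x. - \<sigma> x b a) has_derivative (\<lambda>u. - S u b a)) (at (\<phi> y))"
      unfolding S_def by (rule has_derivative_minus[OF smooth_on_has_derivative[OF \<sigma> x]])
    then have "((\<lambda>x. \<sigma> x a b) has_derivative (\<lambda>u. - S u b a)) (at (\<phi> y))"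
      by (rule has_derivative_transform_within_open[OF _ smooth_on_open[OF \<sigma>] x]) (metis anti)
    then show ?thesis unfolding S_def[of u a b] by (simp add: frechet_derivative_eqI)
  qed
  have cyc: "S a b c - S b a c + S c a b = 0" for a b c
    using closed[OF x, of "case_nat a (case_nat b (\<lambda>_. c))"]
    by (simp add: ext_deriv_def S_def numeral_2_eq_2)
  have "((\<lambda>p. \<sigma> (\<Psi> p) (D\<Psi> p (0, v 0)) (D\<Psi> p (0, v 1))) has_derivative
    (\<lambda>h. frechet_derivative (\<lambda>x. \<sigma> x (D\<Psi> (0, y) (0, v 0)) (D\<Psi> (0, y) (0, v 1))) (at (\<Psi> (0, y))) (D\<Psi> (0, y) h) +
      \<sigma> (\<Psi> (0, y)) (frechet_derivative (\<lambda>p. D\<Psi> p (0, v 0)) (at (0, y)) h) (D\<Psi> (0, y) (0, v 1)) +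
      \<sigma> (\<Psi> (0, y)) (D\<Psi> (0, y) (0, v 0)) (frechet_derivative (\<lambda>p. D\<Psi> p (0, v 1)) (at (0, y)) h))) (at (0, y))"
    by (rule has_derivative_bilinear_along[OF \<sigma> bil smooth_on_open[OF \<Psi>] O _ smooth_on_has_derivative[OF \<Psi> O]
        smooth_on_has_derivative[OF smooth_on_frechet_derivative[OF \<Psi>] O]
        smooth_on_has_derivative[OF smooth_on_frechet_derivative[OF \<Psi>] O]]) (auto simp: \<Psi>_V)
  from time_derivative[OF this]
  have time: "((\<lambda>t. \<sigma> (\<Psi> (t, y)) (D\<Psi> (t, y) (0, v 0)) (D\<Psi> (t, y) (0, v 1))) has_vector_derivative
      S (\<zeta> y) (?D y (v 0)) (?D y (v 1)) + \<sigma> (\<phi> y) (?Z (v 0)) (?D y (v 1)) + \<sigma> (\<phi> y) (?D y (v 0)) (?Z (v 1))) (at 0)"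
    unfolding S_def D\<phi>[OF y] D\<zeta>[OF y] \<phi>_eq[OF y] \<zeta>_eq[OF y] .
  define B where "B a b = frechet_derivative (\<lambda>z. ?D z a) (at y) b" for a b
  have B: "B a b = B b a" for a b
    unfolding B_def by (rule second_derivative_symmetric[OF \<phi>_smooth y])
  have space: "((\<lambda>z. \<sigma> (\<phi> z) (\<zeta> z) (?D z a)) has_derivative
    (\<lambda>h. S (?D y h) (\<zeta> y) (?D y a) + \<sigma> (\<phi> y) (?Z h) (?D y a) + \<sigma> (\<phi> y) (\<zeta> y) (B a h))) (at y)" for a
    unfolding S_def B_def
    by (rule has_derivative_bilinear_along[OF \<sigma> bil N y \<phi>_V smooth_on_has_derivative[OF \<phi>_smooth y]
        smooth_on_has_derivative[OF \<zeta>_smooth y]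
        smooth_on_has_derivative[OF smooth_on_frechet_derivative[OF \<phi>_smooth] y]])
  have "ext_deriv 1 (\<lambda>z w. \<sigma> (\<phi> z) (\<zeta> z) (?D z (w 0))) y v =
     (S (?D y (v 0)) (\<zeta> y) (?D y (v 1)) + \<sigma> (\<phi> y) (?Z (v 0)) (?D y (v 1)) + \<sigma> (\<phi> y) (\<zeta> y) (B (v 1) (v 0)))
     - (S (?D y (v 1)) (\<zeta> y) (?D y (v 0)) + \<sigma> (\<phi> y) (?Z (v 1)) (?D y (v 0)) + \<sigma> (\<phi> y) (\<zeta> y) (B (v 0) (v 1)))"
    by (simp add: ext_deriv_def frechet_derivative_eqI[OF space])
  also have "\<dots> = S (\<zeta> y) (?D y (v 0)) (?D y (v 1)) + \<sigma> (\<phi> y) (?Z (v 0)) (?D y (v 1)) + \<sigma> (\<phi> y) (?D y (v 0)) (?Z (v 1))"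
    using cyc[of "\<zeta> y" "?D y (v 0)" "?D y (v 1)"] S_anti[of "?D y (v 1)" "\<zeta> y" "?D y (v 0)"]
      anti[OF x, of "?Z (v 1)" "?D y (v 0)"] B[of "v 0" "v 1"] S_anti[of "?D y (v 0)" "\<zeta> y" "?D y (v 1)"]
    by simp
  finally show ?thesis using time by simp
qed

end

section \<open>Charts\<close>

lemma chart_simps:
  assumes "is_chart c"
  shows "p \<in> chart_dom c \<Longrightarrow> param c (coord c p) = p"
    and "p \<in> chart_dom c \<Longrightarrow> coord c p \<in> chart_img c"
    and "y \<in> chart_img c \<Longrightarrow> param c y \<in> chart_dom c"
    and "y \<in> chart_img c \<Longrightarrow> coord c (param c y) = y"
  using assms unfolding is_chart_def homeomorphism_def chart_img_def by auto

lemma preimage_chart_iff: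
  assumes "is_chart c"
  shows "y \<in> coord c ` (chart_dom c \<inter> \<Phi> -` chart_dom d) \<longleftrightarrow>
    y \<in> chart_img c \<and> \<Phi> (param c y) \<in> chart_dom d"
  using chart_simps[OF assms] by (auto simp: chart_img_def intro!: image_eqI)

lemma smooth_atlas_chart: "smooth_atlas A \<Longrightarrow> c \<in> A \<Longrightarrow> is_chart c"
  by (simp add: smooth_atlas_def)

lemma chart_around:
  assumes "smooth_atlas A"
  shows "chart_around A p \<in> A" "p \<in> chart_dom (chart_around A p)"
proof -
  have "\<exists>d. d \<in> A \<and> p \<in> chart_dom d" using assms unfolding smooth_atlas_def by blast
  from someI_ex[OF this] show "chart_around A p \<in> A" "p \<in> chart_dom (chart_around A p)"
    by (simp_all add: chart_around_def)
qed

lemma dtrans_has_derivative: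
  assumes "smooth_atlas A" "c \<in> A" "d \<in> A" "p \<in> chart_dom c" "p \<in> chart_dom d"
  shows "(transition c d has_derivative dtrans c d p) (at (coord c p))"
  unfolding dtrans_def
proof (rule smooth_on_has_derivative)
  show "smooth_on (coord c ` (chart_dom c \<inter> chart_dom d)) (transition c d)"
    using assms by (simp add: smooth_atlas_def)
qed (use assms in auto)

lemma dtrans_linear:
  "smooth_atlas A \<Longrightarrow> c \<in> A \<Longrightarrow> d \<in> A \<Longrightarrow> p \<in> chart_dom c \<Longrightarrow> p \<in> chart_dom d \<Longrightarrow> linear (dtrans c d p)"
  using dtrans_has_derivative has_derivative_linear by blast

lemma has_derivative_chart_change:
  assumes A: "smooth_atlas A" "d \<in> A" "d' \<in> A"
    and N: "open N" "z \<in> N" "\<And>x. x \<in> N \<Longrightarrow> P x \<in> chart_dom d"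
    and z: "P z \<in> chart_dom d'"
    and D: "((\<lambda>x. coord d (P x)) has_derivative D) (at z)"
  shows "((\<lambda>x. coord d' (P x)) has_derivative (\<lambda>h. dtrans d d' (P z) (D h))) (at z)"
proof -
  have "((\<lambda>x. transition d d' (coord d (P x))) has_derivative (\<lambda>h. dtrans d d' (P z) (D h))) (at z)"
    by (rule has_derivative_compose[where g = "transition d d'", OF D dtrans_has_derivative[OF A N(3)[OF N(2)] z]])
  then show ?thesis
    by (rule has_derivative_transform_within_open[OF _ N(1,2)])
      (simp add: transition_def chart_simps[OF smooth_atlas_chart[OF A(1,2)]] N(3))
qed

lemma smooth_on_chart_change:
  assumes A: "smooth_atlas A" "d \<in> A" "d' \<in> A"
    and P: "\<And>x. x \<in> N \<Longrightarrow> P x \<in> chart_dom d" "\<And>x. x \<in> N \<Longrightarrow> P x \<in> chart_dom d'"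
    and D: "smooth_on N (\<lambda>x. coord d (P x))"
  shows "smooth_on N (\<lambda>x. coord d' (P x))"
proof -
  have "smooth_on (coord d ` (chart_dom d \<inter> chart_dom d')) (transition d d')"
    using A by (simp add: smooth_atlas_def)
  then have "smooth_on N (\<lambda>x. transition d d' (coord d (P x)))"
    by (rule smooth_on_compose[OF _ D]) (use P in auto)
  then show ?thesis
    by (rule smooth_on_cong) (simp add: transition_def chart_simps[OF smooth_atlas_chart[OF A(1,2)]] P)
qed

lemma dtrans_inverse:
  assumes A: "smooth_atlas A" "d \<in> A" "d' \<in> A" and p: "p \<in> chart_dom d" "p \<in> chart_dom d'"
  shows "dtrans d' d p (dtrans d d' p v) = v"
proof -
  have d: "is_chart d" using smooth_atlas_chart A by blast
  note s = chart_simps[OF d]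
  have "smooth_on (coord d ` (chart_dom d \<inter> chart_dom d')) (transition d d')"
    using A by (simp add: smooth_atlas_def)
  note N = smooth_on_open[OF this]
  have "((\<lambda>x. coord d (param d x)) has_derivative (\<lambda>h. dtrans d' d (param d (coord d p)) (dtrans d d' p h))) (at (coord d p))"
  proof (rule has_derivative_chart_change[where d = d' and d' = d and P = "param d", OF A(1,3,2) N])
    show "((\<lambda>x. coord d' (param d x)) has_derivative dtrans d d' p) (at (coord d p))"
      using dtrans_has_derivative[OF A p] by (simp add: transition_def o_def)
  qed (use p s in auto)
  moreover have "((\<lambda>x. coord d (param d x)) has_derivative (\<lambda>h. h)) (at (coord d p))"
    by (rule has_derivative_transform_within_open[OF has_derivative_ident N]) (use p s in auto)
  ultimately have "(\<lambda>h. dtrans d' d (param d (coord d p)) (dtrans d d' p h)) = (\<lambda>h. h)"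
    by (rule has_derivative_unique)
  from fun_cong[OF this, of v] show ?thesis using s(1)[OF p(1)] by simp
qed

definition chart_invariant :: "('p, 'e::euclidean_space) chart set \<Rightarrow> ('p, 'e, 'b) form \<Rightarrow> bool" where
  "chart_invariant A \<alpha> \<longleftrightarrow> (\<forall>d\<in>A. \<forall>d'\<in>A. \<forall>p\<in>chart_dom d \<inter> chart_dom d'. \<forall>v.
     \<alpha> d (coord d p) v = \<alpha> d' (coord d' p) (\<lambda>i. dtrans d d' p (v i)))"

lemma immersion_smooth:
  "immersion B A \<Phi> \<Longrightarrow> c \<in> B \<Longrightarrow> d \<in> A \<Longrightarrow>
    smooth_on (coord c ` (chart_dom c \<inter> \<Phi> -` chart_dom d)) (local_map c d \<Phi>)"
  by (simp add: immersion_def)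

lemma local_map_eq: "local_map c d \<Phi> = (\<lambda>y. coord d (\<Phi> (param c y)))"
  by (simp add: local_map_def fun_eq_iff)

lemma frechet_local_map_change:
  assumes A: "smooth_atlas A" "d \<in> A" "d' \<in> A" and B: "smooth_atlas B" "c \<in> B" and \<Phi>: "immersion B A \<Phi>"
    and y: "y \<in> chart_img c" "\<Phi> (param c y) \<in> chart_dom d" "\<Phi> (param c y) \<in> chart_dom d'"
  shows "frechet_derivative (local_map c d' \<Phi>) (at y) v =
    dtrans d d' (\<Phi> (param c y)) (frechet_derivative (local_map c d \<Phi>) (at y) v)"
proof -
  let ?N = "coord c ` (chart_dom c \<inter> \<Phi> -` chart_dom d)"
  have c: "is_chart c" using smooth_atlas_chart B by blast
  note N = immersion_smooth[OF \<Phi> B(2) A(2)]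
  have yN: "y \<in> ?N" using preimage_chart_iff[OF c] y by blast
  have "((\<lambda>x. coord d' (\<Phi> (param c x))) has_derivative
      (\<lambda>h. dtrans d d' (\<Phi> (param c y)) (frechet_derivative (local_map c d \<Phi>) (at y) h))) (at y)"
  proof (rule has_derivative_chart_change[where P = "\<lambda>x. \<Phi> (param c x)",
        OF A smooth_on_open[OF N] yN _ y(3)])
    show "\<Phi> (param c x) \<in> chart_dom d" if "x \<in> ?N" for x
      using that preimage_chart_iff[OF c, of x \<Phi> d] by (simp only:)
    show "((\<lambda>x. coord d (\<Phi> (param c x))) has_derivative frechet_derivative (local_map c d \<Phi>) (at y)) (at y)"
      using smooth_on_has_derivative[OF N yN] by (simp add: local_map_eq)
  qed
  then show ?thesis by (simp add: frechet_derivative_eqI local_map_eq)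
qed

text \<open>The pullback refers to a chosen chart around each image point, which may jump from point to point. For an invariant
  form every fixed chart gives the same value, and in a fixed chart one can differentiate.\<close>

lemma pullback_eq:
  assumes inv: "chart_invariant A \<alpha>" and A: "smooth_atlas A" "d \<in> A" and B: "smooth_atlas B" "c \<in> B"
    and \<Phi>: "immersion B A \<Phi>" and y: "y \<in> chart_img c" "\<Phi> (param c y) \<in> chart_dom d"
  shows "pullback A \<Phi> \<alpha> c y v =
    \<alpha> d (coord d (\<Phi> (param c y))) (\<lambda>i. frechet_derivative (local_map c d \<Phi>) (at y) (v i))"
proof -
  let ?p = "\<Phi> (param c y)"
  let ?d = "chart_around A ?p"
  note ca = chart_around[OF A(1), of ?p]
  have "\<alpha> d (coord d ?p) (\<lambda>i. frechet_derivative (local_map c d \<Phi>) (at y) (v i)) =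
    \<alpha> ?d (coord ?d ?p) (\<lambda>i. dtrans d ?d ?p (frechet_derivative (local_map c d \<Phi>) (at y) (v i)))"
    using inv A(2) ca y unfolding chart_invariant_def by blast
  then show ?thesis
    unfolding pullback_def Let_def frechet_local_map_change[OF A(1,2) ca(1) B \<Phi> y ca(2)] by simp
qed

section \<open>Deformations of special Lagrangian submanifolds\<close>

locale special_lagrangian_field =
  fixes A :: "('p::{t2_space,second_countable_topology}, complex^'m::{finite,linorder}) chart set"
    and g :: "('p, complex^'m::{finite,linorder}) tensor2"
    and f :: "'p \<Rightarrow> real"
    and \<Omega> :: "('p, complex^'m::{finite,linorder}, complex) form"
    and B :: "('l::{t2_space,second_countable_topology}, real^'m::{finite,linorder}) chart set"
    and F :: "'l \<Rightarrow> 'p"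
    and \<theta> :: real
    and \<xi> :: "('l, 'p, complex^'m::{finite,linorder}) field_along"
  assumes soliton: "gradient_steady_soliton A g f"
    and volume: "soliton_volume_form A g f \<Omega>"
    and special_lagrangian: "f_special_lagrangian A g f \<Omega> B F \<theta>"
    and normal: "normal_field A g B F \<xi>"
begin

lemma atlas_A: "smooth_atlas A" and atlas_B: "smooth_atlas B" and immersion_F: "immersion B A F"
  using soliton special_lagrangian
  unfolding gradient_steady_soliton_def kaehler_manifold_def holomorphic_atlas_def
    f_special_lagrangian_def oriented_atlas_def by auto

lemma dtrans_J: "c \<in> A \<Longrightarrow> d \<in> A \<Longrightarrow> p \<in> chart_dom c \<Longrightarrow> p \<in> chart_dom d \<Longrightarrow>
    dtrans c d p (cplx_J v) = cplx_J (dtrans c d p v)"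
  using soliton unfolding gradient_steady_soliton_def kaehler_manifold_def holomorphic_atlas_def by blast

lemma metric_chart:
  assumes "d \<in> A"
  shows "smooth_on (chart_img d) (\<lambda>x. g d x v w)"
    and "x \<in> chart_img d \<Longrightarrow> bilinear (g d x)"
    and "x \<in> chart_img d \<Longrightarrow> g d x v w = g d x w v"
    and "x \<in> chart_img d \<Longrightarrow> v \<noteq> 0 \<Longrightarrow> g d x v v > 0"
    and "x \<in> chart_img d \<Longrightarrow> g d x (cplx_J v) (cplx_J w) = g d x v w"
proof -
  have h: "hermitian_metric A g"
    using soliton by (simp add: gradient_steady_soliton_def kaehler_manifold_def)
  note chart = h[unfolded hermitian_metric_def, THEN conjunct1, rule_format, OF assms]
  show "smooth_on (chart_img d) (\<lambda>x. g d x v w)"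
    using chart[THEN conjunct1] by simp
  assume "x \<in> chart_img d"
  note pt = chart[THEN conjunct2, rule_format, OF this]
  show "bilinear (g d x)" "g d x v w = g d x w v" "g d x (cplx_J v) (cplx_J w) = g d x v w"
    "v \<noteq> 0 \<Longrightarrow> g d x v v > 0"
    using pt by simp_all
qed

lemma metric_change: "d \<in> A \<Longrightarrow> d' \<in> A \<Longrightarrow> p \<in> chart_dom d \<Longrightarrow> p \<in> chart_dom d' \<Longrightarrow>
    g d (coord d p) v w = g d' (coord d' p) (dtrans d d' p v) (dtrans d d' p w)"
  using soliton unfolding gradient_steady_soliton_def kaehler_manifold_def hermitian_metric_def by blast

lemma kaehler_closed: "d \<in> A \<Longrightarrow> x \<in> chart_img d \<Longrightarrow> ext_deriv 2 (kaehler_form g d) x v = 0"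
  using soliton unfolding gradient_steady_soliton_def kaehler_manifold_def by blast

lemma holomorphic: "holomorphic_top_form A \<Omega>"
  using volume by (simp add: soliton_volume_form_def)

lemma \<Omega>_chart:
  assumes "d \<in> A"
  shows "x \<in> chart_img d \<Longrightarrow> form_type_k0 CARD('m) (\<Omega> d x)"
    and "smooth_on (chart_img d) (\<lambda>x. \<Omega> d x v)"
    and "x \<in> chart_img d \<Longrightarrow> frechet_derivative (\<lambda>z. \<Omega> d z v) (at x) (cplx_J u) =
      \<i> * frechet_derivative (\<lambda>z. \<Omega> d z v) (at x) u"
  using holomorphic assms unfolding holomorphic_top_form_def by blast+

lemma invariant_kaehler: "chart_invariant A (kaehler_form g)"
  unfolding chart_invariant_def kaehler_form_def
proof (intro ballI allI)
  fix d d' p v assume "d \<in> A" "d' \<in> A" "p \<in> chart_dom d \<inter> chart_dom d'"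
  then show "g d (coord d p) (cplx_J (v 0)) (v 1) =
      g d' (coord d' p) (cplx_J (dtrans d d' p (v 0))) (dtrans d d' p (v 1))"
    using metric_change[of d d' p "cplx_J (v 0)" "v 1"] dtrans_J[of d d' p "v 0"] by simp
qed

lemma invariant_metric: "chart_invariant A (\<lambda>d x v. g d x (v 0) (v 1))"
  unfolding chart_invariant_def
proof (intro ballI allI)
  fix d d' p v assume "d \<in> A" "d' \<in> A" "p \<in> chart_dom d \<inter> chart_dom d'"
  then show "g d (coord d p) (v 0) (v 1) = g d' (coord d' p) (dtrans d d' p (v 0)) (dtrans d d' p (v 1))"
    using metric_change[of d d' p "v 0" "v 1"] by simp
qed

lemma invariant_\<Omega>: "chart_invariant A \<Omega>"
  using holomorphic unfolding chart_invariant_def holomorphic_top_form_def by blast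

lemma invariant_phase: "chart_invariant A (Re_phase \<theta> \<Omega>)" "chart_invariant A (Im_phase \<theta> \<Omega>)"
proof -
  have \<Omega>: "\<Omega> d (coord d p) v = \<Omega> d' (coord d' p) (\<lambda>i. dtrans d d' p (v i))"
    if "d \<in> A" "d' \<in> A" "p \<in> chart_dom d \<inter> chart_dom d'" for d d' p v
    using invariant_\<Omega> that unfolding chart_invariant_def by blast
  show "chart_invariant A (Re_phase \<theta> \<Omega>)" "chart_invariant A (Im_phase \<theta> \<Omega>)"
    unfolding chart_invariant_def Re_phase_def Im_phase_def
    by (intro ballI allI arg_cong[where f = Re] arg_cong[where f = Im] arg_cong2[where f = "(*)"] refl \<Omega>;
        assumption)+
qed

definition phase :: complex where "phase = exp (- \<i> * of_real \<theta>)"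

lemma norm_phase: "cmod phase = 1"
  by (simp add: phase_def)

text \<open>All fields are now expressed in a chart \<open>c\<close> of the submanifold and a chart \<open>d\<close> of the ambient
  manifold.\<close>

context
  fixes c :: "('l, real^'m::{finite,linorder}) chart" and d :: "('p, complex^'m::{finite,linorder}) chart"
  assumes c: "c \<in> B" and d: "d \<in> A"
begin

definition N :: "(real^'m::{finite,linorder}) set" where
  "N = coord c ` (chart_dom c \<inter> F -` chart_dom d)"

definition V :: "(complex^'m::{finite,linorder}) set" where "V = chart_img d"

definition \<phi> :: "real^'m::{finite,linorder} \<Rightarrow> complex^'m::{finite,linorder}" where
  "\<phi> = local_map c d F"

definition \<zeta> :: "real^'m::{finite,linorder} \<Rightarrow> complex^'m::{finite,linorder}" where
  "\<zeta> z = \<xi> d (param c z)"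

definition \<kappa> :: "complex^'m::{finite,linorder} \<Rightarrow> complex" where "\<kappa> x = \<Omega> d x axis_seq"

definition \<sigma> :: "complex^'m::{finite,linorder} \<Rightarrow> complex^'m::{finite,linorder} \<Rightarrow>
    complex^'m::{finite,linorder} \<Rightarrow> real" where
  "\<sigma> x a b = g d x (cplx_J a) b"

definition u :: "real^'m::{finite,linorder} \<Rightarrow> real" where "u = f \<circ> F \<circ> param c"

abbreviation "D z \<equiv> frechet_derivative \<phi> (at z)"

lemma chart_c: "is_chart c" and chart_d: "is_chart d"
  using smooth_atlas_chart atlas_A atlas_B c d by blast+

lemma N_iff: "z \<in> N \<longleftrightarrow> z \<in> chart_img c \<and> F (param c z) \<in> chart_dom d"
  unfolding N_def by (rule preimage_chart_iff[OF chart_c])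

lemma \<phi>_smooth: "smooth_on N \<phi>"
  unfolding N_def \<phi>_def by (rule immersion_smooth[OF immersion_F c d])

lemmas N_open = smooth_on_open[OF \<phi>_smooth]

lemma D_linear: "z \<in> N \<Longrightarrow> linear (D z)"
  using smooth_on_has_derivative[OF \<phi>_smooth] has_derivative_linear by blast

lemma D_inj: "z \<in> N \<Longrightarrow> inj (D z)"
  using immersion_F c d unfolding immersion_def N_def \<phi>_def by blast

lemma \<phi>_V: "z \<in> N \<Longrightarrow> \<phi> z \<in> V"
  using N_iff chart_simps(2)[OF chart_d] by (auto simp: \<phi>_def V_def local_map_eq)

lemma \<zeta>_smooth: "smooth_on N \<zeta>"
  using normal c d unfolding normal_field_def N_def \<zeta>_def by blast

lemma \<zeta>_normal:
  assumes "z \<in> N"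
  shows "g d (\<phi> z) (\<zeta> z) (D z w) = 0"
  using normal c d assms unfolding normal_field_def N_def \<zeta>_def \<phi>_def local_map_eq by blast

lemma \<kappa>_smooth: "smooth_on V \<kappa>"
  unfolding V_def \<kappa>_def by (rule \<Omega>_chart(2)[OF d])

lemma \<kappa>_holomorphic: "x \<in> V \<Longrightarrow>
    frechet_derivative \<kappa> (at x) (cplx_J v) = \<i> * frechet_derivative \<kappa> (at x) v"
  using \<Omega>_chart(3)[OF d, of x axis_seq v] by (simp add: V_def \<kappa>_def[abs_def])

lemma \<Omega>_eq: "x \<in> V \<Longrightarrow> \<Omega> d x v = \<kappa> x * det (frame_matrix v)"
  unfolding \<kappa>_def V_def by (rule form_type_k0_top[OF \<Omega>_chart(1)[OF d]])

lemma param_\<phi>: "z \<in> N \<Longrightarrow> param d (\<phi> z) = F (param c z)"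
  using N_iff chart_simps(1)[OF chart_d] by (auto simp: \<phi>_def local_map_eq)

lemma u_smooth: "smooth_on N u"
proof -
  have "smooth_on V (f \<circ> param d)"
    using soliton d unfolding gradient_steady_soliton_def smooth_function_def V_def by blast
  then have "smooth_on N (\<lambda>z. (f \<circ> param d) (\<phi> z))"
    by (rule smooth_on_compose[OF _ \<phi>_smooth]) (use \<phi>_V in auto)
  then show ?thesis
    by (rule smooth_on_cong) (simp add: u_def param_\<phi>)
qed

lemma induced_metric_eq:
  assumes "z \<in> N"
  shows "induced_metric A g F c z = (\<lambda>v w. g d (\<phi> z) (D z v) (D z w))"
proof (intro ext)
  fix v w
  have "induced_metric A g F c z v w = pullback A F (\<lambda>d x v. g d x (v 0) (v 1)) c z (case_nat v (\<lambda>_. w))"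
    by (simp add: induced_metric_def pullback_def Let_def)
  also have "\<dots> = g d (\<phi> z) (D z v) (D z w)"
    using assms pullback_eq[OF invariant_metric atlas_A d atlas_B c immersion_F, of z "case_nat v (\<lambda>_. w)"]
    by (simp add: N_iff \<phi>_def local_map_eq)
  finally show "induced_metric A g F c z v w = g d (\<phi> z) (D z v) (D z w)" .
qed

lemma omega_tilde_eq:
  assumes "z \<in> N"
  shows "omega_tilde A g F \<xi> c z w = \<sigma> (\<phi> z) (\<zeta> z) (D z (w 0))"
proof -
  let ?p = "F (param c z)"
  let ?d = "chart_around A ?p"
  note ca = chart_around[OF atlas_A, of ?p]
  have z: "z \<in> chart_img c" "?p \<in> chart_dom d" using assms N_iff by auto
  have \<xi>: "\<xi> ?d (param c z) = dtrans d ?d ?p (\<zeta> z)"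
    using normal d ca z unfolding normal_field_def \<zeta>_def by blast
  have D: "frechet_derivative (local_map c ?d F) (at z) v = dtrans d ?d ?p (D z v)" for v
    unfolding \<phi>_def by (rule frechet_local_map_change[OF atlas_A d ca(1) atlas_B c immersion_F z ca(2)])
  show ?thesis
    unfolding omega_tilde_def pullback_interior_def Let_def interior_product_def kaehler_form_def D \<xi> \<sigma>_def
    using metric_change[OF d ca(1) z(2) ca(2), of "cplx_J (\<zeta> z)" "D z (w 0)"] dtrans_J[OF d ca(1) z(2) ca(2), of "\<zeta> z"]
    by (simp add: \<phi>_def local_map_eq)
qed

lemma calibrated_plane_at:
  assumes z: "z \<in> N"
  shows "calibrated_plane (g d (\<phi> z)) (\<Omega> d (\<phi> z)) (exp (- u z)) (D z) phase"
proof -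
  have x: "\<phi> z \<in> chart_img d" using \<phi>_V[OF z] by (simp add: V_def)
  have pd: "f (param d (\<phi> z)) = u z" using param_\<phi>[OF z] by (simp add: u_def)
  show ?thesis
  proof (intro calibrated_plane.intro hermitian_volume.intro calibrated_plane_axioms.intro)
    show "bilinear (g d (\<phi> z))" by (rule metric_chart(2)[OF d x])
    show "g d (\<phi> z) a b = g d (\<phi> z) b a" for a b by (rule metric_chart(3)[OF d x])
    show "a \<noteq> 0 \<Longrightarrow> g d (\<phi> z) a a > 0" for a by (rule metric_chart(4)[OF d x])
    show "g d (\<phi> z) (cplx_J a) (cplx_J b) = g d (\<phi> z) a b" for a b by (rule metric_chart(5)[OF d x])
    show "form_type_k0 CARD('m) (\<Omega> d (\<phi> z))" by (rule \<Omega>_chart(1)[OF d x])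
    show "exp (- u z) > 0" by simp
    show "linear (D z)" by (rule D_linear[OF z])
    show "inj (D z)" by (rule D_inj[OF z])
    show "cmod phase = 1" by (rule norm_phase)
    show "\<exists>v. \<Omega> d (\<phi> z) v \<noteq> 0"
      using volume d x unfolding soliton_volume_form_def by blast
    show "complex_of_real (exp (- u z) * wedge_power CARD('m) (\<lambda>v. g d (\<phi> z) (cplx_J (v 0)) (v 1)) v / fact CARD('m)) =
      (-1) ^ (CARD('m) * (CARD('m) - 1) div 2) * (\<i> / 2) ^ CARD('m) *
      wedge CARD('m) CARD('m) (\<Omega> d (\<phi> z)) (\<lambda>w. cnj (\<Omega> d (\<phi> z) w)) v" for v
    proof -
      have k: "kaehler_form g d (\<phi> z) = (\<lambda>v. g d (\<phi> z) (cplx_J (v 0)) (v 1))"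
        by (simp add: kaehler_form_def fun_eq_iff)
      have "(\<exists>v. \<Omega> d (\<phi> z) v \<noteq> 0) \<and> (\<forall>v. complex_of_real (exp (- f (param d (\<phi> z))) *
          wedge_power CARD('m) (kaehler_form g d (\<phi> z)) v / fact CARD('m)) =
        (-1) ^ (CARD('m) * (CARD('m) - 1) div 2) * (\<i> / 2) ^ CARD('m) *
        wedge CARD('m) CARD('m) (\<Omega> d (\<phi> z)) (\<lambda>w. cnj (\<Omega> d (\<phi> z) w)) v)"
        using volume d x unfolding soliton_volume_form_def by blast
      then show ?thesis unfolding k pd by (rule conjunct2[THEN spec])
    qed
    fix v
    have zc: "z \<in> chart_img c" "F (param c z) \<in> chart_dom d" using z N_iff by auto
    have "Re (phase * \<Omega> d (\<phi> z) (\<lambda>i. D z (v i))) = pullback A F (Re_phase \<theta> \<Omega>) c z v"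
      unfolding pullback_eq[OF invariant_phase(1) atlas_A d atlas_B c immersion_F zc]
      by (simp add: Re_phase_def phase_def \<phi>_def local_map_eq)
    also have "\<dots> = exp (- f (F (param c z)) / 2) * volume_form (induced_metric A g F c) z v"
      using special_lagrangian c zc(1) unfolding f_special_lagrangian_def by blast
    also have "exp (- f (F (param c z)) / 2) = sqrt (exp (- u z))"
    proof -
      have "exp (- u z) = (exp (- f (F (param c z)) / 2))\<^sup>2"
        by (simp add: u_def power2_eq_square exp_add[symmetric])
      then show ?thesis by simp
    qed
    also have "volume_form (induced_metric A g F c) z v =
      volume_form (\<lambda>_ v w. g d (\<phi> z) (D z v) (D z w)) (0 :: real^'m::{finite,linorder}) v"
      by (simp add: volume_form_def induced_metric_eq[OF z])
    finally show "Re (phase * \<Omega> d (\<phi> z) (\<lambda>i. D z (v i))) = sqrt (exp (- u z)) *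
      volume_form (\<lambda>_ v w. g d (\<phi> z) (D z v) (D z w)) (0 :: real^'m::{finite,linorder}) v" .
  qed
qed

text \<open>The pullback of \<open>\<iota>\<^sub>\<xi> \<Omega>\<close>, and its imaginary part after division by the phase: the latter is the
  weighted Hodge star of \<open>\<omega>(\<xi>)\<close> up to the sign.\<close>

definition \<beta> :: "real^'m::{finite,linorder} \<Rightarrow> (nat \<Rightarrow> real^'m::{finite,linorder}) \<Rightarrow> complex" where
  "\<beta> z w = \<kappa> (\<phi> z) * det (frame_matrix (case_nat (\<zeta> z) (\<lambda>i. D z (w i))))"

definition density :: "real^'m::{finite,linorder} \<Rightarrow> real" where
  "density y = Im (phase * interior_density \<kappa> \<phi> \<zeta> y)"

text \<open>The vector \<open>x\<close> dual to \<open>\<omega>(\<xi>)\<close> links the two: the Hodge star is the interior product of \<open>x\<close> with the volume form, and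
  \<open>\<xi> = - J D\<phi> x\<close>.\<close>

lemma hodge_star_omega_tilde:
  assumes z: "z \<in> N"
  obtains x where "\<And>w. g d (\<phi> z) (D z x) (D z w) = \<sigma> (\<phi> z) (\<zeta> z) (D z w)"
    and "\<And>w. real_metric.vol (\<lambda>v w. g d (\<phi> z) (D z v) (D z w)) (case_nat x w) =
      - exp (u z / 2) * Im (phase * \<beta> z w)"
    and "\<And>w. hodge_star (induced_metric A g F c) 1 (omega_tilde A g F \<xi> c) z w = - exp (u z / 2) * Im (phase * \<beta> z w)"
proof -
  interpret P: calibrated_plane "g d (\<phi> z)" "\<Omega> d (\<phi> z)" "exp (- u z)" "D z" phase
    by (rule calibrated_plane_at[OF z])
  let ?a = "\<lambda>v. P.\<omega> (\<zeta> z) (D z v)"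
  have \<sigma>\<omega>: "\<sigma> (\<phi> z) = P.\<omega>" by (simp add: \<sigma>_def P.\<omega>_def fun_eq_iff)
  have lin_a: "linear ?a"
    by (rule linearI) (simp_all add: P.\<omega>_def linear_add[OF P.lin] linear_scale[OF P.lin] P.G_simps)
  obtain b where "P.tangent.orthonormal b" using P.tangent.orthonormal_exists by blast
  from P.tangent.riesz_orthonormal[OF this lin_a] obtain x
    where x: "\<And>w. g d (\<phi> z) (D z x) (D z w) = ?a w" by blast
  have "Im (phase * \<beta> z w) = - sqrt (exp (- u z)) * P.tangent.vol (case_nat x w)" for w
    using P.Im_interior_normal[OF \<zeta>_normal[OF z] x, of w] \<Omega>_eq[OF \<phi>_V[OF z]] by (simp add: \<beta>_def)
  moreover have "exp (u z / 2) * sqrt (exp (- u z)) = 1"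
  proof -
    have "exp (- u z) = (exp (- u z / 2))\<^sup>2"
      by (simp add: power2_eq_square exp_add[symmetric])
    then show ?thesis by (simp add: exp_add[symmetric])
  qed
  ultimately have vol: "P.tangent.vol (case_nat x w) = - exp (u z / 2) * Im (phase * \<beta> z w)" for w
    by (simp add: mult.assoc[symmetric])
  have "hodge_star (induced_metric A g F c) 1 (omega_tilde A g F \<xi> c) z w = P.tangent.vol (case_nat x w)" for w
    by (rule P.tangent.hodge_star_one[where y = z and g = "induced_metric A g F c", OF induced_metric_eq[OF z] lin_a _ x])
      (simp add: omega_tilde_eq[OF z] \<sigma>\<omega>)
  then have hs: "hodge_star (induced_metric A g F c) 1 (omega_tilde A g F \<xi> c) z w =
      - exp (u z / 2) * Im (phase * \<beta> z w)" for w
    by (simp only: vol)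
  show ?thesis
  proof (rule that[of x])
    show "g d (\<phi> z) (D z x) (D z w) = \<sigma> (\<phi> z) (\<zeta> z) (D z w)" for w
      unfolding \<sigma>\<omega> by (rule x)
  qed (fact vol hs)+
qed

text \<open>The terms with the derivative of \<open>f\<close> cancel, because the weighted codifferential is the
  codifferential for the weight \<open>e\<^bsup>-f/2\<^esup>\<close>.\<close>

lemma codiff_weighted_eq:
  assumes y: "y \<in> N"
  shows "codiff_weighted (induced_metric A g F c) u 1 (omega_tilde A g F \<xi> c) y w =
    exp (u y / 2) * density y / sqrt (real_metric.gram (\<lambda>v w. g d (\<phi> y) (D y v) (D y w)))"
proof -
  interpret P: calibrated_plane "g d (\<phi> y)" "\<Omega> d (\<phi> y)" "exp (- u y)" "D y" phase
    by (rule calibrated_plane_at[OF y])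
  let ?g = "induced_metric A g F c" and ?\<alpha> = "omega_tilde A g F \<xi> c" and ?m = "CARD('m)"
  let ?Du = "frechet_derivative u (at y)"
  note gy = induced_metric_eq[OF y]
  have Du: "(u has_derivative ?Du) (at y)" by (rule smooth_on_has_derivative[OF u_smooth y])
  then have lin_Du: "linear ?Du" by (rule has_derivative_linear)
  obtain x where x: "\<And>w. g d (\<phi> y) (D y x) (D y w) = \<sigma> (\<phi> y) (\<zeta> y) (D y w)"
    and vol: "\<And>w. P.tangent.vol (case_nat x w) = - exp (u y / 2) * Im (phase * \<beta> y w)"
    using hodge_star_omega_tilde[OF y] by metis
  have ext: "ext_deriv (?m - 1) (hodge_star ?g 1 ?\<alpha>) y v =
      (- exp (u y / 2) * density y + 1 / 2 * (sqrt P.tangent.gram * ?Du x)) * det (frame_matrix v)" for v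
  proof -
    let ?v = "\<lambda>i j. v (if j < i then j else Suc j)"
    have idx: "{..?m - 1} = {..<?m}"
      by (metis One_nat_def Suc_pred lessThan_Suc_atMost zero_less_card_finite)
    have "\<phi> ` N \<subseteq> V" using \<phi>_V by auto
    note top = ext_deriv_interior_top[OF \<kappa>_smooth \<kappa>_holomorphic \<phi>_smooth this \<zeta>_smooth y, folded \<beta>_def]
    define E where "E i = frechet_derivative (\<lambda>z. \<beta> z (?v i)) (at y)" for i
    have E: "((\<lambda>z. \<beta> z (?v i)) has_derivative E i) (at y)" if "i < ?m" for i
    proof -
      have "(\<lambda>z. \<beta> z (?v i)) differentiable (at y)" by (rule top(2)[OF _ that])
      then show ?thesis unfolding E_def by (simp only: frechet_derivative_works)
    qed
    have d: "((\<lambda>z. - exp (u z / 2) * Im (phase * \<beta> z (?v i))) has_derivative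
        (\<lambda>h. - exp (u y / 2) * Im (phase * E i h) + - (exp (u y / 2) * (?Du h / 2)) * Im (phase * \<beta> y (?v i)))) (at y)"
      if "i < ?m" for i
      by (rule has_derivative_mult)
        (auto intro!: derivative_eq_intros Du E[OF that] bounded_linear.has_derivative[OF bounded_linear_Im])
    have "ext_deriv (?m - 1) (hodge_star ?g 1 ?\<alpha>) y v =
        ext_deriv (?m - 1) (\<lambda>z w. - exp (u z / 2) * Im (phase * \<beta> z w)) y v"
      by (rule ext_deriv_cong[OF N_open y]) (metis hodge_star_omega_tilde)
    also have "\<dots> = (\<Sum>i<?m. (-1) ^ i * (- exp (u y / 2) * Im (phase * E i (v i)) +
        - (exp (u y / 2) * (?Du (v i) / 2)) * Im (phase * \<beta> y (?v i))))"
      unfolding ext_deriv_def idx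
      by (intro sum.cong refl arg_cong2[where f = "(*)"]) (simp only: frechet_derivative_eqI[OF d] lessThan_iff)
    also have "\<dots> = - exp (u y / 2) * Im (phase * (\<Sum>i<?m. (-1) ^ i * E i (v i))) +
       1 / 2 * (\<Sum>i<?m. ?Du (v i) * ((-1) ^ i * (- exp (u y / 2) * Im (phase * \<beta> y (?v i)))))"
    proof -
      have "Im (phase * (\<Sum>i<?m. (-1) ^ i * E i (v i))) = (\<Sum>i<?m. (-1) ^ i * Im (phase * E i (v i)))"
      proof -
        have "Im (phase * ((-1) ^ i * E i (v i))) = (-1) ^ i * Im (phase * E i (v i))" for i
          by (cases "even i") auto
        then show ?thesis by (simp only: sum_distrib_left Im_sum)
      qed
      then show ?thesis
        by (simp only: sum_distrib_left sum.distrib[symmetric]) (rule sum.cong[OF refl], simp add: algebra_simps)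
    qed
    \<comment> \<open>the first sum is the exterior derivative of \<open>\<beta>\<close>; the second one is evaluated by Cramer's rule\<close>
  also have "(\<Sum>i<?m. (-1) ^ i * E i (v i)) = ext_deriv (?m - 1) \<beta> y v"
      unfolding ext_deriv_def idx E_def ..
    also have "ext_deriv (?m - 1) \<beta> y v = interior_density \<kappa> \<phi> \<zeta> y * of_real (det (frame_matrix v))"
      by (rule top(1))
    also have "(\<Sum>i<?m. ?Du (v i) * ((-1) ^ i * (- exp (u y / 2) * Im (phase * \<beta> y (?v i))))) =
      (\<Sum>i<?m. ?Du (v i) * (sqrt P.tangent.gram * det (frame_matrix (v(i := x)))))"
    proof (rule sum.cong[OF refl], rule arg_cong2[where f = "(*)"], rule refl)
      fix i assume "i \<in> {..<?m}"
      then show "(-1) ^ i * (- exp (u y / 2) * Im (phase * \<beta> y (?v i))) =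
          sqrt P.tangent.gram * det (frame_matrix (v(i := x)))"
        unfolding vol[symmetric] P.tangent.vol_def using det_frame_front[of i x v]
        by (simp add: mult.left_commute mult.assoc[symmetric] power_mult_distrib[symmetric] del: fun_upd_apply)
    qed
    also have "\<dots> = sqrt P.tangent.gram * ?Du (\<Sum>i<?m. det (frame_matrix (v(i := x))) *\<^sub>R v i)"
      by (simp only: linear_sum[OF lin_Du] linear_scale[OF lin_Du] sum_distrib_left real_scaleR_def)
        (rule sum.cong[OF refl], simp only: mult_ac)
    also have "(\<Sum>i<?m. det (frame_matrix (v(i := x))) *\<^sub>R v i) = det (frame_matrix v) *\<^sub>R x"
      using cramer_frame[of v x] by (simp only: scalar_mult_eq_scaleR)
    finally show ?thesis
      by (simp add: linear_scale[OF lin_Du] density_def mult.assoc[symmetric]) (simp add: algebra_simps)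
  qed
  have grad: "?\<alpha> y (case_nat (gradient ?g u y) w) = ?Du x"
  proof -
    have "?\<alpha> y (case_nat (gradient ?g u y) w) = g d (\<phi> y) (D y x) (D y (gradient ?g u y))"
      by (simp add: omega_tilde_eq[OF y] x)
    also have "\<dots> = g d (\<phi> y) (D y (gradient ?g u y)) (D y x)" by (rule P.sym)
    also have "\<dots> = ?Du x"
      unfolding gradient_def by (rule P.tangent.sharp_eq[where g = ?g, OF gy lin_Du])
    finally show ?thesis .
  qed
  have m: "?m - 1 + 1 = ?m" by simp
  have "codiff ?g 1 ?\<alpha> y w = - ((- exp (u y / 2) * density y + 1 / 2 * (sqrt P.tangent.gram * ?Du x)) / sqrt P.tangent.gram)"
    unfolding codiff_def m
    by (subst P.tangent.hodge_star_top[where g = ?g and y = y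
          and \<beta> = "ext_deriv (?m - 1) (hodge_star ?g 1 ?\<alpha>)", OF gy ext])
      (simp add: diff_divide_distrib)
  then show ?thesis
    unfolding codiff_weighted_def interior_product_def grad
    using P.tangent.gram_pos by (simp add: field_simps)
qed

text \<open>In one pair of charts the pullbacks are those of fixed forms under a smooth family of maps, and the
  coordinate formulas for their first variation apply.\<close>

lemma first_variation:
  assumes fam: "smooth_immersion_family B A \<epsilon> \<Phi>" and \<Phi>0: "\<Phi> 0 = F"
    and vel: "\<And>d q. d \<in> A \<Longrightarrow> F q \<in> chart_dom d \<Longrightarrow>
      ((\<lambda>t. coord d (\<Phi> t q)) has_vector_derivative \<xi> d q) (at 0)"
    and y: "y \<in> N"
  shows "((\<lambda>t. pullback A (\<Phi> t) (kaehler_form g) c y v) has_real_derivative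
      ext_deriv 1 (omega_tilde A g F \<xi> c) y v) (at 0)"
    and "((\<lambda>t. pullback A (\<Phi> t) (Im_phase \<theta> \<Omega>) c y v) has_real_derivative
      density y * det (frame_matrix v)) (at 0)"
proof -
  define O\<^sub>\<Psi> where "O\<^sub>\<Psi> = {(t, y). t \<in> {-\<epsilon><..<\<epsilon>} \<and> y \<in> chart_img c \<and> \<Phi> t (param c y) \<in> chart_dom d}"
  define \<Psi> where "\<Psi> = (\<lambda>(t, y). local_map c d (\<Phi> t) y)"
  have eps: "\<epsilon> > 0" and \<Psi>: "smooth_on O\<^sub>\<Psi> \<Psi>" and imm: "\<And>t. t \<in> {-\<epsilon><..<\<epsilon>} \<Longrightarrow> immersion B A (\<Phi> t)"
    using fam c d unfolding smooth_immersion_family_def O\<^sub>\<Psi>_def \<Psi>_def by blast+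
  have N_O: "(0, z) \<in> O\<^sub>\<Psi>" if "z \<in> N" for z
    using that eps \<Phi>0 by (auto simp: O\<^sub>\<Psi>_def N_iff)
  have \<Psi>_D: "((\<lambda>t. \<Psi> (t, z)) has_vector_derivative frechet_derivative \<Psi> (at (0, z)) (1, 0)) (at 0)" if "z \<in> N" for z
  proof -
    note d0 = smooth_on_has_derivative[OF \<Psi> N_O[OF that]]
    have "((\<lambda>t. \<Psi> (t, z)) has_derivative (\<lambda>t. frechet_derivative \<Psi> (at (0, z)) (t, 0))) (at 0)"
      by (rule has_derivative_compose[where g = \<Psi> and f = "\<lambda>t. (t, z)", OF _ d0])
        (intro has_derivative_Pair has_derivative_const has_derivative_ident)
    moreover have "(\<lambda>t. frechet_derivative \<Psi> (at (0, z)) (t, 0)) =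
      (\<lambda>t. t *\<^sub>R frechet_derivative \<Psi> (at (0, z)) (1, 0))"
    proof
      fix t
      show "frechet_derivative \<Psi> (at (0, z)) (t, 0) = t *\<^sub>R frechet_derivative \<Psi> (at (0, z)) (1, 0)"
        using linear_scale[OF has_derivative_linear[OF d0], of t "(1, 0)"] by simp
    qed
    ultimately show ?thesis by (simp only: has_vector_derivative_def)
  qed
  interpret lv: local_variation O\<^sub>\<Psi> \<Psi> N \<phi> \<zeta> V
  proof
    show "\<Psi> p \<in> V" if "p \<in> O\<^sub>\<Psi>" for p
      using that chart_simps(2)[OF chart_d] by (auto simp: O\<^sub>\<Psi>_def \<Psi>_def V_def local_map_eq)
    show "\<phi> z = \<Psi> (0, z)" for z by (simp add: \<phi>_def \<Psi>_def \<Phi>0)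
    show "\<zeta> z = frechet_derivative \<Psi> (at (0, z)) (1, 0)" if "z \<in> N" for z
    proof (rule vector_derivative_unique_at[OF _ \<Psi>_D[OF that]])
      show "((\<lambda>t. \<Psi> (t, z)) has_vector_derivative \<zeta> z) (at 0)"
        using vel[OF d, of "param c z"] that by (simp add: \<Psi>_def \<zeta>_def local_map_eq N_iff)
    qed
  qed (use \<Psi> N_open N_O in auto)
  have D\<Psi>: "frechet_derivative (local_map c d (\<Phi> t)) (at y) v = frechet_derivative \<Psi> (at (t, y)) (0, v)"
    if "(t, y) \<in> O\<^sub>\<Psi>" for t v
  proof -
    have "((\<lambda>z. \<Psi> (t, z)) has_derivative (\<lambda>v. frechet_derivative \<Psi> (at (t, y)) (0, v))) (at y)"
      by (rule has_derivative_compose[where g = \<Psi> and f = "\<lambda>z. (t, z)", OF _ smooth_on_has_derivative[OF \<Psi> that]])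
        (intro has_derivative_Pair has_derivative_const has_derivative_ident)
    then show ?thesis by (simp add: \<Psi>_def frechet_derivative_eqI)
  qed
  define T where "T = {t. (t, y) \<in> O\<^sub>\<Psi>}"
  have T: "open T" "0 \<in> T"
  proof -
    have "T = (\<lambda>t. (t, y)) -` O\<^sub>\<Psi>" by (auto simp: T_def)
    then show "open T" using smooth_on_open[OF \<Psi>] by (auto intro!: open_vimage continuous_intros)
    show "0 \<in> T" using N_O[OF y] by (simp add: T_def)
  qed
  have pb: "pullback A (\<Phi> t) \<alpha> c y v = \<alpha> d (\<Psi> (t, y)) (\<lambda>i. frechet_derivative \<Psi> (at (t, y)) (0, v i))"
    if "t \<in> T" "chart_invariant A \<alpha>" for t and \<alpha> :: "('p, complex^'m::{finite,linorder}, real) form"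
  proof -
    have t: "(t, y) \<in> O\<^sub>\<Psi>" using that by (simp add: T_def)
    then have "t \<in> {-\<epsilon><..<\<epsilon>}" "y \<in> chart_img c" "\<Phi> t (param c y) \<in> chart_dom d" by (auto simp: O\<^sub>\<Psi>_def)
    note p = pullback_eq[OF that(2) atlas_A d atlas_B c imm[OF this(1)] this(2,3)]
    have e: "coord d (\<Phi> t (param c y)) = \<Psi> (t, y)" by (simp add: \<Psi>_def local_map_eq)
    show ?thesis using p[of v] unfolding D\<Psi>[OF t] e .
  qed
  have transfer: "((\<lambda>t. pullback A (\<Phi> t) \<alpha> c y v) has_real_derivative r) (at 0)"
    if "((\<lambda>t. \<alpha> d (\<Psi> (t, y)) (\<lambda>i. frechet_derivative \<Psi> (at (t, y)) (0, v i))) has_vector_derivative r) (at 0)"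
      "chart_invariant A \<alpha>" for \<alpha> :: "('p, complex^'m::{finite,linorder}, real) form" and r
    unfolding has_real_derivative_iff_has_vector_derivative
    by (rule has_vector_derivative_transform_within_open[OF that(1) T]) (simp add: pb that(2))
  have "((\<lambda>t. kaehler_form g d (\<Psi> (t, y)) (\<lambda>i. frechet_derivative \<Psi> (at (t, y)) (0, v i))) has_vector_derivative
      ext_deriv 1 (\<lambda>z w. \<sigma> (\<phi> z) (\<zeta> z) (D z (w 0))) y v) (at 0)"
    unfolding kaehler_form_def \<sigma>_def[symmetric]
  proof (rule lv.two_form_variation[OF _ _ _ _ y])
    show "smooth_on V (\<lambda>x. \<sigma> x a b)" for a b
      unfolding \<sigma>_def V_def by (rule metric_chart(1)[OF d])
    fix x assume "x \<in> V"
    then have x: "x \<in> chart_img d" by (simp add: V_def)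
    have "linear (cplx_J :: complex^'m::{finite,linorder} \<Rightarrow> _)"
      by (rule linearI) (simp_all add: cplx_J_def vec_eq_iff algebra_simps)
    then show "bilinear (\<sigma> x)"
      using metric_chart(2)[OF d x] unfolding bilinear_def \<sigma>_def
      by (auto intro: linear_compose[unfolded o_def])
    show "\<sigma> x a b = - \<sigma> x b a" for a b
    proof -
      have J2: "cplx_J (cplx_J a) = - (a :: complex^'m::{finite,linorder})" for a by (simp add: cplx_J_def vec_eq_iff)
      have "g d x (cplx_J a) b = g d x (cplx_J (cplx_J a)) (cplx_J b)" using metric_chart(5)[OF d x] by simp
      also have "\<dots> = - g d x a (cplx_J b)" unfolding J2 by (rule bilinear_lneg[OF metric_chart(2)[OF d x]])
      finally show ?thesis using metric_chart(3)[OF d x] by (simp add: \<sigma>_def)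
    qed
    show "ext_deriv 2 (\<lambda>x v. \<sigma> x (v 0) (v 1)) x v = 0" for v
      using kaehler_closed[OF d x, of v] by (simp add: kaehler_form_def[abs_def] \<sigma>_def)
  qed
  also have "ext_deriv 1 (\<lambda>z w. \<sigma> (\<phi> z) (\<zeta> z) (D z (w 0))) y v = ext_deriv 1 (omega_tilde A g F \<xi> c) y v"
    by (rule ext_deriv_cong[OF N_open y]) (simp add: omega_tilde_eq)
  finally show "((\<lambda>t. pullback A (\<Phi> t) (kaehler_form g) c y v) has_real_derivative
      ext_deriv 1 (omega_tilde A g F \<xi> c) y v) (at 0)"
    by (rule transfer[OF _ invariant_kaehler])
  have "((\<lambda>t. \<kappa> (\<Psi> (t, y)) * det (frame_matrix (\<lambda>i. frechet_derivative \<Psi> (at (t, y)) (0, v i)))) has_vector_derivative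
      interior_density \<kappa> \<phi> \<zeta> y * of_real (det (frame_matrix v))) (at 0)"
    by (rule lv.top_form_variation[OF \<kappa>_smooth y])
  then have "((\<lambda>t. Im (phase * (\<kappa> (\<Psi> (t, y)) * det (frame_matrix (\<lambda>i. frechet_derivative \<Psi> (at (t, y)) (0, v i)))))) has_vector_derivative
      Im (phase * (interior_density \<kappa> \<phi> \<zeta> y * of_real (det (frame_matrix v))))) (at 0)"
    by (intro bounded_linear.has_vector_derivative[OF bounded_linear_Im] has_vector_derivative_mult_right)
  then have "((\<lambda>t. Im_phase \<theta> \<Omega> d (\<Psi> (t, y)) (\<lambda>i. frechet_derivative \<Psi> (at (t, y)) (0, v i))) has_vector_derivative
      Im (phase * (interior_density \<kappa> \<phi> \<zeta> y * of_real (det (frame_matrix v))))) (at 0)"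
    by (rule has_vector_derivative_transform_within_open[OF _ T])
      (simp only: Im_phase_def phase_def \<Omega>_eq[OF lv.\<Psi>_V] T_def mem_Collect_eq)
  from transfer[OF this invariant_phase(2)]
  show "((\<lambda>t. pullback A (\<Phi> t) (Im_phase \<theta> \<Omega>) c y v) has_real_derivative
      density y * det (frame_matrix v)) (at 0)"
    by (simp add: density_def algebra_simps)
qed

end

end

section \<open>Smooth bump functions\<close>

text \<open>The powers of \<open>1/x\<close> are included to make the class of these functions closed under differentiation.\<close>

definition flat :: "nat \<Rightarrow> real \<Rightarrow> real" where
  "flat n x = (if x > 0 then exp (- 1 / x) / x ^ n else 0)"

lemma flat_nonneg: "flat n x \<ge> 0"
  by (simp add: flat_def)

lemma power_le_fact_exp:
  assumes "(x::real) \<ge> 0"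
  shows "x ^ k \<le> fact k * exp x"
proof -
  have "sum (\<lambda>n. x ^ n /\<^sub>R fact n) {k} \<le> (\<Sum>n. x ^ n /\<^sub>R fact n)"
    using assms by (intro sum_le_suminf sums_summable[OF exp_converges]) auto
  then have "x ^ k /\<^sub>R fact k \<le> exp x" by (simp add: exp_def)
  then show ?thesis by (simp add: field_simps)
qed

lemma flat_le: "\<bar>flat n x\<bar> \<le> fact (n + 2) * x\<^sup>2"
proof (cases "x > 0")
  case True
  have "(1 / x) ^ (n + 2) \<le> fact (n + 2) * exp (1 / x)"
    using True by (intro power_le_fact_exp) simp
  then have "exp (- 1 / x) * (1 / x) ^ (n + 2) \<le> exp (- 1 / x) * (fact (n + 2) * exp (1 / x))"
    by (intro mult_left_mono) auto
  also have "\<dots> = fact (n + 2)" by (simp add: exp_minus)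
  finally have "exp (- 1 / x) / x ^ (n + 2) \<le> fact (n + 2)" by (simp add: power_divide)
  then have "flat n x / x\<^sup>2 \<le> fact (n + 2)" using True by (simp only: flat_def power_add if_True divide_divide_eq_left)
  then show ?thesis using True flat_nonneg[of n x] by (simp add: field_simps)
qed (simp add: flat_def)

text \<open>Near \<open>0\<close> the function is bounded by a multiple of \<open>x\<^sup>2\<close>, so that its derivative vanishes there.\<close>

lemma flat_has_derivative: "(flat n has_real_derivative flat (n + 2) x - n * flat (n + 1) x) (at x)"
proof -
  consider "x > 0" | "x < 0" | "x = 0" by linarith
  then show ?thesis
  proof cases
    case 1
    have "((\<lambda>x. exp (- 1 / x) / x ^ n) has_real_derivative
        (exp (- 1 / x) * (1 / x\<^sup>2) * x ^ n - exp (- 1 / x) * (n * x ^ (n - 1))) / (x ^ n * x ^ n)) (at x)"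
      using 1 by (auto intro!: derivative_eq_intros simp: power2_eq_square)
    also have "(exp (- 1 / x) * (1 / x\<^sup>2) * x ^ n - exp (- 1 / x) * (n * x ^ (n - 1))) / (x ^ n * x ^ n) =
        flat (n + 2) x - n * flat (n + 1) x"
      using 1 by (cases n) (simp_all add: flat_def field_simps power2_eq_square)
    finally show ?thesis
      by (rule has_field_derivative_transform_within_open[of _ _ _ "{0<..}"]) (use 1 in \<open>auto simp: flat_def\<close>)
  next
    case 2
    have "((\<lambda>_. 0) has_real_derivative 0) (at x)" by simp
    then have "(flat n has_real_derivative 0) (at x)"
      by (rule has_field_derivative_transform_within_open[of _ _ _ "{..<0}"]) (use 2 in \<open>auto simp: flat_def\<close>)
    then show ?thesis using 2 by (simp add: flat_def)
  next
    case 3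
    have "((\<lambda>h. fact (n + 2) * \<bar>h\<bar>) \<longlongrightarrow> fact (n + 2) * \<bar>0::real\<bar>) (at 0)"
      by (intro tendsto_intros)
    then have lim: "((\<lambda>h. fact (n + 2) * \<bar>h\<bar>) \<longlongrightarrow> (0::real)) (at 0)" by simp
    have "norm ((flat n (0 + h) - flat n 0) / h) \<le> fact (n + 2) * \<bar>h\<bar>" for h :: real
    proof (cases "h = 0")
      case False
      have "\<bar>flat n h\<bar> \<le> (fact (n + 2) * \<bar>h\<bar>) * \<bar>h\<bar>"
        using flat_le[of n h] by (simp only: power2_eq_square mult.assoc abs_mult_self_eq)
      then have "\<bar>flat n h\<bar> / \<bar>h\<bar> \<le> fact (n + 2) * \<bar>h\<bar>"
        using False by (simp only: pos_divide_le_eq zero_less_abs_iff not_False_eq_True)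
      then show ?thesis by (simp only: flat_def[of n 0] real_norm_def abs_divide add_0_left diff_zero less_irrefl if_False)
    qed simp
    then have "((\<lambda>h. (flat n (0 + h) - flat n 0) / h) \<longlongrightarrow> 0) (at 0)"
      by (intro Lim_null_comparison[OF _ lim] always_eventually) auto
    then show ?thesis using 3 by (simp add: DERIV_def flat_def[of _ 0])
  qed
qed

lemma Ck_on_flat: "Ck_on k UNIV (flat n)"
proof (induction k arbitrary: n)
  case 0
  then show ?case
    using DERIV_isCont[OF flat_has_derivative] by (auto intro: continuous_at_imp_continuous_on)
next
  case (Suc k)
  show ?case
  proof (rule Ck_on_SucI)
    show "(flat n has_derivative (\<lambda>v. (flat (n + 2) x - n * flat (n + 1) x) * v)) (at x)" for x
      using flat_has_derivative[of n x] by (simp add: has_field_derivative_def)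
    show "Ck_on k UNIV (\<lambda>x. (flat (n + 2) x - n * flat (n + 1) x) * v)" for v
    proof -
      have "Ck_on k UNIV (\<lambda>x. flat (n + 2) x * v + flat (n + 1) x * (- n * v))"
        by (intro Ck_on_add Ck_on_bounded_linear[where L = "\<lambda>x. x * _", OF bounded_linear_mult_left] Suc.IH open_UNIV)
      then show ?thesis by (simp add: algebra_simps)
    qed
  qed simp
qed

text \<open>Applying the flat function twice gives a smooth step from \<open>1\<close> to \<open>0\<close> without any division.\<close>

definition smooth_step :: "real \<Rightarrow> real" where
  "smooth_step s = exp 1 * flat 0 (1 - exp 1 * flat 0 s)"

lemma smooth_on_smooth_step: "smooth_on UNIV smooth_step"
proof -
  have flat: "smooth_on UNIV (flat 0)" by (simp add: smooth_on_def Ck_on_flat)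
  have "smooth_on UNIV (\<lambda>s. 1 - exp 1 * flat 0 s)"
    by (intro smooth_on_diff smooth_on_mult smooth_on_const flat) auto
  from smooth_on_compose[OF flat this] show ?thesis
    unfolding smooth_step_def[abs_def] by (intro smooth_on_mult smooth_on_const) auto
qed

lemma smooth_step_one: "s \<le> 0 \<Longrightarrow> smooth_step s = 1"
  by (simp add: smooth_step_def flat_def exp_minus)

lemma smooth_step_zero:
  assumes "s \<ge> 1"
  shows "smooth_step s = 0"
proof -
  have "exp (- 1) \<le> exp (- 1 / s)" using assms by (simp add: field_simps)
  then have "exp 1 * exp (- 1) \<le> exp 1 * flat 0 s" using assms by (simp add: flat_def)
  then show ?thesis by (simp add: smooth_step_def flat_def exp_minus)
qed

definition ball_bump :: "'a::euclidean_space \<Rightarrow> real \<Rightarrow> 'a \<Rightarrow> real" where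
  "ball_bump x r y = smooth_step (((y - x) \<bullet> (y - x) - r\<^sup>2) / r\<^sup>2)"

lemma smooth_on_ball_bump: "open S \<Longrightarrow> smooth_on S (ball_bump x r)"
proof -
  assume S: "open S"
  have "smooth_on S (\<lambda>y. ((y - x) \<bullet> (y - x) - r\<^sup>2) * (1 / r\<^sup>2))"
    by (intro smooth_on_mult smooth_on_diff smooth_on_bounded_bilinear[OF bounded_bilinear_inner]
        smooth_on_const smooth_on_ident S)
  then have "smooth_on S (\<lambda>y. smooth_step (((y - x) \<bullet> (y - x) - r\<^sup>2) * (1 / r\<^sup>2)))"
    by (rule smooth_on_compose[OF smooth_on_smooth_step]) auto
  then show ?thesis by (simp add: ball_bump_def[abs_def])
qed

lemma ball_bump_one:
  assumes "r > 0" "dist x y \<le> r"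
  shows "ball_bump x r y = 1"
proof -
  have "(y - x) \<bullet> (y - x) = (dist x y)\<^sup>2"
    by (subst dist_commute) (simp add: dist_norm power2_norm_eq_inner)
  then have "(y - x) \<bullet> (y - x) \<le> r\<^sup>2" using assms by (simp add: power_mono)
  then have "((y - x) \<bullet> (y - x) - r\<^sup>2) / r\<^sup>2 \<le> 0" by (intro divide_nonpos_nonneg) auto
  then show ?thesis unfolding ball_bump_def by (rule smooth_step_one)
qed

lemma ball_bump_zero:
  assumes "r > 0" "dist x y \<ge> 2 * r"
  shows "ball_bump x r y = 0"
proof -
  have "(y - x) \<bullet> (y - x) = (dist x y)\<^sup>2"
    by (subst dist_commute) (simp add: dist_norm power2_norm_eq_inner)
  moreover have "(2 * r)\<^sup>2 \<le> (dist x y)\<^sup>2" using assms by (intro power_mono) auto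
  moreover have "2 * r\<^sup>2 \<le> (2 * r)\<^sup>2" by (simp add: power_mult_distrib)
  ultimately have "2 * r\<^sup>2 \<le> (y - x) \<bullet> (y - x)" by linarith
  then have "1 \<le> ((y - x) \<bullet> (y - x) - r\<^sup>2) / r\<^sup>2"
    using assms(1) by (subst pos_le_divide_eq) auto
  then show ?thesis unfolding ball_bump_def by (rule smooth_step_zero)
qed

lemma smooth_on_sin: "smooth_on UNIV (sin :: real \<Rightarrow> real)"
proof -
  have "Ck_on k UNIV (sin :: real \<Rightarrow> real) \<and> Ck_on k UNIV (cos :: real \<Rightarrow> real)" for k
  proof (induction k)
    case 0
    then show ?case by (auto intro: continuous_intros)
  next
    case (Suc k)
    have "Ck_on (Suc k) UNIV (sin :: real \<Rightarrow> real)"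
      by (rule Ck_on_SucI[where D = "\<lambda>x v. cos x * v"])
        (auto intro!: derivative_eq_intros Ck_on_bounded_linear[where L = "\<lambda>x. x * _", OF bounded_linear_mult_left] conjunct2[OF Suc])
    moreover have "Ck_on (Suc k) UNIV (cos :: real \<Rightarrow> real)"
    proof (rule Ck_on_SucI[where D = "\<lambda>x v. sin x * (- v)"])
      show "(cos has_derivative (\<lambda>v. sin x * (- v))) (at x)" for x :: real
        by (auto intro!: derivative_eq_intros)
      show "Ck_on k UNIV (\<lambda>x::real. sin x * (- v))" for v
        by (rule Ck_on_bounded_linear[where L = "\<lambda>x. x * - v", OF bounded_linear_mult_left open_UNIV conjunct1[OF Suc]])
    qed simp
    ultimately show ?case by simp
  qed
  then show ?thesis by (simp add: smooth_on_def)
qed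

section \<open>Small perturbations over compact sets\<close>

lemma compact_perturbation_in_open:
  fixes \<psi> \<eta> :: "'x::metric_space \<Rightarrow> 'e::real_normed_vector"
  assumes "compact L" "continuous_on L \<psi>" "continuous_on L \<eta>" "open U" "\<psi> ` L \<subseteq> U"
  shows "\<exists>\<delta>>0. \<forall>x\<in>L. \<forall>s. \<bar>s\<bar> \<le> \<delta> \<longrightarrow> \<psi> x + s *\<^sub>R \<eta> x \<in> U"
proof -
  have "compact (\<psi> ` L)" by (rule compact_continuous_image[OF assms(2,1)])
  then obtain e where e: "e > 0" "(\<Union>x\<in>\<psi> ` L. ball x e) \<subseteq> U"
    using compact_subset_open_imp_ball_epsilon_subset[OF _ assms(4,5)] by blast
  have "bounded (\<eta> ` L)" by (intro compact_imp_bounded compact_continuous_image assms)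
  then obtain M where M: "M > 0" "\<And>x. x \<in> L \<Longrightarrow> norm (\<eta> x) \<le> M" by (auto simp: bounded_pos)
  show ?thesis
  proof (intro exI[of _ "e / (2 * M)"] conjI ballI allI impI)
    show "e / (2 * M) > 0" using e M by simp
    fix x s assume x: "x \<in> L" and s: "\<bar>s\<bar> \<le> e / (2 * M)"
    have "norm (s *\<^sub>R \<eta> x) \<le> e / (2 * M) * M"
      unfolding norm_scaleR using s M(2)[OF x] order_trans[OF abs_ge_zero s] by (intro mult_mono) simp_all
    also have "\<dots> < e" using e M by simp
    finally have "\<psi> x + s *\<^sub>R \<eta> x \<in> ball (\<psi> x) e" by (simp add: dist_norm)
    then show "\<psi> x + s *\<^sub>R \<eta> x \<in> U" using e(2) x by blast
  qed
qed

lemma continuous_on_linear_family: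
  fixes D :: "'x::topological_space \<Rightarrow> 'a::euclidean_space \<Rightarrow> 'e::real_normed_vector"
  assumes "\<And>x. x \<in> L \<Longrightarrow> linear (D x)" "\<And>v. continuous_on L (\<lambda>x. D x v)"
  shows "continuous_on (L \<times> S) (\<lambda>(x, v). D x v)"
proof -
  have "continuous_on (L \<times> S) (\<lambda>p. \<Sum>b\<in>Basis. (snd p \<bullet> b) *\<^sub>R D (fst p) b)"
    by (intro continuous_intros continuous_on_compose2[OF assms(2), of _ fst]) auto
  then show ?thesis
    by (rule continuous_on_eq) (auto simp: linear_expand_Basis[OF assms(1), symmetric])
qed

text \<open>By compactness, \<open>|D x v|\<close> has a positive lower bound and \<open>|E x v|\<close> an upper bound on the unit vectors \<open>v\<close>.\<close>

lemma compact_perturbation_injective: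
  fixes D E :: "'x::metric_space \<Rightarrow> 'a::euclidean_space \<Rightarrow> 'e::real_normed_vector"
  assumes L: "compact L" and D: "\<And>x. x \<in> L \<Longrightarrow> linear (D x)" "\<And>v. continuous_on L (\<lambda>x. D x v)"
    and E: "\<And>x. x \<in> L \<Longrightarrow> linear (E x)" "\<And>v. continuous_on L (\<lambda>x. E x v)"
    and inj: "\<And>x. x \<in> L \<Longrightarrow> inj (D x)"
  shows "\<exists>\<delta>>0. \<forall>x\<in>L. \<forall>s. \<bar>s\<bar> \<le> \<delta> \<longrightarrow> inj (\<lambda>v. D x v + s *\<^sub>R E x v)"
proof (cases "L = {}")
  case False
  let ?C = "L \<times> sphere (0::'a) 1"
  have C: "compact ?C" using L by (intro compact_Times) auto
  have cD: "continuous_on ?C (\<lambda>p. norm (case p of (x, v) \<Rightarrow> D x v))"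
    and cE: "continuous_on ?C (\<lambda>p. norm (case p of (x, v) \<Rightarrow> E x v))"
    by (intro continuous_on_norm continuous_on_linear_family D E; assumption)+
  have "?C \<noteq> {}"
  proof -
    obtain b :: 'a where "b \<in> Basis" using nonempty_Basis by blast
    then have "b \<in> sphere 0 1" by simp
    then show ?thesis using False by blast
  qed
  then obtain p where p: "p \<in> ?C" "\<And>p'. p' \<in> ?C \<Longrightarrow> norm (case p of (x, v) \<Rightarrow> D x v) \<le> norm (case p' of (x, v) \<Rightarrow> D x v)"
    using continuous_attains_inf[OF C _ cD] by blast
  obtain p0 where p0: "p0 \<in> ?C" "\<And>p'. p' \<in> ?C \<Longrightarrow> norm (case p' of (x, v) \<Rightarrow> E x v) \<le> norm (case p0 of (x, v) \<Rightarrow> E x v)"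
    using continuous_attains_sup[OF C \<open>?C \<noteq> {}\<close> cE] by blast
  define \<mu> where "\<mu> = norm (case p of (x, v) \<Rightarrow> D x v)"
  define M where "M = norm (case p0 of (x, v) \<Rightarrow> E x v) + 1"
  have "\<mu> > 0"
  proof -
    obtain x v where xv: "p = (x, v)" "x \<in> L" "norm v = 1" using p(1) by auto
    then have "D x v \<noteq> 0"
      using linear_injective_0[OF D(1)[of x]] inj[of x] by fastforce
    then show ?thesis by (simp add: \<mu>_def xv)
  qed
  have "M > 0" by (simp add: M_def add_nonneg_pos)
  show ?thesis
  proof (intro exI[of _ "\<mu> / (2 * M)"] conjI ballI allI impI)
    show "\<mu> / (2 * M) > 0" using \<open>\<mu> > 0\<close> \<open>M > 0\<close> by simp
    fix x s assume x: "x \<in> L" and s: "\<bar>s\<bar> \<le> \<mu> / (2 * M)"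
    have lin: "linear (\<lambda>v. D x v + s *\<^sub>R E x v)"
      by (intro linear_compose_add linear_compose_scale_right D E x)
    have unit: "D x v + s *\<^sub>R E x v \<noteq> 0" if "norm v = 1" for v
    proof -
      have xv: "(x, v) \<in> ?C" using x that by simp
      have "norm (s *\<^sub>R E x v) \<le> \<mu> / (2 * M) * M"
        unfolding norm_scaleR
      proof (rule mult_mono)
        show "norm (E x v) \<le> M" using p0(2)[OF xv] by (simp add: M_def)
      qed (use s \<open>\<mu> > 0\<close> \<open>M > 0\<close> in simp_all)
      also have "\<dots> < \<mu>" using \<open>\<mu> > 0\<close> \<open>M > 0\<close> by simp
      also have "\<mu> \<le> norm (D x v)" using p(2)[OF xv] by (simp add: \<mu>_def)
      finally show ?thesis by (metis add_eq_0_iff norm_minus_cancel less_irrefl)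
    qed
    have "v = 0" if v: "D x v + s *\<^sub>R E x v = 0" for v
    proof (rule ccontr)
      assume "v \<noteq> 0"
      let ?w = "(1 / norm v) *\<^sub>R v"
      have "D x ?w + s *\<^sub>R E x ?w = (1 / norm v) *\<^sub>R (D x v + s *\<^sub>R E x v)"
        by (rule linear_scale[OF lin])
      moreover have "norm ?w = 1" using \<open>v \<noteq> 0\<close> by simp
      ultimately show False using unit[of ?w] v by simp
    qed
    then show "inj (\<lambda>v. D x v + s *\<^sub>R E x v)" using linear_injective_0[OF lin] by blast
  qed
qed (auto intro: exI[of _ 1])

section \<open>Smooth families of immersions\<close>

lemma chart_open_image:
  assumes "is_chart c" "open Q"
  shows "open (coord c ` (chart_dom c \<inter> Q))"
proof -
  have "coord c ` (chart_dom c \<inter> Q) = chart_img c \<inter> param c -` Q"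
    using chart_simps[OF assms(1)] by (auto simp: chart_img_def intro!: image_eqI)
  moreover have "open (chart_img c \<inter> param c -` Q)"
    using assms unfolding is_chart_def homeomorphism_def by (intro continuous_open_preimage) auto
  ultimately show ?thesis by simp
qed

lemma chart_continuous:
  assumes "is_chart c"
  shows "continuous_on (chart_dom c) (coord c)" "continuous_on (chart_img c) (param c)"
    "open (chart_dom c)" "open (chart_img c)"
  using assms unfolding is_chart_def homeomorphism_def by auto

lemma chart_coord_inj: "is_chart c \<Longrightarrow> p \<in> chart_dom c \<Longrightarrow> q \<in> chart_dom c \<Longrightarrow> coord c p = coord c q \<Longrightarrow> p = q"
  using chart_simps(1) by metis

definition family_map :: "('l, 'a) chart \<Rightarrow> ('p, 'e) chart \<Rightarrow> (real \<Rightarrow> 'l \<Rightarrow> 'p) \<Rightarrow> real \<times> 'a \<Rightarrow> 'e" where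
  "family_map c d \<Phi> p = coord d (\<Phi> (fst p) (param c (snd p)))"

lemma family_map_eq: "(\<lambda>(t, y). local_map c d (\<Phi> t) y) = family_map c d \<Phi>"
  by (auto simp: family_map_def local_map_eq fun_eq_iff)

locale immersion_field =
  fixes A :: "('p::{t2_space,second_countable_topology}, 'e::euclidean_space) chart set"
    and B :: "('l::{t2_space,second_countable_topology}, 'a::euclidean_space) chart set"
    and F :: "'l \<Rightarrow> 'p" and \<xi> :: "('l, 'p, 'e) field_along"
  assumes atlas_A: "smooth_atlas A" and atlas_B: "smooth_atlas B" and immersion_F: "immersion B A F"
    and \<xi>_change: "\<And>d d' q. d \<in> A \<Longrightarrow> d' \<in> A \<Longrightarrow> F q \<in> chart_dom d \<Longrightarrow> F q \<in> chart_dom d' \<Longrightarrow>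
      \<xi> d' q = dtrans d d' (F q) (\<xi> d q)"
    and \<xi>_smooth: "\<And>c d. c \<in> B \<Longrightarrow> d \<in> A \<Longrightarrow>
      smooth_on (coord c ` (chart_dom c \<inter> F -` chart_dom d)) (\<lambda>y. \<xi> d (param c y))"
begin

text \<open>Smoothness and immersivity of a family are local in space and time; a family is put together from pieces that are
  tested in one pair of charts each.\<close>

definition regular_in :: "('l, 'a) chart \<Rightarrow> ('p, 'e) chart \<Rightarrow> (real \<Rightarrow> 'l \<Rightarrow> 'p) \<Rightarrow> real \<Rightarrow> 'l \<Rightarrow> bool" where
  "regular_in c d \<Phi> t q \<longleftrightarrow> q \<in> chart_dom c \<and> (\<exists>S. (t, coord c q) \<in> S \<and>
     (\<forall>s y. (s, y) \<in> S \<longrightarrow> y \<in> chart_img c \<and> \<Phi> s (param c y) \<in> chart_dom d) \<and>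
     smooth_on S (family_map c d \<Phi>) \<and>
     inj (\<lambda>v. frechet_derivative (family_map c d \<Phi>) (at (t, coord c q)) (0, v)))"

definition regular_at :: "(real \<Rightarrow> 'l \<Rightarrow> 'p) \<Rightarrow> real \<Rightarrow> 'l \<Rightarrow> bool" where
  "regular_at \<Phi> t q \<longleftrightarrow> (\<exists>c\<in>B. \<exists>d\<in>A. regular_in c d \<Phi> t q)"

lemmas chart_B = smooth_atlas_chart[OF atlas_B] and chart_A = smooth_atlas_chart[OF atlas_A]

text \<open>Another pair of charts composes the coordinate expression with two transition maps, which are smooth
  and have invertible derivatives.\<close>

lemma regular_in_any:
  assumes reg: "regular_at \<Phi> t q" and c': "c' \<in> B" "q \<in> chart_dom c'" and d': "d' \<in> A" "\<Phi> t q \<in> chart_dom d'"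
  shows "regular_in c' d' \<Phi> t q"
proof -
  obtain c d S where c: "c \<in> B" "q \<in> chart_dom c" and d: "d \<in> A" and S: "(t, coord c q) \<in> S"
    "\<And>s y. (s, y) \<in> S \<Longrightarrow> y \<in> chart_img c \<and> \<Phi> s (param c y) \<in> chart_dom d"
    "smooth_on S (family_map c d \<Phi>)" "inj (\<lambda>v. frechet_derivative (family_map c d \<Phi>) (at (t, coord c q)) (0, v))"
    using reg unfolding regular_at_def regular_in_def by blast
  note sc = chart_simps[OF chart_B[OF c(1)]] and sc' = chart_simps[OF chart_B[OF c'(1)]]
    and sd = chart_simps[OF chart_A[OF d]]
  define \<tau> where "\<tau> = transition c' c"
  define C where "C = coord c' ` (chart_dom c' \<inter> chart_dom c)"
  define m where "m = (\<lambda>p::real \<times> 'a. (fst p, \<tau> (snd p)))"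
  have \<tau>: "smooth_on C \<tau>"
    using atlas_B c(1) c'(1) unfolding smooth_atlas_def C_def \<tau>_def by blast
  have "open (UNIV \<times> C :: (real \<times> 'a) set)" using smooth_on_open[OF \<tau>] by (intro open_Times) auto
  have m: "smooth_on (UNIV \<times> C) m"
    unfolding m_def
  proof (intro smooth_on_Pair smooth_on_bounded_linear[OF bounded_linear_fst] smooth_on_ident)
    show "smooth_on (UNIV \<times> C) (\<lambda>p::real \<times> 'a. \<tau> (snd p))"
      by (rule smooth_on_compose[OF \<tau> smooth_on_bounded_linear[OF bounded_linear_snd smooth_on_ident]])
        (use \<open>open (UNIV \<times> C :: (real \<times> 'a) set)\<close> in auto)
  qed fact+
  define S1 where "S1 = (UNIV \<times> C) \<inter> m -` S"
  have S1: "open S1" unfolding S1_def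
    by (rule continuous_open_preimage[OF smooth_on_imp_continuous_on[OF m] smooth_on_open[OF m] smooth_on_open[OF S(3)]])
  have tr: "y \<in> chart_img c'" "param c (\<tau> y) = param c' y" if "y \<in> C" for y
    using that sc sc' by (auto simp: C_def \<tau>_def transition_def chart_img_def)
  have eq1: "family_map c' d \<Phi> p = family_map c d \<Phi> (m p)" if "p \<in> S1" for p
    using that tr by (auto simp: S1_def family_map_def m_def)
  have sm1: "smooth_on S1 (family_map c' d \<Phi>)"
  proof (rule smooth_on_cong)
    show "smooth_on S1 (\<lambda>p. family_map c d \<Phi> (m p))"
      by (rule smooth_on_compose[OF S(3) smooth_on_subset[OF m S1]]) (auto simp: S1_def)
  qed (simp add: eq1)
  have \<Phi>d: "\<Phi> (fst p) (param c' (snd p)) \<in> chart_dom d" if "p \<in> S1" for p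
    using that S(2)[of "fst p" "\<tau> (snd p)"] tr by (auto simp: S1_def m_def)
  define S2 where "S2 = S1 \<inter> family_map c' d \<Phi> -` (coord d ` (chart_dom d \<inter> chart_dom d'))"
  have "open (coord d ` (chart_dom d \<inter> chart_dom d'))"
    by (intro chart_open_image chart_A d chart_continuous(3) d')
  then have S2: "open S2" unfolding S2_def
    by (intro continuous_open_preimage[OF smooth_on_imp_continuous_on[OF sm1] S1])
  have \<Phi>d': "\<Phi> (fst p) (param c' (snd p)) \<in> chart_dom d'" if p: "p \<in> S2" for p
  proof -
    obtain x where x: "x \<in> chart_dom d" "x \<in> chart_dom d'" "family_map c' d \<Phi> p = coord d x"
      using p by (auto simp: S2_def)
    then have "\<Phi> (fst p) (param c' (snd p)) = x"
      using p \<Phi>d[of p] chart_coord_inj[OF chart_A[OF d]] by (auto simp: S2_def family_map_def)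
    then show ?thesis using x by simp
  qed
  have sub: "S2 \<subseteq> S1" by (auto simp: S2_def)
  have sm2: "smooth_on S2 (family_map c' d' \<Phi>)"
    unfolding family_map_def
    by (rule smooth_on_chart_change[OF atlas_A d d'(1)])
      (use \<Phi>d \<Phi>d' sub smooth_on_subset[OF sm1 S2 sub] in \<open>auto simp: family_map_def[abs_def]\<close>)
  let ?p = "(t, coord c' q)"
  have qC: "coord c' q \<in> C" using c c' by (auto simp: C_def)
  have \<tau>q: "\<tau> (coord c' q) = coord c q" using c' sc' by (simp add: \<tau>_def transition_def)
  have pS1: "?p \<in> S1" using S(1) qC \<tau>q by (simp add: S1_def m_def)
  have \<Phi>q: "\<Phi> t q \<in> chart_dom d" using \<Phi>d[OF pS1] c' sc' by simp
  have pS2: "?p \<in> S2" using pS1 \<Phi>q d'(2) c' sc' by (auto simp: S2_def family_map_def)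
  let ?D = "frechet_derivative (family_map c d \<Phi>) (at (t, coord c q))"
  have D1: "(family_map c' d \<Phi> has_derivative (\<lambda>h. ?D (fst h, dtrans c' c q (snd h)))) (at ?p)"
  proof (rule has_derivative_transform_within_open[OF _ S1 pS1])
    have "(m has_derivative (\<lambda>h. (fst h, dtrans c' c q (snd h)))) (at ?p)"
      unfolding m_def \<tau>_def
    proof (intro has_derivative_Pair has_derivative_fst has_derivative_ident)
      show "((\<lambda>p. transition c' c (snd p)) has_derivative (\<lambda>h. dtrans c' c q (snd h))) (at ?p)"
        by (rule has_derivative_compose[where g = "transition c' c" and f = snd])
          (auto intro!: derivative_eq_intros dtrans_has_derivative[OF atlas_B] c c')
    qed
    moreover have "(family_map c d \<Phi> has_derivative ?D) (at (m ?p))"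
      using smooth_on_has_derivative[OF S(3,1)] by (simp add: m_def \<tau>q)
    ultimately show "((\<lambda>p. family_map c d \<Phi> (m p)) has_derivative (\<lambda>h. ?D (fst h, dtrans c' c q (snd h)))) (at ?p)"
      by (rule has_derivative_compose)
  qed (simp add: eq1)
  have "((\<lambda>p. coord d' (\<Phi> (fst p) (param c' (snd p)))) has_derivative
      (\<lambda>h. dtrans d d' (\<Phi> (fst ?p) (param c' (snd ?p))) (?D (fst h, dtrans c' c q (snd h))))) (at ?p)"
    by (rule has_derivative_chart_change[OF atlas_A d d'(1) S1 pS1 \<Phi>d])
      (use D1 d'(2) c' sc' in \<open>auto simp: family_map_def[abs_def]\<close>)
  then have "frechet_derivative (family_map c' d' \<Phi>) (at ?p) =
      (\<lambda>h. dtrans d d' (\<Phi> t q) (?D (fst h, dtrans c' c q (snd h))))"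
    using c' sc' by (simp add: family_map_def[abs_def] frechet_derivative_eqI)
  moreover have "inj (\<lambda>v. dtrans d d' (\<Phi> t q) (?D (0, dtrans c' c q v)))"
  proof (rule injI)
    fix v w assume "dtrans d d' (\<Phi> t q) (?D (0, dtrans c' c q v)) = dtrans d d' (\<Phi> t q) (?D (0, dtrans c' c q w))"
    then have "?D (0, dtrans c' c q v) = ?D (0, dtrans c' c q w)"
      using dtrans_inverse[OF atlas_A d d'(1) \<Phi>q d'(2)] by metis
    then have "dtrans c' c q v = dtrans c' c q w" using S(4) by (auto dest: injD)
    then show "v = w" using dtrans_inverse[OF atlas_B c'(1) c(1) c'(2) c(2)] by metis
  qed
  ultimately have "inj (\<lambda>v. frechet_derivative (family_map c' d' \<Phi>) (at ?p) (0, v))" by simp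
  then show ?thesis
    unfolding regular_in_def using c'(2) pS2 sm2 \<Phi>d' tr sub
    by (intro conjI exI[of _ S2]) (auto simp: S1_def)
qed

lemma regular_at_continuous:
  assumes "regular_at \<Phi> t q"
  shows "continuous (at (t, q)) (\<lambda>(t, q). \<Phi> t q)"
proof -
  obtain c d S where c: "c \<in> B" "q \<in> chart_dom c" and d: "d \<in> A" and S: "(t, coord c q) \<in> S"
    "\<And>s y. (s, y) \<in> S \<Longrightarrow> y \<in> chart_img c \<and> \<Phi> s (param c y) \<in> chart_dom d"
    "smooth_on S (family_map c d \<Phi>)"
    using assms unfolding regular_at_def regular_in_def by blast
  note sc = chart_simps[OF chart_B[OF c(1)]] and sd = chart_simps[OF chart_A[OF d]]
  define m where "m = (\<lambda>p::real \<times> 'l. (fst p, coord c (snd p)))"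
  have m: "continuous_on (UNIV \<times> chart_dom c) m"
    unfolding m_def by (intro continuous_intros continuous_on_compose2[OF chart_continuous(1)[OF chart_B[OF c(1)]]]) auto
  define W where "W = (UNIV \<times> chart_dom c) \<inter> m -` S"
  have W: "open W" unfolding W_def
    by (intro continuous_open_preimage[OF m] open_Times chart_continuous chart_B c smooth_on_open[OF S(3)] open_UNIV)
  have "continuous_on W (\<lambda>p. param d (family_map c d \<Phi> (m p)))"
  proof (rule continuous_on_compose2[OF chart_continuous(2)[OF chart_A[OF d]]])
    show "continuous_on W (\<lambda>p. family_map c d \<Phi> (m p))"
      by (rule continuous_on_compose2[OF smooth_on_imp_continuous_on[OF S(3)] continuous_on_subset[OF m]])
        (auto simp: W_def)
    show "(\<lambda>p. family_map c d \<Phi> (m p)) ` W \<subseteq> chart_img d"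
      using S(2) sd(2) by (fastforce simp: W_def m_def family_map_def)
  qed
  then have "continuous_on W (\<lambda>(t, q). \<Phi> t q)"
  proof (rule continuous_on_eq)
    fix p assume "p \<in> W"
    then show "param d (family_map c d \<Phi> (m p)) = (case p of (t, q) \<Rightarrow> \<Phi> t q)"
      using S(2)[of "fst p" "coord c (snd p)"] sd(1) sc(1) by (auto simp: W_def m_def family_map_def)
  qed
  moreover have "(t, q) \<in> W" using S(1) c(2) by (simp add: W_def m_def)
  ultimately show ?thesis using W by (simp add: continuous_on_eq_continuous_at)
qed

lemma regular_family_smooth:
  assumes reg: "\<And>t q. \<bar>t\<bar> < a \<Longrightarrow> regular_at \<Phi> t q" and c: "c \<in> B" and d: "d \<in> A"
  shows "smooth_on {(t, y). t \<in> {-a<..<a} \<and> y \<in> chart_img c \<and> \<Phi> t (param c y) \<in> chart_dom d} (family_map c d \<Phi>)"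
proof (rule smooth_on_local)
  note sc = chart_simps[OF chart_B[OF c]]
  fix p assume "p \<in> {(t, y). t \<in> {-a<..<a} \<and> y \<in> chart_img c \<and> \<Phi> t (param c y) \<in> chart_dom d}"
  then obtain t y where p: "p = (t, y)" "\<bar>t\<bar> < a" "y \<in> chart_img c" "\<Phi> t (param c y) \<in> chart_dom d" by auto
  from regular_in_any[OF reg[OF p(2)] c sc(3)[OF p(3)] d p(4)]
  obtain S where S: "(t, y) \<in> S" "\<And>s y. (s, y) \<in> S \<Longrightarrow> y \<in> chart_img c \<and> \<Phi> s (param c y) \<in> chart_dom d"
    "smooth_on S (family_map c d \<Phi>)"
    unfolding regular_in_def using sc(4)[OF p(3)] by auto
  have "open (S \<inter> {-a<..<a} \<times> UNIV)" using smooth_on_open[OF S(3)] by (intro open_Int open_Times) auto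
  then have "smooth_on (S \<inter> {-a<..<a} \<times> UNIV) (family_map c d \<Phi>)" by (intro smooth_on_subset[OF S(3)]) auto
  then show "\<exists>N. p \<in> N \<and> N \<subseteq> {(t, y). t \<in> {-a<..<a} \<and> y \<in> chart_img c \<and> \<Phi> t (param c y) \<in> chart_dom d} \<and>
      smooth_on N (family_map c d \<Phi>)"
    using S(1,2) p by (intro exI[of _ "S \<inter> {-a<..<a} \<times> UNIV"]) auto
qed

lemma regular_imp_family:
  assumes "a > 0" and reg: "\<And>t q. \<bar>t\<bar> < a \<Longrightarrow> regular_at \<Phi> t q"
  shows "smooth_immersion_family B A a \<Phi>"
proof -
  have cont: "continuous_on ({-a<..<a} \<times> UNIV) (\<lambda>(t, q). \<Phi> t q)"
  proof (intro continuous_at_imp_continuous_on ballI)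
    fix p :: "real \<times> 'l" assume "p \<in> {-a<..<a} \<times> UNIV"
    then have "\<bar>fst p\<bar> < a" by auto
    from regular_at_continuous[OF reg[OF this], of "snd p"]
    show "isCont (\<lambda>(t, q). \<Phi> t q) p" by simp
  qed
  have "immersion B A (\<Phi> t)" if t: "t \<in> {-a<..<a}" for t
  proof -
    have "continuous_on UNIV (\<lambda>q. case (t, q) of (t, q) \<Rightarrow> \<Phi> t q)"
      by (rule continuous_on_compose2[OF cont]) (use t in \<open>auto intro!: continuous_intros\<close>)
    then have ct: "continuous_on UNIV (\<Phi> t)" by simp
    have "smooth_on (coord c ` (chart_dom c \<inter> \<Phi> t -` chart_dom d)) (local_map c d (\<Phi> t)) \<and>
      (\<forall>y\<in>coord c ` (chart_dom c \<inter> \<Phi> t -` chart_dom d). inj (frechet_derivative (local_map c d (\<Phi> t)) (at y)))"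
      if c: "c \<in> B" and d: "d \<in> A" for c d
    proof -
      note sc = chart_simps[OF chart_B[OF c]]
      let ?N = "coord c ` (chart_dom c \<inter> \<Phi> t -` chart_dom d)"
      have N: "y \<in> ?N \<longleftrightarrow> y \<in> chart_img c \<and> \<Phi> t (param c y) \<in> chart_dom d" for y
        by (rule preimage_chart_iff[OF chart_B[OF c]])
      have "open (\<Phi> t -` chart_dom d)"
        by (rule open_vimage[OF chart_continuous(3)[OF chart_A[OF d]] ct])
      then have oN: "open ?N" by (intro chart_open_image chart_B c)
      have lm: "local_map c d (\<Phi> t) = (\<lambda>y. family_map c d \<Phi> (t, y))"
        by (simp add: local_map_eq family_map_def)
      have "smooth_on ?N (\<lambda>y. family_map c d \<Phi> (t, y))"
        by (rule smooth_on_compose[OF regular_family_smooth[OF reg c d]])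
          (use t N in \<open>auto intro!: smooth_on_Pair smooth_on_const smooth_on_ident oN\<close>)
      moreover have "inj (frechet_derivative (local_map c d (\<Phi> t)) (at y))" if y: "y \<in> ?N" for y
      proof -
        have yc: "y \<in> chart_img c" "\<Phi> t (param c y) \<in> chart_dom d" using N y by auto
        have "\<bar>t\<bar> < a" using t by auto
        from regular_in_any[OF reg[OF this] c sc(3)[OF yc(1)] d yc(2)]
        obtain S where S: "(t, y) \<in> S" "smooth_on S (family_map c d \<Phi>)"
          "inj (\<lambda>v. frechet_derivative (family_map c d \<Phi>) (at (t, y)) (0, v))"
          unfolding regular_in_def using sc(4)[OF yc(1)] by auto
        have "((\<lambda>y. family_map c d \<Phi> (t, y)) has_derivative
            (\<lambda>v. frechet_derivative (family_map c d \<Phi>) (at (t, y)) (0, v))) (at y)"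
          by (rule has_derivative_compose[where f = "\<lambda>y. (t, y)", OF _ smooth_on_has_derivative[OF S(2,1)]])
            (intro has_derivative_Pair has_derivative_const has_derivative_ident)
        then show ?thesis using S(3) by (simp add: lm frechet_derivative_eqI)
      qed
      ultimately show ?thesis by (simp add: lm)
    qed
    then show ?thesis using ct by (simp add: immersion_def)
  qed
  then show ?thesis
    using assms cont regular_family_smooth[OF reg]
    by (simp add: smooth_immersion_family_def family_map_eq)
qed

lemma regular_at_local:
  assumes reg: "regular_at \<Phi> t q" and T: "open T" "t \<in> T" and Q: "open Q" "q \<in> Q"
    and eq: "\<And>s q'. s \<in> T \<Longrightarrow> q' \<in> Q \<Longrightarrow> \<Phi>' s q' = \<Phi> s q'"
  shows "regular_at \<Phi>' t q"
proof -
  obtain c d S where c: "c \<in> B" "q \<in> chart_dom c" and d: "d \<in> A" and S: "(t, coord c q) \<in> S"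
    "\<And>s y. (s, y) \<in> S \<Longrightarrow> y \<in> chart_img c \<and> \<Phi> s (param c y) \<in> chart_dom d"
    "smooth_on S (family_map c d \<Phi>)" "inj (\<lambda>v. frechet_derivative (family_map c d \<Phi>) (at (t, coord c q)) (0, v))"
    using reg unfolding regular_at_def regular_in_def by blast
  note sc = chart_simps[OF chart_B[OF c(1)]]
  define S' where "S' = S \<inter> T \<times> (coord c ` (chart_dom c \<inter> Q))"
  have S': "open S'" unfolding S'_def
    using smooth_on_open[OF S(3)] by (intro open_Int open_Times T chart_open_image Q chart_B c)
  have eq': "family_map c d \<Phi>' p = family_map c d \<Phi> p" "\<Phi>' (fst p) (param c (snd p)) = \<Phi> (fst p) (param c (snd p))"
    if "p \<in> S'" for p
    using that eq sc(1) by (auto simp: S'_def family_map_def)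
  have p: "(t, coord c q) \<in> S'" using S(1) T Q c by (auto simp: S'_def)
  have "smooth_on S' (family_map c d \<Phi>')"
  proof (rule smooth_on_cong)
    show "smooth_on S' (family_map c d \<Phi>)" by (rule smooth_on_subset[OF S(3) S']) (auto simp: S'_def)
  qed (rule eq'(1)[symmetric])
  moreover have "frechet_derivative (family_map c d \<Phi>') (at (t, coord c q)) =
      frechet_derivative (family_map c d \<Phi>) (at (t, coord c q))"
    by (rule frechet_derivative_cong_open[OF S' p eq'(1)])
  ultimately have "regular_in c d \<Phi>' t q"
    unfolding regular_in_def using c(2) p S(2,4) eq'(2)
    by (intro conjI exI[of _ S']) (auto simp: S'_def)
  then show ?thesis using c d unfolding regular_at_def by blast
qed

lemma regular_constant: "regular_at (\<lambda>_. F) t q"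
proof -
  define c where "c = chart_around B q"
  define d where "d = chart_around A (F q)"
  have c: "c \<in> B" "q \<in> chart_dom c" and d: "d \<in> A" "F q \<in> chart_dom d"
    using chart_around[OF atlas_B] chart_around[OF atlas_A] by (auto simp: c_def d_def)
  let ?N = "coord c ` (chart_dom c \<inter> F -` chart_dom d)"
  have N: "smooth_on ?N (local_map c d F)" by (rule immersion_smooth[OF immersion_F c(1) d(1)])
  have fm: "family_map c d (\<lambda>_. F) = (\<lambda>p. local_map c d F (snd p))"
    by (simp add: family_map_def[abs_def] local_map_eq)
  have oN: "open (UNIV \<times> ?N :: (real \<times> 'a) set)" using smooth_on_open[OF N] by (intro open_Times) auto
  have q: "coord c q \<in> ?N" using c d by auto
  have "smooth_on (UNIV \<times> ?N) (family_map c d (\<lambda>_. F))"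
    unfolding fm
    by (rule smooth_on_compose[OF N smooth_on_bounded_linear[OF bounded_linear_snd smooth_on_ident[OF oN]]]) auto
  moreover have "inj (\<lambda>v. frechet_derivative (family_map c d (\<lambda>_. F)) (at (t, coord c q)) (0, v))"
  proof -
    have "((\<lambda>p. local_map c d F (snd p)) has_derivative
        (\<lambda>h. frechet_derivative (local_map c d F) (at (coord c q)) (snd h))) (at (t, coord c q))"
      by (rule has_derivative_compose[where g = "local_map c d F" and f = snd])
        (use smooth_on_has_derivative[OF N q] in \<open>auto intro!: derivative_eq_intros\<close>)
    then have "frechet_derivative (family_map c d (\<lambda>_. F)) (at (t, coord c q)) =
      (\<lambda>h. frechet_derivative (local_map c d F) (at (coord c q)) (snd h))"
      unfolding fm by (rule frechet_derivative_eqI)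
    moreover have "inj (frechet_derivative (local_map c d F) (at (coord c q)))"
      using immersion_F c d q unfolding immersion_def by blast
    ultimately show ?thesis by simp
  qed
  ultimately have "regular_in c d (\<lambda>_. F) t q"
    unfolding regular_in_def using c(2) q preimage_chart_iff[OF chart_B[OF c(1)], of _ F d]
    by (intro conjI exI[of _ "UNIV \<times> ?N"]) auto
  then show ?thesis using c d unfolding regular_at_def by blast
qed

end

lemma finite_uniform_positive:
  fixes P :: "'k \<Rightarrow> real \<Rightarrow> bool"
  assumes "finite K" "\<And>k. k \<in> K \<Longrightarrow> \<exists>\<delta>>0. P k \<delta>" "\<And>k \<delta> \<delta>'. P k \<delta> \<Longrightarrow> 0 < \<delta>' \<Longrightarrow> \<delta>' \<le> \<delta> \<Longrightarrow> P k \<delta>'"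
  shows "\<exists>\<delta>>0. \<forall>k\<in>K. P k \<delta>"
  using assms(1,2)
proof (induction K rule: finite_induct)
  case empty
  then show ?case by (auto intro: exI[of _ 1])
next
  case (insert k K)
  obtain \<delta>' where "\<delta>' > 0" "P k \<delta>'" using insert.prems[of k] by auto
  moreover obtain \<delta> where "\<delta> > 0" "\<forall>k\<in>K. P k \<delta>" using insert by auto
  ultimately have d: "\<delta> > 0" "\<forall>k\<in>K. P k \<delta>" "\<delta>' > 0" "P k \<delta>'" by auto
  have "\<forall>j\<in>insert k K. P j (min \<delta> \<delta>')"
    using d assms(3)[of _ \<delta> "min \<delta> \<delta>'"] assms(3)[of _ \<delta>' "min \<delta> \<delta>'"] by auto
  then show ?case using d by (intro exI[of _ "min \<delta> \<delta>'"]) auto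
qed

context immersion_field
begin

definition velocity :: "(real \<Rightarrow> 'l \<Rightarrow> 'p) \<Rightarrow> ('l \<Rightarrow> real) \<Rightarrow> bool" where
  "velocity \<Phi> \<rho> \<longleftrightarrow> (\<forall>d\<in>A. \<forall>q. F q \<in> chart_dom d \<longrightarrow>
     ((\<lambda>t. coord d (\<Phi> t q)) has_vector_derivative \<rho> q *\<^sub>R \<xi> d q) (at 0))"

text \<open>A family can be modified inside one pair of charts so that its velocity increases by \<open>\<psi> \<xi>\<close>,
  where \<open>\<psi>\<close> has compact support: in the chart \<open>e\<close> of the ambient manifold one adds
  \<open>\<delta> sin(t/\<delta>) \<psi> \<xi>\<close>. The added vector never exceeds \<open>\<delta> |\<psi> \<xi>|\<close>, and for small \<open>\<delta>\<close> this neither leaves the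
  charts nor destroys immersivity.\<close>

lemma modify_family:
  assumes ab: "0 < b" "b < a" and reg: "\<And>t q. \<bar>t\<bar> < a \<Longrightarrow> regular_at \<Phi> t q" and \<Phi>0: "\<Phi> 0 = F"
    and vel: "velocity \<Phi> \<rho>" and c: "c \<in> B" and e: "e \<in> A"
    and S: "compact S" "S \<subseteq> chart_dom c" "\<And>t q. \<bar>t\<bar> < a \<Longrightarrow> q \<in> S \<Longrightarrow> \<Phi> t q \<in> chart_dom e"
    and \<psi>: "\<And>q. q \<notin> S \<Longrightarrow> \<psi> q = 0" "smooth_on (chart_img c) (\<lambda>y. \<psi> (param c y))"
    and K: "finite K" "\<And>k. k \<in> K \<Longrightarrow> compact (R k)" "\<And>k. k \<in> K \<Longrightarrow> d k \<in> A"
      "\<And>k t q. k \<in> K \<Longrightarrow> \<bar>t\<bar> < a \<Longrightarrow> q \<in> R k \<Longrightarrow> \<Phi> t q \<in> chart_dom (d k)"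
  shows "\<exists>\<Phi>'. (\<forall>t q. \<bar>t\<bar> < b \<longrightarrow> regular_at \<Phi>' t q) \<and> \<Phi>' 0 = F \<and> velocity \<Phi>' (\<lambda>q. \<rho> q + \<psi> q) \<and>
    (\<forall>t q. q \<notin> S \<longrightarrow> \<Phi>' t q = \<Phi> t q) \<and>
    (\<forall>k\<in>K. \<forall>t q. \<bar>t\<bar> < b \<longrightarrow> q \<in> R k \<inter> S \<longrightarrow> \<Phi>' t q \<in> chart_dom (d k))"
proof -
  note sc = chart_simps[OF chart_B[OF c]] and se = chart_simps[OF chart_A[OF e]]
  define fm where "fm = family_map c e \<Phi>"
  define N where "N = coord c ` (chart_dom c \<inter> F -` chart_dom e)"
  define W0 where "W0 = {(t, y). t \<in> {-a<..<a} \<and> y \<in> chart_img c \<and> \<Phi> t (param c y) \<in> chart_dom e}"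
  define W where "W = W0 \<inter> {-b<..<b} \<times> N"
  define \<eta> where "\<eta> y = \<psi> (param c y) *\<^sub>R \<xi> e (param c y)" for y
  have N_iff: "y \<in> N \<longleftrightarrow> y \<in> chart_img c \<and> F (param c y) \<in> chart_dom e" for y
    unfolding N_def by (rule preimage_chart_iff[OF chart_B[OF c]])
  have N: "open N" unfolding N_def by (rule smooth_on_open[OF \<xi>_smooth[OF c e]])
  have fm: "smooth_on W0 fm" unfolding W0_def fm_def by (rule regular_family_smooth[OF reg c e])
  have \<eta>: "smooth_on N \<eta>" unfolding \<eta>_def
    by (intro smooth_on_scaleR smooth_on_subset[OF \<psi>(2) N] \<xi>_smooth[OF c e, folded N_def]) (auto simp: N_iff)
  have FS: "F q \<in> chart_dom e" if "q \<in> S" for q using S(3)[of 0 q] that ab \<Phi>0 by simp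
  have cS: "continuous_on S (coord c)"
    by (rule continuous_on_subset[OF chart_continuous(1)[OF chart_B[OF c]] S(2)])
  have closedbox: "compact ({-b..b} \<times> coord c ` (S \<inter> R))" if "compact R" for R
    using compact_Int[OF S(1) that] by (intro compact_Times compact_continuous_image continuous_on_subset[OF cS]) auto
  define L where "L = {-b..b} \<times> coord c ` S"
  have L: "compact L" unfolding L_def
    by (intro compact_Times compact_continuous_image cS S) auto
  have L_W0: "x \<in> W0" "snd x \<in> N" if "x \<in> L" for x
  proof -
    obtain t q where x: "x = (t, coord c q)" "q \<in> S" "\<bar>t\<bar> \<le> b" using \<open>x \<in> L\<close> by (auto simp: L_def)
    then have "q \<in> chart_dom c" using S(2) by auto
    then show "x \<in> W0" "snd x \<in> N"
      using x ab sc S(3)[of t q] FS by (auto simp: W0_def N_iff)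
  qed
  have c_fm: "continuous_on L fm"
    using continuous_on_subset[OF smooth_on_imp_continuous_on[OF fm]] L_W0 by blast
  have c_\<eta>: "continuous_on L (\<lambda>x. \<eta> (snd x))"
    by (rule continuous_on_compose2[OF smooth_on_imp_continuous_on[OF \<eta>]]) (use L_W0 in \<open>auto intro!: continuous_intros\<close>)
  have fm_q: "fm (t, coord c q) = coord e (\<Phi> t q)" if "q \<in> S" for t q
    using that S(2) sc(1) by (auto simp: fm_def family_map_def)
  \<comment> \<open>three bounds on the perturbation: it stays in the chart \<open>e\<close>, keeps the differential injective, and stays in the
    charts \<open>d k\<close>\<close>
  obtain \<delta>1 where \<delta>1: "\<delta>1 > 0" "\<And>x s. x \<in> L \<Longrightarrow> \<bar>s\<bar> \<le> \<delta>1 \<Longrightarrow> fm x + s *\<^sub>R \<eta> (snd x) \<in> chart_img e"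
  proof -
    have "fm ` L \<subseteq> chart_img e"
      using L_W0 se(2) by (fastforce simp: W0_def fm_def family_map_def)
    from compact_perturbation_in_open[OF L c_fm c_\<eta> chart_continuous(4)[OF chart_A[OF e]] this] show ?thesis
      using that by blast
  qed
  obtain \<delta>2 where \<delta>2: "\<delta>2 > 0" "\<And>x s. x \<in> L \<Longrightarrow> \<bar>s\<bar> \<le> \<delta>2 \<Longrightarrow>
      inj (\<lambda>v. frechet_derivative fm (at x) (0, v) + s *\<^sub>R frechet_derivative \<eta> (at (snd x)) v)"
  proof -
    have "\<exists>\<delta>>0. \<forall>x\<in>L. \<forall>s. \<bar>s\<bar> \<le> \<delta> \<longrightarrow>
        inj (\<lambda>v. frechet_derivative fm (at x) (0, v) + s *\<^sub>R frechet_derivative \<eta> (at (snd x)) v)"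
    proof (rule compact_perturbation_injective[OF L])
      fix x assume x: "x \<in> L"
      have lin: "linear (frechet_derivative fm (at x))"
        using smooth_on_has_derivative[OF fm L_W0(1)[OF x]] by (rule has_derivative_linear)
      have "linear (\<lambda>v::'a. (0::real, v))" by (rule linearI) auto
      from linear_compose[OF this lin] show "linear (\<lambda>v. frechet_derivative fm (at x) (0, v))" by (simp add: o_def)
      show "linear (frechet_derivative \<eta> (at (snd x)))"
        using smooth_on_has_derivative[OF \<eta> L_W0(2)[OF x]] by (rule has_derivative_linear)
      obtain t q where tq: "x = (t, coord c q)" "q \<in> S" "\<bar>t\<bar> \<le> b" using x by (auto simp: L_def)
      then have "q \<in> chart_dom c" "\<bar>t\<bar> < a" "\<Phi> t q \<in> chart_dom e" using S(2,3) ab by auto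
      from regular_in_any[OF reg[OF this(2)] c this(1) e this(3)]
      show "inj (\<lambda>v. frechet_derivative fm (at x) (0, v))"
        unfolding regular_in_def tq fm_def by blast
    next
      show "continuous_on L (\<lambda>x. frechet_derivative fm (at x) (0, v))" for v
        by (rule continuous_on_subset[OF smooth_on_imp_continuous_on[OF smooth_on_frechet_derivative[OF fm]]])
          (use L_W0 in auto)
      show "continuous_on L (\<lambda>x. frechet_derivative \<eta> (at (snd x)) v)" for v
        by (rule continuous_on_compose2[OF smooth_on_imp_continuous_on[OF smooth_on_frechet_derivative[OF \<eta>]]])
          (use L_W0 in \<open>auto intro!: continuous_intros\<close>)
    qed
    then show ?thesis using that by blast
  qed
  obtain \<delta>3 where \<delta>3: "\<delta>3 > 0" "\<And>k x s. k \<in> K \<Longrightarrow> x \<in> {-b..b} \<times> coord c ` (S \<inter> R k) \<Longrightarrow> \<bar>s\<bar> \<le> \<delta>3 \<Longrightarrow>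
      fm x + s *\<^sub>R \<eta> (snd x) \<in> coord e ` (chart_dom e \<inter> chart_dom (d k))"
  proof -
    have "\<exists>\<delta>>0. \<forall>k\<in>K. \<forall>x\<in>{-b..b} \<times> coord c ` (S \<inter> R k). \<forall>s. \<bar>s\<bar> \<le> \<delta> \<longrightarrow>
        fm x + s *\<^sub>R \<eta> (snd x) \<in> coord e ` (chart_dom e \<inter> chart_dom (d k))"
    proof (rule finite_uniform_positive[OF K(1)])
      fix k assume k: "k \<in> K"
      let ?L = "{-b..b} \<times> coord c ` (S \<inter> R k)"
      have sub: "?L \<subseteq> L" by (auto simp: L_def)
      show "\<exists>\<delta>>0. \<forall>x\<in>?L. \<forall>s. \<bar>s\<bar> \<le> \<delta> \<longrightarrow>
        fm x + s *\<^sub>R \<eta> (snd x) \<in> coord e ` (chart_dom e \<inter> chart_dom (d k))"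
      proof (rule compact_perturbation_in_open[OF closedbox[OF K(2)[OF k]]
            continuous_on_subset[OF c_fm sub] continuous_on_subset[OF c_\<eta> sub]])
        show "open (coord e ` (chart_dom e \<inter> chart_dom (d k)))"
          by (intro chart_open_image chart_A e chart_continuous(3) K(3) k)
        show "fm ` ?L \<subseteq> coord e ` (chart_dom e \<inter> chart_dom (d k))"
          using ab K(4)[OF k] S(3) by (force simp: fm_q)
      qed
    qed (meson order_trans)
    then show ?thesis using that by blast
  qed
  define \<delta> where "\<delta> = min \<delta>1 (min \<delta>2 \<delta>3)"
  have \<delta>: "\<delta> > 0" "\<delta> \<le> \<delta>1" "\<delta> \<le> \<delta>2" "\<delta> \<le> \<delta>3" using \<delta>1 \<delta>2 \<delta>3 by (auto simp: \<delta>_def)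
  define h where "h t = \<delta> * sin (t * (1 / \<delta>))" for t
  have h_le: "\<bar>h t\<bar> \<le> \<delta>" for t
  proof -
    have "\<delta> * \<bar>sin (t * (1 / \<delta>))\<bar> \<le> \<delta> * 1" using \<delta> by (intro mult_left_mono) auto
    then show ?thesis using \<delta> by (simp add: h_def abs_mult)
  qed
  have h: "smooth_on UNIV h"
  proof -
    have "smooth_on UNIV (\<lambda>t. t * (1 / \<delta>))" by (intro smooth_on_mult smooth_on_ident smooth_on_const) auto
    from smooth_on_compose[OF smooth_on_sin this] show ?thesis
      unfolding h_def[abs_def] by (intro smooth_on_mult smooth_on_const) auto
  qed
  have h0: "h 0 = 0" by (simp add: h_def)
  have dh0: "(h has_vector_derivative 1) (at 0)"
    unfolding h_def has_real_derivative_iff_has_vector_derivative[symmetric]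
    using \<delta> by (auto intro!: derivative_eq_intros)
  define \<Phi>' where "\<Phi>' t q = (if q \<in> S then param e (fm (t, coord c q) + h t *\<^sub>R \<eta> (coord c q)) else \<Phi> t q)" for t q
  have in_S: "\<Phi>' t q \<in> chart_dom e" "coord e (\<Phi>' t q) = coord e (\<Phi> t q) + h t *\<^sub>R \<eta> (coord c q)"
    if "q \<in> S" "\<bar>t\<bar> < b" for t q
  proof -
    have "(t, coord c q) \<in> L" using that by (auto simp: L_def)
    from \<delta>1(2)[OF this, of "h t"] have "fm (t, coord c q) + h t *\<^sub>R \<eta> (coord c q) \<in> chart_img e"
      using h_le[of t] \<delta>(2) by simp
    then show "\<Phi>' t q \<in> chart_dom e" "coord e (\<Phi>' t q) = coord e (\<Phi> t q) + h t *\<^sub>R \<eta> (coord c q)"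
      using that se(3,4) by (simp_all add: \<Phi>'_def fm_q)
  qed
  have W: "open W" unfolding W_def
    using N smooth_on_open[OF fm] by (intro open_Int open_Times) auto
  have on_W: "\<Phi>' t (param c y) \<in> chart_dom e" "family_map c e \<Phi>' (t, y) = fm (t, y) + h t *\<^sub>R \<eta> y"
    if "(t, y) \<in> W" for t y
  proof -
    have y: "y \<in> chart_img c" "\<bar>t\<bar> < b" "\<Phi> t (param c y) \<in> chart_dom e"
      using that by (auto simp: W_def W0_def)
    have "\<Phi>' t (param c y) \<in> chart_dom e \<and> family_map c e \<Phi>' (t, y) = fm (t, y) + h t *\<^sub>R \<eta> y"
    proof (cases "param c y \<in> S")
      case True
      then show ?thesis using in_S[OF True y(2)] sc(4)[OF y(1)] by (simp add: family_map_def fm_def)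
    next
      case False
      then show ?thesis using y \<psi>(1) by (simp add: \<Phi>'_def family_map_def fm_def \<eta>_def)
    qed
    then show "\<Phi>' t (param c y) \<in> chart_dom e" "family_map c e \<Phi>' (t, y) = fm (t, y) + h t *\<^sub>R \<eta> y" by auto
  qed
  have smW: "smooth_on W (\<lambda>p. fm p + h (fst p) *\<^sub>R \<eta> (snd p))"
  proof (intro smooth_on_add smooth_on_scaleR)
    show "smooth_on W fm" by (rule smooth_on_subset[OF fm W]) (auto simp: W_def)
    show "smooth_on W (\<lambda>p. h (fst p))"
      by (rule smooth_on_compose[OF h smooth_on_bounded_linear[OF bounded_linear_fst smooth_on_ident[OF W]]]) auto
    show "smooth_on W (\<lambda>p. \<eta> (snd p))"
      by (rule smooth_on_compose[OF \<eta> smooth_on_bounded_linear[OF bounded_linear_snd smooth_on_ident[OF W]]])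
        (auto simp: W_def)
  qed
  have reg': "regular_at \<Phi>' t q" if t: "\<bar>t\<bar> < b" for t q
  proof (cases "q \<in> S")
    case True
    then have qc: "q \<in> chart_dom c" using S(2) by auto
    let ?p = "(t, coord c q)"
    have pL: "?p \<in> L" using True t by (auto simp: L_def)
    have pW: "?p \<in> W" using L_W0[OF pL] t by (auto simp: W_def)
    have sm: "smooth_on W (family_map c e \<Phi>')"
      by (rule smooth_on_cong[OF smW]) (use on_W(2) in auto)
    have "((\<lambda>p. fm p + h (fst p) *\<^sub>R \<eta> (snd p)) has_derivative
        (\<lambda>k. frechet_derivative fm (at ?p) k + (h (fst ?p) *\<^sub>R frechet_derivative \<eta> (at (coord c q)) (snd k) +
           frechet_derivative h (at t) (fst k) *\<^sub>R \<eta> (snd ?p)))) (at ?p)"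
    proof (intro has_derivative_add has_derivative_scaleR)
      show "(fm has_derivative frechet_derivative fm (at ?p)) (at ?p)"
        by (rule smooth_on_has_derivative[OF fm L_W0(1)[OF pL]])
      have h_t: "(h has_derivative frechet_derivative h (at t)) (at (fst ?p))"
        using smooth_on_has_derivative[OF h, of t] by simp
      show "((\<lambda>p. h (fst p)) has_derivative (\<lambda>k. frechet_derivative h (at t) (fst k))) (at ?p)"
        by (rule has_derivative_compose[where g = h and f = fst, OF _ h_t]) (auto intro!: derivative_eq_intros)
      have \<eta>_q: "(\<eta> has_derivative frechet_derivative \<eta> (at (coord c q))) (at (snd ?p))"
        using smooth_on_has_derivative[OF \<eta> L_W0(2)[OF pL]] by simp
      show "((\<lambda>p. \<eta> (snd p)) has_derivative (\<lambda>k. frechet_derivative \<eta> (at (coord c q)) (snd k))) (at ?p)"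
        by (rule has_derivative_compose[where g = \<eta> and f = snd, OF _ \<eta>_q]) (auto intro!: derivative_eq_intros)
    qed
    then have "(family_map c e \<Phi>' has_derivative
        (\<lambda>k. frechet_derivative fm (at ?p) k + (h (fst ?p) *\<^sub>R frechet_derivative \<eta> (at (coord c q)) (snd k) +
           frechet_derivative h (at t) (fst k) *\<^sub>R \<eta> (snd ?p)))) (at ?p)"
      by (rule has_derivative_transform_within_open[OF _ W pW]) (use on_W(2) in auto)
    then have D: "frechet_derivative (family_map c e \<Phi>') (at ?p) =
        (\<lambda>k. frechet_derivative fm (at ?p) k + (h (fst ?p) *\<^sub>R frechet_derivative \<eta> (at (coord c q)) (snd k) +
           frechet_derivative h (at t) (fst k) *\<^sub>R \<eta> (snd ?p)))"
      by (rule frechet_derivative_eqI)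
    have h_0: "frechet_derivative h (at t) 0 = 0"
      using linear_0[OF has_derivative_linear[OF smooth_on_has_derivative[OF h, of t]]] by simp
    have "\<bar>h t\<bar> \<le> \<delta>2" using h_le[of t] \<delta>(3) by simp
    from \<delta>2(2)[OF pL this] have "inj (\<lambda>v. frechet_derivative (family_map c e \<Phi>') (at ?p) (0, v))"
      unfolding D by (simp add: h_0)
    then have "regular_in c e \<Phi>' t q"
      unfolding regular_in_def using qc pW sm on_W(1)
      by (intro conjI exI[of _ W]) (auto simp: W_def W0_def)
    then show ?thesis using c e unfolding regular_at_def by blast
  next
    case False
    have "\<bar>t\<bar> < a" using t ab by simp
    then show ?thesis
      by (rule regular_at_local[OF reg, of t UNIV "- S" q \<Phi>'])
        (use False compact_imp_closed[OF S(1)] in \<open>auto simp: \<Phi>'_def open_Compl\<close>)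
  qed
  have \<Phi>'0: "\<Phi>' 0 = F"
  proof
    fix q
    show "\<Phi>' 0 q = F q"
      using se(1)[OF FS[of q]] by (simp add: \<Phi>'_def h0 fm_q \<Phi>0)
  qed
  have vel': "velocity \<Phi>' (\<lambda>q. \<rho> q + \<psi> q)"
    unfolding velocity_def
  proof (intro ballI allI impI)
    fix d q assume d: "d \<in> A" and q: "F q \<in> chart_dom d"
    show "((\<lambda>t. coord d (\<Phi>' t q)) has_vector_derivative (\<rho> q + \<psi> q) *\<^sub>R \<xi> d q) (at 0)"
    proof (cases "q \<in> S")
      case False
      then show ?thesis using vel d q \<psi>(1)[OF False] by (simp add: velocity_def \<Phi>'_def)
    next
      case True
      then have qc: "q \<in> chart_dom c" using S(2) by auto
      have Fe: "F q \<in> chart_dom e" by (rule FS[OF True])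
      have "((\<lambda>t. coord e (\<Phi> t q) + h t *\<^sub>R \<eta> (coord c q)) has_vector_derivative
          \<rho> q *\<^sub>R \<xi> e q + (h 0 *\<^sub>R 0 + 1 *\<^sub>R \<eta> (coord c q))) (at 0)"
        using vel e Fe unfolding velocity_def
        by (intro has_vector_derivative_add has_vector_derivative_scaleR has_vector_derivative_const
            dh0[unfolded has_real_derivative_iff_has_vector_derivative[symmetric]]) blast
      then have "((\<lambda>t. coord e (\<Phi>' t q)) has_vector_derivative \<rho> q *\<^sub>R \<xi> e q + (h 0 *\<^sub>R 0 + 1 *\<^sub>R \<eta> (coord c q))) (at 0)"
        by (rule has_vector_derivative_transform_within_open[of _ _ _ "{-b<..<b}"]) (use ab in_S(2)[OF True] in auto)
      then have "((\<lambda>t. coord e (\<Phi>' t q)) has_vector_derivative (\<rho> q + \<psi> q) *\<^sub>R \<xi> e q) (at 0)"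
        using sc(1)[OF qc] by (simp add: \<eta>_def algebra_simps)
      then have "((\<lambda>t. coord e (\<Phi>' t q)) has_derivative (\<lambda>t. t *\<^sub>R (\<rho> q + \<psi> q) *\<^sub>R \<xi> e q)) (at 0)"
        by (simp add: has_vector_derivative_def)
      then have "((\<lambda>t. coord d (\<Phi>' t q)) has_derivative
          (\<lambda>t. dtrans e d (\<Phi>' 0 q) (t *\<^sub>R (\<rho> q + \<psi> q) *\<^sub>R \<xi> e q))) (at 0)"
        by (intro has_derivative_chart_change[where P = "\<lambda>t. \<Phi>' t q" and N = "{-b<..<b}", OF atlas_A e d])
          (use ab in_S(1)[OF True] \<Phi>'0 q in auto)
      moreover have "dtrans e d (\<Phi>' 0 q) (t *\<^sub>R (\<rho> q + \<psi> q) *\<^sub>R \<xi> e q) = t *\<^sub>R (\<rho> q + \<psi> q) *\<^sub>R \<xi> d q" for t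
        using linear_scale[OF dtrans_linear[OF atlas_A e d Fe q]] \<xi>_change[OF e d Fe q] by (simp add: \<Phi>'0)
      ultimately show ?thesis by (simp add: has_vector_derivative_def)
    qed
  qed
  have stay: "\<Phi>' t q \<in> chart_dom (d k)" if "k \<in> K" "\<bar>t\<bar> < b" "q \<in> R k \<inter> S" for k t q
  proof -
    have "(t, coord c q) \<in> {-b..b} \<times> coord c ` (S \<inter> R k)" using that by auto
    from \<delta>3(2)[OF that(1) this, of "h t"] obtain x where
      x: "x \<in> chart_dom e" "x \<in> chart_dom (d k)" "fm (t, coord c q) + h t *\<^sub>R \<eta> (coord c q) = coord e x"
      using h_le[of t] \<delta>(4) by auto
    then have "\<Phi>' t q = x" using that(3) se(1) by (simp add: \<Phi>'_def)
    then show ?thesis using x(2) by simp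
  qed
  show ?thesis
    using reg' \<Phi>'0 vel' stay by (intro exI[of _ \<Phi>']) (auto simp: \<Phi>'_def)
qed

end

lemma smooth_on_prod:
  fixes u :: "nat \<Rightarrow> 'a::euclidean_space \<Rightarrow> real"
  assumes "open S" "\<And>i. i < n \<Longrightarrow> smooth_on S (u i)"
  shows "smooth_on S (\<lambda>x. \<Prod>i<n. u i x)"
  using assms(2)
proof (induction n)
  case 0
  then show ?case by (simp add: smooth_on_const assms(1))
next
  case (Suc n)
  then show ?case by (simp add: smooth_on_mult)
qed

text \<open>A countable cover by open sets \<open>U i\<close>, each with a bump function \<open>\<beta> i\<close> that equals \<open>1\<close> on
  it and is supported in a compact set \<open>K i\<close> that \<open>F\<close> maps into a single chart.\<close>

locale bump_cover = immersion_field A B F \<xi>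
  for A :: "('p::{t2_space,second_countable_topology}, 'e::euclidean_space) chart set"
    and B :: "('l::{t2_space,second_countable_topology}, 'a::euclidean_space) chart set"
    and F :: "'l \<Rightarrow> 'p" and \<xi> :: "('l, 'p, 'e) field_along" +
  fixes c :: "nat \<Rightarrow> ('l, 'a) chart" and e :: "nat \<Rightarrow> ('p, 'e) chart"
    and U K :: "nat \<Rightarrow> 'l set" and \<beta> :: "nat \<Rightarrow> 'l \<Rightarrow> real"
  assumes c: "c i \<in> B" and e: "e i \<in> A" and U: "open (U i)" "(\<Union>i. U i) = UNIV"
    and K: "compact (K i)" "K i \<subseteq> chart_dom (c i)" "F ` K i \<subseteq> chart_dom (e i)"
    and \<beta>: "q \<in> U i \<Longrightarrow> \<beta> i q = 1" "q \<notin> K i \<Longrightarrow> \<beta> i q = 0"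
    and \<beta>_smooth: "d \<in> B \<Longrightarrow> smooth_on (chart_img d) (\<lambda>y. \<beta> i (param d y))"
begin

text \<open>The functions \<open>\<psi> i = \<beta> i (1 - \<beta> 0) \<dots> (1 - \<beta> (i - 1))\<close> sum to \<open>1\<close>, and all of them from
  \<open>i = j + 1\<close> on vanish on \<open>U j\<close>.\<close>

definition \<psi> :: "nat \<Rightarrow> 'l \<Rightarrow> real" where "\<psi> i q = \<beta> i q * (\<Prod>j<i. 1 - \<beta> j q)"

definition \<rho> :: "nat \<Rightarrow> 'l \<Rightarrow> real" where "\<rho> i q = 1 - (\<Prod>j<i. 1 - \<beta> j q)"

definition S :: "nat \<Rightarrow> 'l set" where "S i = K i - (\<Union>j<i. U j)"

text \<open>Compactness in time costs a part of the time interval at every modification. The radii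
  decrease but stay above \<open>1\<close>, so that a common interval is left for the limit.\<close>

definition a :: "nat \<Rightarrow> real" where "a i = 1 + 1 / (real i + 1)"

lemma a_gt: "a i > 1" and a_decreasing: "a (Suc i) < a i"
  by (auto simp: a_def divide_simps algebra_simps)

lemma \<rho>_Suc: "\<rho> (Suc i) q = \<rho> i q + \<psi> i q"
  by (simp add: \<rho>_def \<psi>_def algebra_simps)

lemma \<rho>_one: "q \<in> U j \<Longrightarrow> j < i \<Longrightarrow> \<rho> i q = 1"
  using \<beta>(1) by (auto simp: \<rho>_def intro!: bexI[of _ j])

lemma \<psi>_zero: "q \<notin> S i \<Longrightarrow> \<psi> i q = 0"
  using \<beta> by (force simp: \<psi>_def S_def)

lemma S_compact: "compact (S i)"
  unfolding S_def using K(1) U(1) by (intro compact_diff open_UN) auto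

lemma S_subset: "S i \<subseteq> K i"
  by (auto simp: S_def)

text \<open>The compact set \<open>S i\<close> is covered by finitely many \<open>U j\<close>, and \<open>S k\<close> avoids \<open>U j\<close> for \<open>k > j\<close>.\<close>

lemma S_meets_finite: "finite {k. S k \<inter> S i \<noteq> {}}"
proof -
  have "S i \<subseteq> (\<Union>j\<in>UNIV. U j)" using U(2) by auto
  then obtain J where J: "finite J" "S i \<subseteq> (\<Union>j\<in>J. U j)"
    using compactE_image[OF S_compact, of UNIV U i] U(1) by auto
  have "{k. S k \<inter> S i \<noteq> {}} \<subseteq> (\<Union>j\<in>J. {..j})"
  proof
    fix k assume "k \<in> {k. S k \<inter> S i \<noteq> {}}"
    then obtain q where q: "q \<in> S k" "q \<in> S i" by auto
    then obtain j where "j \<in> J" "q \<in> U j" using J(2) by auto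
    then have "k \<le> j" using q(1) by (auto simp: S_def not_le[symmetric])
    then show "k \<in> (\<Union>j\<in>J. {..j})" using \<open>j \<in> J\<close> by auto
  qed
  then show ?thesis using J(1) finite_subset by blast
qed

lemma \<psi>_smooth: "d \<in> B \<Longrightarrow> smooth_on (chart_img d) (\<lambda>y. \<psi> i (param d y))"
  unfolding \<psi>_def
  by (intro smooth_on_mult smooth_on_prod smooth_on_diff smooth_on_const \<beta>_smooth
      chart_continuous(4) chart_B)

text \<open>After \<open>i\<close> modifications the velocity is \<open>\<rho> i \<xi> = (\<psi> 0 + \<dots> + \<psi> (i - 1)) \<xi>\<close>. The last condition keeps the points of
  every \<open>S k\<close> in the chart \<open>e k\<close>, as a later modification on \<open>S k\<close> needs it.\<close>

definition stage :: "nat \<Rightarrow> (real \<Rightarrow> 'l \<Rightarrow> 'p) \<Rightarrow> bool" where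
  "stage i \<Phi> \<longleftrightarrow> (\<forall>t q. \<bar>t\<bar> < a i \<longrightarrow> regular_at \<Phi> t q) \<and> \<Phi> 0 = F \<and> velocity \<Phi> (\<rho> i) \<and>
     (\<forall>k t q. \<bar>t\<bar> < a i \<longrightarrow> q \<in> S k \<longrightarrow> \<Phi> t q \<in> chart_dom (e k))"

lemma stage_0: "stage 0 (\<lambda>_. F)"
proof -
  have "F q \<in> chart_dom (e k)" if "q \<in> S k" for q k
    using K(3)[of k] S_subset[of k] that by blast
  then show ?thesis
    by (auto simp: stage_def velocity_def \<rho>_def regular_constant)
qed

text \<open>The modification on \<open>S i\<close> threatens the last condition only for the finitely many \<open>k\<close> for which \<open>S k\<close> meets \<open>S i\<close>.\<close>

lemma stage_Suc:
  assumes "stage i \<Phi>"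
  shows "\<exists>\<Phi>'. stage (Suc i) \<Phi>' \<and> (\<forall>t q. q \<notin> S i \<longrightarrow> \<Phi>' t q = \<Phi> t q)"
proof -
  have st: "\<And>t q. \<bar>t\<bar> < a i \<Longrightarrow> regular_at \<Phi> t q" "\<Phi> 0 = F" "velocity \<Phi> (\<rho> i)"
    "\<And>k t q. \<bar>t\<bar> < a i \<Longrightarrow> q \<in> S k \<Longrightarrow> \<Phi> t q \<in> chart_dom (e k)"
    using assms unfolding stage_def by blast+
  have "0 < a (Suc i)" using a_gt[of "Suc i"] by simp
  have "\<exists>\<Phi>'. (\<forall>t q. \<bar>t\<bar> < a (Suc i) \<longrightarrow> regular_at \<Phi>' t q) \<and> \<Phi>' 0 = F \<and>
    velocity \<Phi>' (\<lambda>q. \<rho> i q + \<psi> i q) \<and> (\<forall>t q. q \<notin> S i \<longrightarrow> \<Phi>' t q = \<Phi> t q) \<and>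
    (\<forall>k\<in>{k. S k \<inter> S i \<noteq> {}}. \<forall>t q. \<bar>t\<bar> < a (Suc i) \<longrightarrow> q \<in> S k \<inter> S i \<longrightarrow> \<Phi>' t q \<in> chart_dom (e k))"
  proof (rule modify_family[OF \<open>0 < a (Suc i)\<close> a_decreasing st(1,2,3) c e S_compact])
    show "S i \<subseteq> chart_dom (c i)" using S_subset K(2) by blast
    show "finite {k. S k \<inter> S i \<noteq> {}}" by (rule S_meets_finite)
  qed (use st(4) \<psi>_zero \<psi>_smooth[OF c] S_compact e in auto)
  then obtain \<Phi>' where \<Phi>': "\<And>t q. \<bar>t\<bar> < a (Suc i) \<Longrightarrow> regular_at \<Phi>' t q" "\<Phi>' 0 = F"
    "velocity \<Phi>' (\<lambda>q. \<rho> i q + \<psi> i q)" "\<And>t q. q \<notin> S i \<Longrightarrow> \<Phi>' t q = \<Phi> t q"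
    "\<And>k t q. \<bar>t\<bar> < a (Suc i) \<Longrightarrow> q \<in> S k \<Longrightarrow> q \<in> S i \<Longrightarrow> \<Phi>' t q \<in> chart_dom (e k)"
    by blast
  have "\<Phi>' t q \<in> chart_dom (e k)" if "\<bar>t\<bar> < a (Suc i)" "q \<in> S k" for k t q
  proof (cases "q \<in> S i")
    case False
    then show ?thesis using st(4)[of t q k] that a_decreasing[of i] \<Phi>'(4) by simp
  qed (use \<Phi>'(5) that in blast)
  then have "stage (Suc i) \<Phi>'" unfolding stage_def \<rho>_Suc[abs_def] using \<Phi>'(1-3) by blast
  then show ?thesis using \<Phi>'(4) by blast
qed

text \<open>On \<open>U j\<close> the sequence of families is constant from \<open>j + 1\<close> on, so that it has a limit, which is
  locally one of its members.\<close>

lemma limit_family: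
  "\<exists>\<Phi>. smooth_immersion_family B A 1 \<Phi> \<and> \<Phi> 0 = F \<and> velocity \<Phi> (\<lambda>_. 1)"
proof -
  obtain \<Phi> where \<Phi>: "\<And>n. stage n (\<Phi> n)" "\<And>n t q. q \<notin> S n \<Longrightarrow> \<Phi> (Suc n) t q = \<Phi> n t q"
    using dependent_nat_choice[of stage "\<lambda>n \<Phi> \<Phi>'. \<forall>t q. q \<notin> S n \<longrightarrow> \<Phi>' t q = \<Phi> t q"]
      stage_0 stage_Suc by blast
  have const: "\<Phi> n t q = \<Phi> (Suc j) t q" if "q \<in> U j" "Suc j \<le> n" for n j t q
    using that(2)
  proof (induction n rule: dec_induct)
    case (step n)
    then have "q \<notin> S n" using that(1) by (auto simp: S_def)
    then show ?case using \<Phi>(2) step by simp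
  qed simp
  define first where "first q = (LEAST j. q \<in> U j)" for q
  have first: "q \<in> U (first q)" "q \<in> U j \<Longrightarrow> first q \<le> j" for q j
  proof -
    have "\<exists>j. q \<in> U j" using U(2) by blast
    then show "q \<in> U (first q)" unfolding first_def by (rule LeastI_ex)
    show "q \<in> U j \<Longrightarrow> first q \<le> j" unfolding first_def by (rule Least_le)
  qed
  define \<Phi>\<^sub>L where "\<Phi>\<^sub>L t q = \<Phi> (Suc (first q)) t q" for t q
  have local: "\<Phi>\<^sub>L t q = \<Phi> (Suc j) t q" if "q \<in> U j" for t q j
    unfolding \<Phi>\<^sub>L_def using const[OF first(1)[of q], of "Suc j" t] first(2)[OF that] by simp
  have reg: "regular_at \<Phi>\<^sub>L t q" if "\<bar>t\<bar> < 1" for t q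
  proof (rule regular_at_local[of "\<Phi> (Suc (first q))" t q UNIV "U (first q)"])
    show "regular_at (\<Phi> (Suc (first q))) t q"
      using \<Phi>(1)[of "Suc (first q)"] that a_gt[of "Suc (first q)"] unfolding stage_def by simp
  qed (use U first(1) local in auto)
  have "\<Phi>\<^sub>L 0 = F" using \<Phi>(1) by (auto simp: \<Phi>\<^sub>L_def stage_def)
  moreover have "velocity \<Phi>\<^sub>L (\<lambda>_. 1)"
    unfolding velocity_def
  proof (intro ballI allI impI)
    fix d q assume "d \<in> A" "F q \<in> chart_dom d"
    then have "((\<lambda>t. coord d (\<Phi> (Suc (first q)) t q)) has_vector_derivative \<rho> (Suc (first q)) q *\<^sub>R \<xi> d q) (at 0)"
      using \<Phi>(1)[of "Suc (first q)"] unfolding stage_def velocity_def by blast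
    then show "((\<lambda>t. coord d (\<Phi>\<^sub>L t q)) has_vector_derivative 1 *\<^sub>R \<xi> d q) (at 0)"
      using \<rho>_one[OF first(1)[of q], of "Suc (first q)"] by (simp add: \<Phi>\<^sub>L_def)
  qed
  moreover have "smooth_immersion_family B A 1 \<Phi>\<^sub>L" by (rule regular_imp_family[OF _ reg]) auto
  ultimately show ?thesis by blast
qed

end

context immersion_field
begin

lemma coordinate_ball:
  obtains c e r where "c \<in> B" "e \<in> A" "q \<in> chart_dom c" "r > 0"
    "cball (coord c q) (2 * r) \<subseteq> coord c ` (chart_dom c \<inter> F -` chart_dom e)"
proof -
  define c where "c = chart_around B q"
  define e where "e = chart_around A (F q)"
  have c: "c \<in> B" "q \<in> chart_dom c" and e: "e \<in> A" "F q \<in> chart_dom e"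
    using chart_around[OF atlas_B] chart_around[OF atlas_A] by (auto simp: c_def e_def)
  have "open (coord c ` (chart_dom c \<inter> F -` chart_dom e))"
    by (rule smooth_on_open[OF immersion_smooth[OF immersion_F c(1) e(1)]])
  moreover have "coord c q \<in> coord c ` (chart_dom c \<inter> F -` chart_dom e)" using c e by auto
  ultimately obtain \<epsilon> where "\<epsilon> > 0" "cball (coord c q) \<epsilon> \<subseteq> coord c ` (chart_dom c \<inter> F -` chart_dom e)"
    using open_contains_cball by blast
  then show ?thesis using that[of c e "\<epsilon> / 2"] c e by simp
qed

text \<open>By the Lindelof property countably many coordinate balls suffice for the cover from which the limit
  family is constructed.\<close>

theorem field_is_velocity:
  "\<exists>\<Phi>. smooth_immersion_family B A 1 \<Phi> \<and> \<Phi> 0 = F \<and>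
     (\<forall>d\<in>A. \<forall>q. F q \<in> chart_dom d \<longrightarrow>
        ((\<lambda>t. coord d (\<Phi> t q)) has_vector_derivative \<xi> d q) (at 0))"
proof -
  have "\<forall>q. \<exists>c e r. c \<in> B \<and> e \<in> A \<and> q \<in> chart_dom c \<and> r > 0 \<and>
    cball (coord c q) (2 * r) \<subseteq> coord c ` (chart_dom c \<inter> F -` chart_dom e)"
    using coordinate_ball by metis
  then obtain c e r where ch: "\<And>q. c q \<in> B" "\<And>q. e q \<in> A" "\<And>q. q \<in> chart_dom (c q)" "\<And>q. r q > 0"
    and ball: "\<And>q. cball (coord (c q) q) (2 * r q) \<subseteq> coord (c q) ` (chart_dom (c q) \<inter> F -` chart_dom (e q))"
    by metis
  define U where "U q = chart_dom (c q) \<inter> coord (c q) -` ball (coord (c q) q) (r q)" for q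
  define K where "K q = param (c q) ` cball (coord (c q) q) (2 * r q)" for q
  define \<beta> where "\<beta> q x = (if x \<in> chart_dom (c q) then ball_bump (coord (c q) q) (r q) (coord (c q) x) else 0)" for q x
  have U: "open (U q)" for q
    unfolding U_def
    by (intro continuous_open_preimage chart_continuous chart_B ch) auto
  have qU: "q \<in> U q" for q using ch by (simp add: U_def)
  have in_K: "x \<in> K q \<longleftrightarrow> x \<in> chart_dom (c q) \<and> coord (c q) x \<in> cball (coord (c q) q) (2 * r q)" for q x
  proof -
    note s = chart_simps[OF chart_B[OF ch(1)[of q]]]
    have sub: "cball (coord (c q) q) (2 * r q) \<subseteq> chart_img (c q)"
      using ball[of q] by (auto simp: chart_img_def)
    show ?thesis
    proof
      assume "x \<in> K q"
      then obtain y where y: "y \<in> cball (coord (c q) q) (2 * r q)" "x = param (c q) y" unfolding K_def by blast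
      then show "x \<in> chart_dom (c q) \<and> coord (c q) x \<in> cball (coord (c q) q) (2 * r q)"
        using sub s(3)[of y] s(4)[of y] by auto
    next
      assume "x \<in> chart_dom (c q) \<and> coord (c q) x \<in> cball (coord (c q) q) (2 * r q)"
      then show "x \<in> K q" unfolding K_def using s(1)[of x] by (metis imageI)
    qed
  qed
  have K: "compact (K q)" "K q \<subseteq> chart_dom (c q)" "F ` K q \<subseteq> chart_dom (e q)" for q
  proof -
    have "cball (coord (c q) q) (2 * r q) \<subseteq> chart_img (c q)"
      using ball[of q] by (auto simp: chart_img_def)
    then show "compact (K q)" unfolding K_def
      by (intro compact_continuous_image continuous_on_subset[OF chart_continuous(2)[OF chart_B[OF ch(1)]]] compact_cball)
    show "K q \<subseteq> chart_dom (c q)" using in_K by blast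
    show "F ` K q \<subseteq> chart_dom (e q)"
    proof (rule image_subsetI)
      fix x assume "x \<in> K q"
      then have x: "x \<in> chart_dom (c q)" "coord (c q) x \<in> coord (c q) ` (chart_dom (c q) \<inter> F -` chart_dom (e q))"
        using in_K ball by blast+
      then show "F x \<in> chart_dom (e q)" using chart_coord_inj[OF chart_B[OF ch(1)]] by blast
    qed
  qed
  have \<beta>1: "\<beta> q x = 1" if "x \<in> U q" for q x
    using that ch by (simp add: \<beta>_def U_def ball_bump_one)
  have \<beta>0: "\<beta> q x = 0" if "x \<notin> K q" for q x
    using that ch by (auto simp: \<beta>_def in_K intro!: ball_bump_zero)
  have \<beta>_smooth: "smooth_on (chart_img d) (\<lambda>y. \<beta> q (param d y))" if d: "d \<in> B" for d q
  proof (rule smooth_on_local)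
    note sd = chart_simps[OF chart_B[OF d]]
    fix y assume y: "y \<in> chart_img d"
    show "\<exists>N. y \<in> N \<and> N \<subseteq> chart_img d \<and> smooth_on N (\<lambda>y. \<beta> q (param d y))"
    proof (cases "param d y \<in> chart_dom (c q)")
      case True
      let ?N = "coord d ` (chart_dom d \<inter> chart_dom (c q))"
      have tr: "smooth_on ?N (transition d (c q))"
        using atlas_B d ch(1) unfolding smooth_atlas_def by blast
      have "smooth_on ?N (\<lambda>y. ball_bump (coord (c q) q) (r q) (transition d (c q) y))"
        by (rule smooth_on_compose[OF smooth_on_ball_bump[OF open_UNIV] tr]) auto
      then have "smooth_on ?N (\<lambda>y. \<beta> q (param d y))"
        by (rule smooth_on_cong) (auto simp: \<beta>_def transition_def sd(1))
      moreover have "y \<in> ?N" using True y sd by (metis IntI imageI)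
      ultimately show ?thesis by (intro exI[of _ ?N]) (auto simp: chart_img_def)
    next
      case False
      let ?N = "coord d ` (chart_dom d \<inter> - K q)"
      have "open ?N" by (intro chart_open_image chart_B d open_Compl compact_imp_closed K)
      then have "smooth_on ?N (\<lambda>y. \<beta> q (param d y))"
        by (rule smooth_on_cong[OF smooth_on_const[of _ 0]]) (auto simp: sd(1) \<beta>0)
      moreover have "y \<in> ?N" using False y sd in_K by (metis ComplI IntI imageI)
      ultimately show ?thesis by (intro exI[of _ ?N]) (auto simp: chart_img_def)
    qed
  qed
  obtain \<U> where \<U>: "\<U> \<subseteq> range U" "countable \<U>" "\<Union>\<U> = \<Union>(range U)"
    using Lindelof[of "range U"] U by blast
  then obtain Q where Q: "countable Q" "\<U> = U ` Q" by (meson countable_subset_image)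
  have cover: "(\<Union>q\<in>Q. U q) = UNIV" using \<U>(3) Q(2) qU by blast
  then have "Q \<noteq> {}" by blast
  define p where "p = from_nat_into Q"
  have "range p = Q" unfolding p_def by (rule range_from_nat_into[OF \<open>Q \<noteq> {}\<close> Q(1)])
  then have cover': "(\<Union>i. U (p i)) = UNIV" using cover by (metis image_image)
  interpret bump_cover A B F \<xi> "\<lambda>i. c (p i)" "\<lambda>i. e (p i)" "\<lambda>i. U (p i)" "\<lambda>i. K (p i)" "\<lambda>i. \<beta> (p i)"
    by unfold_locales (use ch U cover' K \<beta>1 \<beta>0 \<beta>_smooth in auto)
  show ?thesis using limit_family unfolding velocity_def by simp
qed

end

section \<open>The deformation equation\<close>

context special_lagrangian_field
begin

lemma immersion_field: "immersion_field A B F \<xi>"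
  using atlas_A atlas_B immersion_F normal unfolding normal_field_def
  by (intro immersion_field.intro) blast+

definition initial_velocity :: "real \<Rightarrow> (real \<Rightarrow> 'l \<Rightarrow> 'p) \<Rightarrow> bool" where
  "initial_velocity \<epsilon> \<Phi> \<longleftrightarrow> smooth_immersion_family B A \<epsilon> \<Phi> \<and> \<Phi> 0 = F \<and>
     (\<forall>d\<in>A. \<forall>q. F q \<in> chart_dom d \<longrightarrow> ((\<lambda>t. coord d (\<Phi> t q)) has_vector_derivative \<xi> d q) (at 0))"

lemma initial_velocity_exists: "\<exists>\<epsilon> \<Phi>. initial_velocity \<epsilon> \<Phi>"
  using immersion_field.field_is_velocity[OF immersion_field] unfolding initial_velocity_def by blast

text \<open>Both the weighted codifferential and the first variation of \<open>Im (e\<^bsup>-i\<theta>\<^esup> \<Omega>)\<close> are multiples of \<open>density\<close>. It refers to a chart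
  of the ambient manifold and therefore appears as an anonymous number \<open>k\<close>.\<close>

lemma variation_at_point:
  assumes c: "c \<in> B" and y: "y \<in> chart_img c"
  obtains k r where "r \<noteq> 0"
    and "\<And>w. codiff_weighted (induced_metric A g F c) (f \<circ> F \<circ> param c) 1 (omega_tilde A g F \<xi> c) y w = r * k"
    and "\<And>\<epsilon> \<Phi> v. initial_velocity \<epsilon> \<Phi> \<Longrightarrow>
      ((\<lambda>t. pullback A (\<Phi> t) (kaehler_form g) c y v) has_real_derivative
        ext_deriv 1 (omega_tilde A g F \<xi> c) y v) (at 0)"
    and "\<And>\<epsilon> \<Phi> v. initial_velocity \<epsilon> \<Phi> \<Longrightarrow>
      ((\<lambda>t. pullback A (\<Phi> t) (Im_phase \<theta> \<Omega>) c y v) has_real_derivative k * det (frame_matrix v)) (at 0)"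
proof -
  define d where "d = chart_around A (F (param c y))"
  have d: "d \<in> A" "F (param c y) \<in> chart_dom d"
    using chart_around[OF atlas_A] by (auto simp: d_def)
  have yN: "y \<in> N c d" using N_iff[OF c d(1)] y d(2) by blast
  interpret P: calibrated_plane "g d (\<phi> c d y)" "\<Omega> d (\<phi> c d y)" "exp (- u c y)"
      "frechet_derivative (\<phi> c d) (at y)" phase
    by (rule calibrated_plane_at[OF c d(1) yN])
  show ?thesis
  proof (rule that)
    show "exp (u c y / 2) / sqrt P.tangent.gram \<noteq> 0" using P.tangent.gram_pos by simp
    show "codiff_weighted (induced_metric A g F c) (f \<circ> F \<circ> param c) 1 (omega_tilde A g F \<xi> c) y w =
        exp (u c y / 2) / sqrt P.tangent.gram * density c d y" for w
      using codiff_weighted_eq[OF c d(1) yN, of w] by (simp add: u_def[OF c d(1)])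
    fix \<epsilon> \<Phi> v assume "initial_velocity \<epsilon> \<Phi>"
    then have "smooth_immersion_family B A \<epsilon> \<Phi>" "\<Phi> 0 = F"
      "\<And>d q. d \<in> A \<Longrightarrow> F q \<in> chart_dom d \<Longrightarrow>
        ((\<lambda>t. coord d (\<Phi> t q)) has_vector_derivative \<xi> d q) (at 0)"
      unfolding initial_velocity_def by blast+
    from first_variation[OF c d(1) this yN, of v]
    show "((\<lambda>t. pullback A (\<Phi> t) (kaehler_form g) c y v) has_real_derivative
        ext_deriv 1 (omega_tilde A g F \<xi> c) y v) (at 0)"
      "((\<lambda>t. pullback A (\<Phi> t) (Im_phase \<theta> \<Omega>) c y v) has_real_derivative
        density c d y * det (frame_matrix v)) (at 0)"
      by blast+
  qed
qed

lemma variation_vanishes_iff: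
  assumes vel: "initial_velocity \<epsilon> \<Phi>" and c: "c \<in> B" and y: "y \<in> chart_img c"
  shows "(\<forall>v. ((\<lambda>t. pullback A (\<Phi> t) (kaehler_form g) c y v) has_real_derivative 0) (at 0) \<and>
      ((\<lambda>t. pullback A (\<Phi> t) (Im_phase \<theta> \<Omega>) c y v) has_real_derivative 0) (at 0)) \<longleftrightarrow>
    (\<forall>v. ext_deriv 1 (omega_tilde A g F \<xi> c) y v = 0 \<and>
      codiff_weighted (induced_metric A g F c) (f \<circ> F \<circ> param c) 1 (omega_tilde A g F \<xi> c) y v = 0)"
proof (rule variation_at_point[OF c y])
  fix k r :: real
  assume r: "r \<noteq> 0"
    and codiff: "\<And>w. codiff_weighted (induced_metric A g F c) (f \<circ> F \<circ> param c) 1 (omega_tilde A g F \<xi> c) y w = r * k"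
    and kaehler: "\<And>\<epsilon> \<Phi> v. initial_velocity \<epsilon> \<Phi> \<Longrightarrow>
    ((\<lambda>t. pullback A (\<Phi> t) (kaehler_form g) c y v) has_real_derivative
      ext_deriv 1 (omega_tilde A g F \<xi> c) y v) (at 0)"
    and Im: "\<And>\<epsilon> \<Phi> v. initial_velocity \<epsilon> \<Phi> \<Longrightarrow>
    ((\<lambda>t. pullback A (\<Phi> t) (Im_phase \<theta> \<Omega>) c y v) has_real_derivative k * det (frame_matrix v)) (at 0)"
  have kaehler_iff: "((\<lambda>t. pullback A (\<Phi> t) (kaehler_form g) c y v) has_real_derivative 0) (at 0) \<longleftrightarrow>
      ext_deriv 1 (omega_tilde A g F \<xi> c) y v = 0" for v
  proof
    assume "((\<lambda>t. pullback A (\<Phi> t) (kaehler_form g) c y v) has_real_derivative 0) (at 0)"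
    from DERIV_unique[OF kaehler[OF vel] this] show "ext_deriv 1 (omega_tilde A g F \<xi> c) y v = 0" .
  next
    assume "ext_deriv 1 (omega_tilde A g F \<xi> c) y v = 0"
    from kaehler[OF vel, of v, unfolded this]
    show "((\<lambda>t. pullback A (\<Phi> t) (kaehler_form g) c y v) has_real_derivative 0) (at 0)" .
  qed
  have Im_iff: "(\<forall>v. ((\<lambda>t. pullback A (\<Phi> t) (Im_phase \<theta> \<Omega>) c y v) has_real_derivative 0) (at 0)) \<longleftrightarrow> k = 0"
  proof
    assume "\<forall>v. ((\<lambda>t. pullback A (\<Phi> t) (Im_phase \<theta> \<Omega>) c y v) has_real_derivative 0) (at 0)"
    then have "((\<lambda>t. pullback A (\<Phi> t) (Im_phase \<theta> \<Omega>) c y axis_seq) has_real_derivative 0) (at 0)" by blast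
    from DERIV_unique[OF Im[OF vel] this] show "k = 0" by simp
  next
    assume "k = 0"
    then show "\<forall>v. ((\<lambda>t. pullback A (\<Phi> t) (Im_phase \<theta> \<Omega>) c y v) has_real_derivative 0) (at 0)"
      using Im[OF vel] by simp
  qed
  show ?thesis unfolding all_conj_distrib kaehler_iff Im_iff codiff using r by simp
qed

end

theorem lemma4p3:
  fixes A :: "('p::{t2_space,second_countable_topology}, complex^'m::{finite,linorder}) chart set"
    and g :: "('p, complex^'m::{finite,linorder}) tensor2"
    and f :: "'p \<Rightarrow> real"
    and \<Omega> :: "('p, complex^'m::{finite,linorder}, complex) form"
    and B :: "('l::{t2_space,second_countable_topology}, real^'m::{finite,linorder}) chart set"
    and F :: "'l \<Rightarrow> 'p"
    and \<theta> :: real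
    and \<xi> :: "('l, 'p, complex^'m::{finite,linorder}) field_along"
  assumes "gradient_steady_soliton A g f"
    and "soliton_volume_form A g f \<Omega>"
    and "f_special_lagrangian A g f \<Omega> B F \<theta>"
    and "normal_field A g B F \<xi>"
  shows "f_SL_deformation_field A g \<Omega> B F \<theta> \<xi> \<longleftrightarrow>
    (\<forall>c\<in>B. \<forall>y\<in>chart_img c. \<forall>v.
       ext_deriv 1 (omega_tilde A g F \<xi> c) y v = 0 \<and>
       codiff_weighted (induced_metric A g F c) (f \<circ> F \<circ> param c) 1
         (omega_tilde A g F \<xi> c) y v = 0)" (is "_ \<longleftrightarrow> ?harmonic")
proof -
  interpret special_lagrangian_field A g f \<Omega> B F \<theta> \<xi>
    using assms by (rule special_lagrangian_field.intro)
  have deformation: "f_SL_deformation_field A g \<Omega> B F \<theta> \<xi> \<longleftrightarrow> (\<exists>\<epsilon> \<Phi>. initial_velocity \<epsilon> \<Phi> \<and>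
      (\<forall>c\<in>B. \<forall>y\<in>chart_img c. \<forall>v.
        ((\<lambda>t. pullback A (\<Phi> t) (kaehler_form g) c y v) has_real_derivative 0) (at 0) \<and>
        ((\<lambda>t. pullback A (\<Phi> t) (Im_phase \<theta> \<Omega>) c y v) has_real_derivative 0) (at 0)))"
    unfolding f_SL_deformation_field_def initial_velocity_def by (simp only: conj_assoc)
  also have "\<dots> \<longleftrightarrow> (\<exists>\<epsilon> \<Phi>. initial_velocity \<epsilon> \<Phi> \<and> ?harmonic)"
  proof (intro ex_cong1 conj_cong refl ball_cong)
    fix \<epsilon> \<Phi> c y assume "initial_velocity \<epsilon> \<Phi>" "c \<in> B" "y \<in> chart_img c"
    then show "(\<forall>v. ((\<lambda>t. pullback A (\<Phi> t) (kaehler_form g) c y v) has_real_derivative 0) (at 0) \<and>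
          ((\<lambda>t. pullback A (\<Phi> t) (Im_phase \<theta> \<Omega>) c y v) has_real_derivative 0) (at 0)) \<longleftrightarrow>
        (\<forall>v. ext_deriv 1 (omega_tilde A g F \<xi> c) y v = 0 \<and>
          codiff_weighted (induced_metric A g F c) (f \<circ> F \<circ> param c) 1 (omega_tilde A g F \<xi> c) y v = 0)"
      by (rule variation_vanishes_iff)
  qed
  also have "\<dots> \<longleftrightarrow> ?harmonic" using initial_velocity_exists by blast
  finally show ?thesis .
qed

end
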